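(* Let $W$ be a complex reflection group with braid group $B$ and pure braid group $P$. Assume that $Z(W)=1$, and that $G$ is a finite subgroup of $W$ acting freely by conjugation on $\mathcal{R}^*$. Then there is a finite subgroup of $B/(P,P)$ which is mapped isomorphically onto $G$ by the projection $\pi:B/(P,P)\to W/Z(W)=W$.
   Context: A complex reflection group is a finite subgroup $W<\mathrm{GL}_n(\mathbf{C})$ generated by (pseudo-)reflections, i.e. elements $\neq 1$ fixing pointwise a hyperplane. $\mathcal{A}$ is the set of reflecting hyperplanes of $W$, and $X=\mathbf{C}^n\setminus\bigcup\mathcal{A}$. The group $W$ acts freely on $X$; $P=\pi_1(X)$ (pure braid group) and $B=\pi_1(X/W)$ (braid group), so there is an exact sequence $1\to P\to B\to W\to 1$. $(P,P)$ is the commutator subgroup of $P$. $Z(W)$ is the center of $W$. $\mathcal{R}^*$ is the set of distinguished reflections of $W$: those reflections $s\in W$ whose eigenvalues are $1$ and $e^{2\pi\mathrm{i}/m}$, where $m$ is the order of the (cyclic) subgroup of $W$ fixing $\mathrm{Ker}(s-1)$ pointwise. The map $s\mapsto\mathrm{Ker}(s-1)$ is a $W$-equivariant bijection $\mathcal{R}^*\to\mathcal{A}$. *)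

theory Defs
  imports "HOL-Analysis.Analysis" "HOL-Algebra.Coset" "HOL-Algebra.Generated_Groups"
    "HOL-Algebra.Group_Action"
begin

section \<open>Quotient topologies and fundamental groups of abstract topologies\<close>

definition quotient_topology :: "'a topology \<Rightarrow> ('a \<Rightarrow> 'b) \<Rightarrow> 'b topology" where
  "quotient_topology T f =
     topology (\<lambda>V. V \<subseteq> f ` topspace T \<and> openin T {x \<in> topspace T. f x \<in> V})"

lemma openin_quotient_topology:
  fixes f :: "'a \<Rightarrow> 'b"
  shows "openin (quotient_topology T f) V \<longleftrightarrow>
     V \<subseteq> f ` topspace T \<and> openin T {x \<in> topspace T. f x \<in> V}"
proof -
  have "istopology (\<lambda>V. V \<subseteq> f ` topspace T \<and> openin T {x \<in> topspace T. f x \<in> V})"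
    unfolding istopology_def
  proof (intro conjI allI impI)
    fix S S' :: "'b set"
    assume S: "S \<subseteq> f ` topspace T \<and> openin T {x \<in> topspace T. f x \<in> S}"
      and S': "S' \<subseteq> f ` topspace T \<and> openin T {x \<in> topspace T. f x \<in> S'}"
    have "{x \<in> topspace T. f x \<in> S \<inter> S'} =
        {x \<in> topspace T. f x \<in> S} \<inter> {x \<in> topspace T. f x \<in> S'}"
      by blast
    then show "openin T {x \<in> topspace T. f x \<in> S \<inter> S'}"
      using S S' by auto
    show "S \<inter> S' \<subseteq> f ` topspace T"
      using S by blast
  next
    fix K :: "'b set set"
    assume K: "\<forall>S\<in>K. S \<subseteq> f ` topspace T \<and> openin T {x \<in> topspace T. f x \<in> S}"
    have "{x \<in> topspace T. f x \<in> \<Union>K} = (\<Union>S\<in>K. {x \<in> topspace T. f x \<in> S})"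
      by blast
    then show "openin T {x \<in> topspace T. f x \<in> \<Union>K}"
      using K by auto
    show "\<Union>K \<subseteq> f ` topspace T"
      using K by blast
  qed
  then show ?thesis
    by (simp add: quotient_topology_def topology_inverse')
qed

lemma topspace_quotient_topology: "topspace (quotient_topology T f) = f ` topspace T"
proof -
  have "{x \<in> topspace T. f x \<in> f ` topspace T} = topspace T"
    by blast
  then have "openin (quotient_topology T f) (f ` topspace T)"
    by (simp add: openin_quotient_topology)
  then show ?thesis
    by (meson openin_quotient_topology openin_subset openin_topspace subset_antisym)
qed

lemma quotient_map_quotient_topology: "quotient_map T (quotient_topology T f) f"
  by (simp add: quotient_map_def topspace_quotient_topology openin_quotient_topology)

text \<open>The library's \<open>joinpaths\<close> and \<open>homotopic_paths\<close> require the points to form a topological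
  type, which the orbits of a group do not; the following are their versions for abstract
  topologies.\<close>

definition path_join :: "(real \<Rightarrow> 'a) \<Rightarrow> (real \<Rightarrow> 'a) \<Rightarrow> real \<Rightarrow> 'a" where
  "path_join p q = (\<lambda>t. if t \<le> 1/2 then p (2 * t) else q (2 * t - 1))"

definition loops_at :: "'a topology \<Rightarrow> 'a \<Rightarrow> (real \<Rightarrow> 'a) set" where
  "loops_at T x = {p. pathin T p \<and> p 0 = x \<and> p 1 = x}"

definition loop_homotopy_rel :: "'a topology \<Rightarrow> 'a \<Rightarrow> ((real \<Rightarrow> 'a) \<times> (real \<Rightarrow> 'a)) set" where
  "loop_homotopy_rel T x =
     {(p, q) \<in> loops_at T x \<times> loops_at T x.
        homotopic_with (\<lambda>r. r 0 = x \<and> r 1 = x) (top_of_set {0..1}) T p q}"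

lemma equiv_loop_homotopy_rel: "equiv (loops_at T x) (loop_homotopy_rel T x)"
proof (rule equivI)
  show "loop_homotopy_rel T x \<subseteq> loops_at T x \<times> loops_at T x"
    by (auto simp: loop_homotopy_rel_def)
  show "refl_on (loops_at T x) (loop_homotopy_rel T x)"
    by (auto simp: refl_on_def loop_homotopy_rel_def loops_at_def pathin_def)
  show "sym (loop_homotopy_rel T x)"
    by (auto simp: sym_def loop_homotopy_rel_def homotopic_with_sym)
  show "trans (loop_homotopy_rel T x)"
    by (auto simp: trans_def loop_homotopy_rel_def intro: homotopic_with_trans)
qed

definition fundamental_group :: "'a topology \<Rightarrow> 'a \<Rightarrow> (real \<Rightarrow> 'a) set monoid" where
  "fundamental_group T x =
     \<lparr>carrier = loops_at T x // loop_homotopy_rel T x,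
      mult = (\<lambda>a b. \<Union>p\<in>a. \<Union>q\<in>b. loop_homotopy_rel T x `` {path_join p q}),
      one = loop_homotopy_rel T x `` {\<lambda>_. x}\<rparr>"

text \<open>The homomorphism into the fundamental group of \<open>T\<close> at \<open>f x\<close> induced by a continuous map
  \<open>f\<close>.\<close>

definition fundamental_group_map ::
  "'b topology \<Rightarrow> 'b \<Rightarrow> ('a \<Rightarrow> 'b) \<Rightarrow> (real \<Rightarrow> 'a) set \<Rightarrow> (real \<Rightarrow> 'b) set" where
  "fundamental_group_map T y f a = (\<Union>p\<in>a. loop_homotopy_rel T y `` {f \<circ> p})"


section \<open>Complex reflection groups\<close>

definition general_linear :: "(complex^'n^'n) monoid" where
  "general_linear = \<lparr>carrier = {A. invertible A}, mult = (**), one = mat 1\<rparr>"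

abbreviation matrix_group :: "(complex^'n^'n) set \<Rightarrow> (complex^'n^'n) monoid" where
  "matrix_group W \<equiv> general_linear\<lparr>carrier := W\<rparr>"

definition group_center :: "('a, 'b) monoid_scheme \<Rightarrow> 'a set" where
  "group_center G = {z \<in> carrier G. \<forall>g\<in>carrier G. z \<otimes>\<^bsub>G\<^esub> g = g \<otimes>\<^bsub>G\<^esub> z}"

text \<open>The kernel of \<open>s - 1\<close>.\<close>

definition fixed_space :: "complex^'n^'n \<Rightarrow> (complex^'n) set" where
  "fixed_space s = {v. s *v v = v}"

definition is_hyperplane :: "(complex^'n) set \<Rightarrow> bool" where
  "is_hyperplane H \<longleftrightarrow> vec.subspace H \<and> vec.dim H + 1 = CARD('n)"

definition is_reflection :: "complex^'n^'n \<Rightarrow> bool" where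
  "is_reflection s \<longleftrightarrow>
     invertible s \<and> s \<noteq> mat 1 \<and> (\<exists>H. is_hyperplane H \<and> (\<forall>v\<in>H. s *v v = v))"

definition complex_reflection_group :: "(complex^'n^'n) set \<Rightarrow> bool" where
  "complex_reflection_group W \<longleftrightarrow>
     subgroup W general_linear \<and> finite W \<and>
     generate general_linear {s \<in> W. is_reflection s} = W"

definition reflecting_hyperplanes :: "(complex^'n^'n) set \<Rightarrow> (complex^'n) set set" where
  "reflecting_hyperplanes W = fixed_space ` {s \<in> W. is_reflection s}"

definition matrix_eigenvalues :: "complex^'n^'n \<Rightarrow> complex set" where
  "matrix_eigenvalues s = {c. \<exists>v. v \<noteq> 0 \<and> s *v v = c *s v}"

text \<open>In rank 1 the number 1 has multiplicity 0 as an eigenvalue of a reflection; this is why it is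
  inserted on the left-hand side below. In higher rank the insertion changes nothing.\<close>

definition distinguished_reflections :: "(complex^'n^'n) set \<Rightarrow> (complex^'n^'n) set" where
  "distinguished_reflections W =
     {s \<in> W. is_reflection s \<and>
        insert 1 (matrix_eigenvalues s) =
          {1, exp (2 * of_real pi * \<i> / of_nat (card {w \<in> W. \<forall>v\<in>fixed_space s. w *v v = v}))}}"

definition acts_freely_by_conjugation ::
  "(complex^'n^'n) set \<Rightarrow> (complex^'n^'n) set \<Rightarrow> bool" where
  "acts_freely_by_conjugation G S \<longleftrightarrow>
     (\<forall>g\<in>G. \<forall>s\<in>S. g ** s ** matrix_inv g = s \<longrightarrow> g = mat 1)"


section \<open>Braid groups\<close>

definition hyperplane_complement :: "(complex^'n^'n) set \<Rightarrow> (complex^'n) set" where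
  "hyperplane_complement W = UNIV - \<Union>(reflecting_hyperplanes W)"

definition orbit_map :: "(complex^'n^'n) set \<Rightarrow> complex^'n \<Rightarrow> (complex^'n) set" where
  "orbit_map W = orbit (matrix_group W) (*v)"

definition orbit_space :: "(complex^'n^'n) set \<Rightarrow> (complex^'n) set topology" where
  "orbit_space W = quotient_topology (top_of_set (hyperplane_complement W)) (orbit_map W)"

definition pure_braid_group ::
  "(complex^'n^'n) set \<Rightarrow> complex^'n \<Rightarrow> (real \<Rightarrow> complex^'n) set monoid" where
  "pure_braid_group W x = fundamental_group (top_of_set (hyperplane_complement W)) x"

definition braid_group ::
  "(complex^'n^'n) set \<Rightarrow> complex^'n \<Rightarrow> (real \<Rightarrow> (complex^'n) set) set monoid" where
  "braid_group W x = fundamental_group (orbit_space W) (orbit_map W x)"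

definition pure_braid_inclusion ::
  "(complex^'n^'n) set \<Rightarrow> complex^'n \<Rightarrow>
     (real \<Rightarrow> complex^'n) set \<Rightarrow> (real \<Rightarrow> (complex^'n) set) set" where
  "pure_braid_inclusion W x =
     fundamental_group_map (orbit_space W) (orbit_map W x) (orbit_map W)"

text \<open>The projection of the braid group onto \<open>W\<close> sends a class to the unique \<open>w\<close> such that the
  lifts starting at \<open>x\<close> of its loops end at \<open>w x\<close>. Since \<open>path_join p q\<close> runs through \<open>p\<close>
  first, this is a homomorphism (not an antihomomorphism): if \<open>p\<close> and \<open>q\<close> lift to paths ending
  at \<open>v x\<close> and \<open>w x\<close>, then the join lifts to the lift of \<open>p\<close> followed by the \<open>v\<close>-translate of
  the lift of \<open>q\<close>, which ends at \<open>v w x\<close>.\<close>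

definition braid_projection ::
  "(complex^'n^'n) set \<Rightarrow> complex^'n \<Rightarrow> (real \<Rightarrow> (complex^'n) set) set \<Rightarrow> complex^'n^'n" where
  "braid_projection W x b =
     (THE w. w \<in> W \<and>
        (\<exists>p. pathin (top_of_set (hyperplane_complement W)) p \<and>
             p 0 = x \<and> p 1 = w *v x \<and> orbit_map W \<circ> p \<in> b))"

text \<open>The commutator subgroup \<open>(P, P)\<close> of the pure braid group \<open>P\<close>, as a subgroup of the braid
  group, and the quotient of the braid group by it.\<close>

definition pure_braid_commutators ::
  "(complex^'n^'n) set \<Rightarrow> complex^'n \<Rightarrow> (real \<Rightarrow> (complex^'n) set) set set" where
  "pure_braid_commutators W x =
     pure_braid_inclusion W x ` derived (pure_braid_group W x) (carrier (pure_braid_group W x))"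

definition relative_abelianization ::
  "(complex^'n^'n) set \<Rightarrow> complex^'n \<Rightarrow> (real \<Rightarrow> (complex^'n) set) set set monoid" where
  "relative_abelianization W x = braid_group W x Mod pure_braid_commutators W x"

text \<open>The map induced by \<open>braid_projection\<close> on cosets.\<close>

definition relative_abelianization_projection ::
  "(complex^'n^'n) set \<Rightarrow> complex^'n \<Rightarrow> (real \<Rightarrow> (complex^'n) set) set set \<Rightarrow> complex^'n^'n" where
  "relative_abelianization_projection W x c = the_elem (braid_projection W x ` c)"

end

theory Submission
  imports Defs "HOL-Complex_Analysis.Complex_Analysis" "HOL-Algebra.FiniteProduct" "HOL-Library.Function_Algebras"
begin

text \<open>
  Write \<open>P = \<pi>\<^sub>1(X)\<close> for the pure braid group and \<open>B = \<pi>\<^sub>1(X/W)\<close> for the braid group. Two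
  facts, one about \<open>G\<close> and one about \<open>P\<close>, carry the proof.

  \<^item> A group \<open>G\<close> that acts freely by conjugation on the distinguished reflections acts freely on the
    reflecting hyperplanes (\<open>free_on_hyperplanes\<close>): an element stabilizing a hyperplane commutes
    with the reflections along it. Hence one can choose defining forms \<open>a\<^sub>H\<close> of the hyperplanes which
    are permuted by \<open>G\<close> without scalar factors: \<open>a\<^bsub>gH\<^esub>(g v) = a\<^sub>H(v)\<close> (\<open>equivariant_forms\<close>).

  \<^item> A loop in \<open>X\<close> represents an element of \<open>(P, P)\<close> if and only if its winding numbers around all
    hyperplanes, that is, the winding numbers of its images under the forms \<open>a\<^sub>H\<close>, vanish
    (\<open>braid_in_commutators_iff\<close>), and all integer vectors occur as winding numbers
    (\<open>winding_vectors_realized\<close>).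

  An element of \<open>B\<close> above \<open>g \<in> G\<close> is the class of a path \<open>p\<close> in \<open>X\<close> from the base point \<open>x\<close> to \<open>g x\<close>. Fix
  a logarithm \<open>\<lambda>\<^sub>H\<close> of each \<open>a\<^sub>H(x)\<close>, divided by \<open>2\<pi>i\<close>. Along \<open>p\<close> the logarithm of \<open>a\<^bsub>gH\<^esub>\<close> starts at \<open>\<lambda>\<^bsub>gH\<^esub>\<close> and
  arrives at some logarithm of \<open>a\<^bsub>gH\<^esub>(g x) = a\<^sub>H(x)\<close>. Call \<open>p\<close> calibrated if it arrives at \<open>\<lambda>\<^sub>H\<close>, for all \<open>H\<close>.
  Composites and inverses of calibrated paths are calibrated, since \<open>G\<close> permutes the forms; so the
  calibrated braids form a subgroup \<open>E\<close> of \<open>B\<close>. Every \<open>g \<in> G\<close> has a calibrated path, because an arbitrary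
  path from \<open>x\<close> to \<open>g x\<close> misses the condition by an integer vector, which a loop at \<open>x\<close> corrects. A
  calibrated loop has winding numbers zero, so \<open>E \<inter> P\<close> lies in \<open>(P, P)\<close>. Therefore the image of \<open>E\<close> in
  \<open>B/(P, P)\<close> maps isomorphically onto \<open>G\<close>.

  Two ingredients are of independent interest. That loops with vanishing winding numbers are
  trivial in the abelianized fundamental group (\<open>zero_windings_imp_trivial\<close>) is proved by sweeping
  \<open>X\<close> with the complex lines through a point in general position, which reduces the claim to finitely
  many punctures in the plane (\<open>path_functional_punctured_convex\<close>). That \<open>B\<close> is described by paths in
  \<open>X\<close> requires that \<open>W\<close> acts freely on \<open>X\<close> (\<open>stabilizer_trivial\<close>); this case of Steinberg's theorem is
  proved by comparing polynomial functions on two orbits.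
\<close>

section \<open>The fundamental group of an abstract topological space\<close>

text \<open>Maps of the unit interval with the same end points are linearly homotopic, and composition with
  \<open>p\<close> carries the homotopy to any topological space. The maps need not be monotone; this is what
  makes a path followed by its reverse an instance.\<close>

lemma homotopic_reparametrizations:
  fixes f g :: "real \<Rightarrow> real"
  assumes p: "pathin T p"
    and f: "continuous_on {0..1} f" "f \<in> {0..1} \<rightarrow> {0..1}"
    and g: "continuous_on {0..1} g" "g \<in> {0..1} \<rightarrow> {0..1}"
    and ends: "f 0 = g 0" "f 1 = g 1" "p (f 0) = x" "p (f 1) = x"
  shows "homotopic_with (\<lambda>r. r 0 = x \<and> r 1 = x) (top_of_set {0..1}) T (p \<circ> f) (p \<circ> g)"
proof -
  have "homotopic_with (\<lambda>h. h 0 = f 0 \<and> h 1 = f 1) (top_of_set {0..1}) (top_of_set {0..1}) f g"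
    unfolding homotopic_with_def
  proof (intro exI conjI allI ballI)
    let ?h = "\<lambda>z. (1 - fst z) * f (snd z) + fst z * g (snd z)"
    have "continuous_on ({0..1} \<times> {0..1}) (f \<circ> snd)" "continuous_on ({0..1} \<times> {0..1}) (g \<circ> snd)"
      by (intro continuous_on_compose continuous_on_subset[OF f(1)] continuous_on_subset[OF g(1)]
            continuous_intros; auto)+
    then have "continuous_on ({0..1} \<times> {0..1}) ?h"
      unfolding o_def by (intro continuous_intros)
    moreover have "?h z \<in> {0..1}" if "z \<in> {0..1} \<times> {0..1}" for z
    proof -
      have fz: "0 \<le> f (snd z)" "f (snd z) \<le> 1" "0 \<le> g (snd z)" "g (snd z) \<le> 1"
        using f(2) g(2) that by (auto simp: Pi_iff)
      have z: "0 \<le> fst z" "fst z \<le> 1" using that by auto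
      have "(1 - fst z) * f (snd z) + fst z * g (snd z) \<le> (1 - fst z) * 1 + fst z * 1"
        using fz z by (intro add_mono mult_left_mono) auto
      then show ?thesis using fz z by auto
    qed
    ultimately show "continuous_map (prod_topology (top_of_set {0..1}) (top_of_set {0..1}))
        (top_of_set {0..1}) ?h"
      by (auto simp: subtopology_Times continuous_map_in_subtopology simp flip: euclidean_product_topology)
    show "(1 - fst (0, t)) * f (snd (0, t)) + fst (0::real, t) * g (snd (0::real, t)) = f t"
      "(1 - fst (1, t)) * f (snd (1, t)) + fst (1::real, t) * g (snd (1::real, t)) = g t" for t
      by auto
    show "(1 - fst (u, 0)) * f (snd (u, 0)) + fst (u, 0) * g (snd (u, 0)) = f 0"
      "(1 - fst (u, 1)) * f (snd (u, 1)) + fst (u, 1) * g (snd (u, 1)) = f 1" for u :: real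
      using ends by (auto simp: algebra_simps)
  qed
  then show ?thesis
    by (rule homotopic_with_compose_continuous_map_left) (use p ends in \<open>auto simp: pathin_def\<close>)
qed

lemma path_join_in_loops_at:
  assumes "p \<in> loops_at T x" "q \<in> loops_at T x"
  shows "path_join p q \<in> loops_at T x"
proof -
  have p: "continuous_map (top_of_set {0..1}) T p" "p 1 = x"
    and q: "continuous_map (top_of_set {0..1}) T q" "q 0 = x"
    using assms by (auto simp: loops_at_def pathin_def)
  have "continuous_map (top_of_set {0..1::real}) T (\<lambda>t. if t \<le> 1/2 then p (2 * t) else q (2 * t - 1))"
  proof (rule continuous_map_cases_le)
    show "continuous_map (subtopology (top_of_set {0..1}) {t \<in> topspace (top_of_set {0..1}). t \<le> 1/2}) T
        (\<lambda>t::real. p (2 * t))"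
      by (rule continuous_map_compose[OF _ p(1), unfolded o_def])
        (auto simp: continuous_map_in_subtopology subtopology_subtopology intro!: continuous_intros)
    show "continuous_map (subtopology (top_of_set {0..1}) {t \<in> topspace (top_of_set {0..1}). 1/2 \<le> t}) T
        (\<lambda>t::real. q (2 * t - 1))"
      by (rule continuous_map_compose[OF _ q(1), unfolded o_def])
        (auto simp: continuous_map_in_subtopology subtopology_subtopology intro!: continuous_intros)
    show "p (2 * t) = q (2 * t - 1)" if "t = 1/2" for t
      using p q unfolding that by simp
  qed (auto intro!: continuous_intros)
  then show ?thesis
    using assms by (auto simp: loops_at_def pathin_def path_join_def)
qed

lemma path_join_homotopic:
  assumes "(p, p') \<in> loop_homotopy_rel T x" "(q, q') \<in> loop_homotopy_rel T x"
  shows "(path_join p q, path_join p' q') \<in> loop_homotopy_rel T x"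
proof -
  have ends: "p 1 = x" "q 0 = x"
    and loops: "p \<in> loops_at T x" "p' \<in> loops_at T x" "q \<in> loops_at T x" "q' \<in> loops_at T x"
    using assms by (auto simp: loop_homotopy_rel_def loops_at_def)
  let ?I = "top_of_set {0..1::real}"
  obtain h where h: "continuous_map (prod_topology ?I ?I) T h" "\<And>t. h (0, t) = p t"
      "\<And>t. h (1, t) = p' t" "\<And>u. u \<in> {0..1} \<Longrightarrow> h (u, 0) = x \<and> h (u, 1) = x"
    using assms(1) by (auto simp: loop_homotopy_rel_def homotopic_with_def)
  obtain k where k: "continuous_map (prod_topology ?I ?I) T k" "\<And>t. k (0, t) = q t"
      "\<And>t. k (1, t) = q' t" "\<And>u. u \<in> {0..1} \<Longrightarrow> k (u, 0) = x \<and> k (u, 1) = x"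
    using assms(2) by (auto simp: loop_homotopy_rel_def homotopic_with_def)
  let ?m = "\<lambda>z::real\<times>real. if snd z \<le> 1/2 then h (fst z, 2 * snd z) else k (fst z, 2 * snd z - 1)"
  have II: "prod_topology ?I ?I = top_of_set ({0..1} \<times> {0..1})"
    by (simp add: subtopology_Times euclidean_product_topology)
  have "continuous_map (top_of_set ({0..1} \<times> {0..1})) T ?m"
  proof (rule continuous_map_cases_le)
    show "continuous_map (subtopology (top_of_set ({0..1} \<times> {0..1}))
        {z \<in> topspace (top_of_set ({0..1} \<times> {0..1})). snd z \<le> 1/2}) T (\<lambda>z. h (fst z, 2 * snd z))"
      by (rule continuous_map_compose[OF _ h(1)[unfolded II], unfolded o_def])
        (auto simp: continuous_map_in_subtopology subtopology_subtopology intro!: continuous_intros)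
    show "continuous_map (subtopology (top_of_set ({0..1} \<times> {0..1}))
        {z \<in> topspace (top_of_set ({0..1} \<times> {0..1})). 1/2 \<le> snd z}) T (\<lambda>z. k (fst z, 2 * snd z - 1))"
      by (rule continuous_map_compose[OF _ k(1)[unfolded II], unfolded o_def])
        (auto simp: continuous_map_in_subtopology subtopology_subtopology intro!: continuous_intros)
    show "h (fst z, 2 * snd z) = k (fst z, 2 * snd z - 1)"
      if "z \<in> topspace (top_of_set ({0..1} \<times> {0..1}))" "snd z = 1/2" for z
      using that(1) h(4)[of "fst z"] k(4)[of "fst z"] unfolding that(2) by auto
  qed (auto intro!: continuous_intros)
  then have "homotopic_with (\<lambda>r. r 0 = x \<and> r 1 = x) ?I T (path_join p q) (path_join p' q')"
    unfolding homotopic_with_def II using h(2-4) k(2-4)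
    by (intro exI[of _ ?m] conjI) (auto simp: path_join_def)
  then show ?thesis
    using loops by (simp add: loop_homotopy_rel_def path_join_in_loops_at)
qed

abbreviation loop_class :: "'a topology \<Rightarrow> 'a \<Rightarrow> (real \<Rightarrow> 'a) \<Rightarrow> (real \<Rightarrow> 'a) set" where
  "loop_class T x p \<equiv> loop_homotopy_rel T x `` {p}"

lemma loop_class_eq_iff:
  assumes "p \<in> loops_at T x" "q \<in> loops_at T x"
  shows "loop_class T x p = loop_class T x q \<longleftrightarrow> (p, q) \<in> loop_homotopy_rel T x"
  using eq_equiv_class_iff[OF equiv_loop_homotopy_rel assms] .

lemma fundamental_group_carrier_iff:
  "c \<in> carrier (fundamental_group T x) \<longleftrightarrow> (\<exists>p\<in>loops_at T x. c = loop_class T x p)"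
  by (auto simp: fundamental_group_def quotient_def)

lemma fundamental_group_mult:
  assumes "p \<in> loops_at T x" "q \<in> loops_at T x"
  shows "loop_class T x p \<otimes>\<^bsub>fundamental_group T x\<^esub> loop_class T x q = loop_class T x (path_join p q)"
proof -
  have cong: "(\<lambda>p q. loop_class T x (path_join p q)) respects2 loop_homotopy_rel T x"
    unfolding congruent2_def
    by (auto intro!: equiv_class_eq[OF equiv_loop_homotopy_rel] path_join_homotopic)
  show ?thesis
    using UN_equiv_class2[OF equiv_loop_homotopy_rel equiv_loop_homotopy_rel cong assms]
    by (simp add: fundamental_group_def)
qed

text \<open>Each group law compares two loops that run along one path \<open>p\<close> in two different ways \<open>f\<close> and \<open>g\<close>,
  so associativity, units and inverses all follow from this rule.\<close>

lemma loop_class_eqI: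
  fixes f g :: "real \<Rightarrow> real"
  assumes "pathin T p" "continuous_on {0..1} f" "f \<in> {0..1} \<rightarrow> {0..1}"
    "continuous_on {0..1} g" "g \<in> {0..1} \<rightarrow> {0..1}"
    "f 0 = g 0" "f 1 = g 1" "p (f 0) = x" "p (f 1) = x"
    and "a \<in> loops_at T x" "b \<in> loops_at T x"
    "\<And>t. t \<in> {0..1} \<Longrightarrow> a t = p (f t)" "\<And>t. t \<in> {0..1} \<Longrightarrow> b t = p (g t)"
  shows "loop_class T x a = loop_class T x b"
proof -
  have "homotopic_with (\<lambda>r. r 0 = x \<and> r 1 = x) (top_of_set {0..1}) T a b"
    by (rule homotopic_with_eq[OF homotopic_reparametrizations[OF assms(1-9)]]) (use assms in auto)
  then show ?thesis
    using assms by (subst loop_class_eq_iff) (auto simp: loop_homotopy_rel_def)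
qed

lemma reversed_loop: "p \<in> loops_at T x \<Longrightarrow> (\<lambda>t. p (1 - t)) \<in> loops_at T x"
  using continuous_map_compose[of "top_of_set {0..1}" "top_of_set {0..1}" "\<lambda>t. 1 - t" T p]
  by (auto simp: loops_at_def pathin_def o_def continuous_map_in_subtopology continuous_on_op_minus)

lemma const_loop: "x \<in> topspace T \<Longrightarrow> (\<lambda>_. x) \<in> loops_at T x"
  by (simp add: loops_at_def pathin_def)

lemma group_fundamental_group:
  assumes x: "x \<in> topspace T"
  shows "group (fundamental_group T x)"
proof (rule groupI)
  let ?G = "fundamental_group T x"
  have one: "\<one>\<^bsub>?G\<^esub> = loop_class T x (\<lambda>_. x)"
    by (simp add: fundamental_group_def)
  show "\<one>\<^bsub>?G\<^esub> \<in> carrier ?G"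
    using const_loop[OF x] by (auto simp: one fundamental_group_carrier_iff)
  fix a b c
  assume "a \<in> carrier ?G"
  then obtain p where p: "p \<in> loops_at T x" "a = loop_class T x p"
    by (auto simp: fundamental_group_carrier_iff)
  then have pin: "pathin T p" and p01: "p 0 = x" "p 1 = x" by (auto simp: loops_at_def)
  show "\<one>\<^bsub>?G\<^esub> \<otimes>\<^bsub>?G\<^esub> a = a"
    unfolding one p(2) fundamental_group_mult[OF const_loop[OF x] p(1)]
  proof (rule loop_class_eqI[OF pin, where f = "\<lambda>t. max 0 (2 * t - 1)" and g = "\<lambda>t. t"])
    show "path_join (\<lambda>_. x) p \<in> loops_at T x" by (simp add: path_join_in_loops_at const_loop x p)
    show "continuous_on {0..1} (\<lambda>t::real. max 0 (2 * t - 1))" by (intro continuous_intros)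
    show "path_join (\<lambda>_. x) p t = p (max 0 (2 * t - 1))" for t
    proof (cases "t = 1/2")
      case True
      show ?thesis using p01 unfolding True by (simp add: path_join_def)
    qed (use p01 in \<open>auto simp: path_join_def max_def\<close>)
  qed (use p p01 in auto)
  show "\<exists>b\<in>carrier ?G. b \<otimes>\<^bsub>?G\<^esub> a = \<one>\<^bsub>?G\<^esub>"
  proof (intro bexI)
    let ?q = "\<lambda>t. p (1 - t)"
    show "loop_class T x ?q \<otimes>\<^bsub>?G\<^esub> a = \<one>\<^bsub>?G\<^esub>"
      unfolding one p(2) fundamental_group_mult[OF reversed_loop[OF p(1)] p(1)]
    proof (rule loop_class_eqI[OF pin, where f = "\<lambda>t. max (1 - 2 * t) (2 * t - 1)" and g = "\<lambda>t. 1"])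
      show "path_join ?q p \<in> loops_at T x" by (simp add: path_join_in_loops_at reversed_loop p)
      show "path_join ?q p t = p (max (1 - 2 * t) (2 * t - 1))" for t
      proof (cases "t = 1/2")
        case True
        show ?thesis unfolding True by (simp add: path_join_def)
      qed (auto simp: path_join_def max_def)
      show "continuous_on {0..1} (\<lambda>t::real. max (1 - 2 * t) (2 * t - 1))" by (intro continuous_intros)
    qed (use p p01 x in \<open>auto simp: const_loop\<close>)
    show "loop_class T x ?q \<in> carrier ?G"
      using reversed_loop[OF p(1)] by (auto simp: fundamental_group_carrier_iff)
  qed
  assume "b \<in> carrier ?G"
  then obtain q where q: "q \<in> loops_at T x" "b = loop_class T x q"
    by (auto simp: fundamental_group_carrier_iff)
  show "a \<otimes>\<^bsub>?G\<^esub> b \<in> carrier ?G"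
    unfolding p(2) q(2) fundamental_group_mult[OF p(1) q(1)] fundamental_group_carrier_iff
    using path_join_in_loops_at[OF p(1) q(1)] by blast
  assume "c \<in> carrier ?G"
  then obtain r where r: "r \<in> loops_at T x" "c = loop_class T x r"
    by (auto simp: fundamental_group_carrier_iff)
  have pq: "path_join p q \<in> loops_at T x" and qr: "path_join q r \<in> loops_at T x"
    and pqr: "path_join (path_join p q) r \<in> loops_at T x" "path_join p (path_join q r) \<in> loops_at T x"
    by (simp_all add: path_join_in_loops_at p q r)
  have "loop_class T x (path_join (path_join p q) r) = loop_class T x (path_join p (path_join q r))"
  proof (rule loop_class_eqI[where f = "\<lambda>t. t"
          and g = "\<lambda>t. if t \<le> 1/2 then t / 2 else max (t - 1/4) (2 * t - 1)"])
    show "pathin T (path_join (path_join p q) r)"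
      using pqr(1) by (simp add: loops_at_def)
    show "continuous_on {0..1::real} (\<lambda>t. if t \<le> 1/2 then t / 2 else max (t - 1/4) (2 * t - 1))"
      by (rule continuous_on_cases_le) (auto intro!: continuous_intros)
    show "path_join p (path_join q r) t =
      path_join (path_join p q) r (if t \<le> 1/2 then t / 2 else max (t - 1/4) (2 * t - 1))"
      if "t \<in> {0..1}" for t
    proof -
      consider "t \<le> 1/2" | "1/2 < t" "t \<le> 3/4" | "3/4 < t" by linarith
      then show ?thesis
      proof cases
        case 2
        then have "max (t - 1/4) (2 * t - 1) = t - 1/4" by simp
        then show ?thesis using 2 by (simp add: path_join_def algebra_simps)
      qed (auto simp: path_join_def max_def algebra_simps)
    qed
  qed (use pqr p01 in \<open>auto simp: loops_at_def max_def\<close>)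
  then show "a \<otimes>\<^bsub>?G\<^esub> b \<otimes>\<^bsub>?G\<^esub> c = a \<otimes>\<^bsub>?G\<^esub> (b \<otimes>\<^bsub>?G\<^esub> c)"
    by (simp add: p(2) q(2) r(2) fundamental_group_mult p(1) q(1) r(1) pq qr)
qed

section \<open>Homotopy invariant functionals on paths with values in an abelian group\<close>

lemma path_image_subpath_in:
  "\<lbrakk>path_image p \<subseteq> S; u \<in> {0..1}; v \<in> {0..1}\<rbrakk> \<Longrightarrow> path_image (subpath u v p) \<subseteq> S"
  using path_image_subpath_subset by blast

lemma convex_homotopic_paths:
  fixes p q :: "real \<Rightarrow> 'a::real_normed_vector"
  assumes "convex C" "path p" "path q" "path_image p \<subseteq> C" "path_image q \<subseteq> C"
    "pathstart q = pathstart p" "pathfinish q = pathfinish p"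
  shows "homotopic_paths C p q"
proof (rule homotopic_paths_linear[OF assms(2,3,6,7)])
  show "closed_segment (p t) (q t) \<subseteq> C" if "t \<in> {0..1}" for t
    using that assms by (intro closed_segment_subset) (auto simp: path_image_def)
qed

text \<open>A homomorphism from the fundamental groupoid of \<open>S\<close> to an abelian group. Admitting open paths
  allows the base point to move, and arguments can cut a loop into pieces.\<close>

locale path_functional = comm_group M for M (structure) +
  fixes S :: "'a::real_normed_vector set" and \<Phi> :: "(real \<Rightarrow> 'a) \<Rightarrow> 'm"
  assumes closed: "\<lbrakk>path p; path_image p \<subseteq> S\<rbrakk> \<Longrightarrow> \<Phi> p \<in> carrier M"
    and join: "\<lbrakk>path p; path_image p \<subseteq> S; path q; path_image q \<subseteq> S; pathfinish p = pathstart q\<rbrakk>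
      \<Longrightarrow> \<Phi> (p +++ q) = \<Phi> p \<otimes> \<Phi> q"
    and homotopic: "homotopic_paths S p q \<Longrightarrow> \<Phi> p = \<Phi> q"
begin

lemma subset: "T \<subseteq> S \<Longrightarrow> path_functional M T \<Phi>"
  by unfold_locales
    (blast intro: closed, blast intro: join, blast intro: homotopic[OF homotopic_paths_subset])

lemma pullback:
  fixes f :: "'c::real_normed_vector \<Rightarrow> 'a"
  assumes "continuous_on T f" "f ` T \<subseteq> S"
  shows "path_functional M T (\<lambda>p. \<Phi> (f \<circ> p))"
proof
  have *: "path (f \<circ> p) \<and> path_image (f \<circ> p) \<subseteq> S" if "path p" "path_image p \<subseteq> T" for p
    using that assms path_continuous_image[OF that(1) continuous_on_subset[OF assms(1) that(2)]]
    by (auto simp: path_image_compose)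
  show "\<Phi> (f \<circ> p) \<in> carrier M" if "path p" "path_image p \<subseteq> T" for p
    using *[OF that] by (auto intro: closed)
  show "\<Phi> (f \<circ> (p +++ q)) = \<Phi> (f \<circ> p) \<otimes> \<Phi> (f \<circ> q)"
    if "path p" "path_image p \<subseteq> T" "path q" "path_image q \<subseteq> T" "pathfinish p = pathstart q" for p q
    using that *[of p] *[of q] by (simp add: path_compose_join join pathfinish_compose pathstart_compose)
  show "\<Phi> (f \<circ> p) = \<Phi> (f \<circ> q)" if "homotopic_paths T p q" for p q
    using assms by (intro homotopic homotopic_paths_continuous_image[OF that]) auto
qed

lemma const:
  assumes "a \<in> S"
  shows "\<Phi> (\<lambda>_. a) = \<one>"
proof -
  have "homotopic_paths S ((\<lambda>_. a) +++ linepath a a) (\<lambda>_. a)"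
    using homotopic_paths_rid[of "\<lambda>_. a" S] assms by (simp add: path_const path_image_const pathfinish_def)
  moreover have "linepath a a = (\<lambda>_. a)" by (simp add: linepath_refl)
  ultimately have "\<Phi> (\<lambda>_. a) = \<Phi> ((\<lambda>_. a) +++ (\<lambda>_. a))"
    by (metis homotopic)
  also have "\<dots> = \<Phi> (\<lambda>_. a) \<otimes> \<Phi> (\<lambda>_. a)"
    using assms by (intro join) (auto simp: path_const path_image_const pathfinish_def pathstart_def)
  finally show ?thesis
    using closed[of "\<lambda>_. a"] assms by (simp add: path_const path_image_const)
qed

lemma reversepath:
  assumes "path p" "path_image p \<subseteq> S"
  shows "\<Phi> (reversepath p) = inv (\<Phi> p)"
proof -
  have "homotopic_paths S (p +++ reversepath p) (linepath (pathstart p) (pathstart p))"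
    using assms by (intro homotopic_paths_rinv) auto
  then have "\<Phi> (p +++ reversepath p) = \<Phi> (\<lambda>_. pathstart p)"
    unfolding linepath_refl by (rule homotopic)
  also have "\<dots> = \<one>"
    using assms by (intro const) auto
  finally have "\<Phi> p \<otimes> \<Phi> (reversepath p) = \<one>"
    using assms by (simp add: join)
  then show ?thesis
    using assms closed[of p] closed[of "reversepath p"]
    by (intro inv_equality[symmetric]) (auto simp: m_comm)
qed

lemma conjugate_loop:
  assumes "path p" "path_image p \<subseteq> S" "path q" "path_image q \<subseteq> S"
    "pathfinish p = pathstart q" "pathfinish q = pathstart q"
  shows "\<Phi> (p +++ (q +++ reversepath p)) = \<Phi> q"
proof -
  have "\<Phi> (p +++ (q +++ reversepath p)) = \<Phi> p \<otimes> (\<Phi> q \<otimes> inv (\<Phi> p))"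
    using assms by (simp add: join reversepath path_image_join)
  also have "\<dots> = \<Phi> q"
    using closed[OF assms(1,2)] closed[OF assms(3,4)] by (metis inv_closed inv_solve_left m_closed m_comm)
  finally show ?thesis .
qed

text \<open>Commutativity of the target makes the functional blind to base points.\<close>

lemma homotopic_loops:
  assumes "homotopic_loops S p q"
  shows "\<Phi> p = \<Phi> q"
proof -
  let ?Q = "{0..1::real} \<times> {0..1::real}"
  obtain h where h: "continuous_on ?Q h" "h ` ?Q \<subseteq> S"
      "\<And>t. t \<in> {0..1} \<Longrightarrow> h (0, t) = p t" "\<And>t. t \<in> {0..1} \<Longrightarrow> h (1, t) = q t"
      "\<And>s. s \<in> {0..1} \<Longrightarrow> h (s, 1) = h (s, 0)"
    using assms by (auto simp: Homotopy.homotopic_loops pathfinish_def pathstart_def image_subset_iff Pi_iff)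
  interpret Q: path_functional M ?Q "\<lambda>p. \<Phi> (h \<circ> p)"
    by (rule pullback) (use h in auto)
  define bottom top left right where "bottom = linepath (0::real, 0::real) (0, 1)"
    and "top = linepath (1::real, 0::real) (1, 1)"
    and "left = linepath (0::real, 0::real) (1, 0)" and "right = linepath (0::real, 1::real) (1, 1)"
  have sub: "path_image bottom \<subseteq> ?Q" "path_image top \<subseteq> ?Q" "path_image left \<subseteq> ?Q" "path_image right \<subseteq> ?Q"
    unfolding bottom_def top_def left_def right_def
    unfolding path_image_linepath by (rule closed_segment_subset; (intro convex_Times convex_real_interval)?; simp)+
  have hp: "\<Phi> (h \<circ> bottom) = \<Phi> p"
  proof (rule homotopic[OF homotopic_paths_sym, OF homotopic_paths_eq])
    show "p t = (h \<circ> bottom) t" if "t \<in> {0..1}" for t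
      using h(3)[OF that] by (simp add: bottom_def linepath_def)
  qed (use homotopic_loops_imp_path[OF assms] homotopic_loops_imp_subset[OF assms] in simp_all)
  have hq: "\<Phi> (h \<circ> top) = \<Phi> q"
  proof (rule homotopic[OF homotopic_paths_sym, OF homotopic_paths_eq])
    show "q t = (h \<circ> top) t" if "t \<in> {0..1}" for t
      using h(4)[OF that] by (simp add: top_def linepath_def)
  qed (use homotopic_loops_imp_path[OF assms] homotopic_loops_imp_subset[OF assms] in simp_all)
  have "path (h \<circ> left)"
    using sub(3) by (intro path_continuous_image continuous_on_subset[OF h(1)]) (simp_all add: left_def)
  moreover have "path_image (h \<circ> left) \<subseteq> S"
    using sub(3) h(2) by (auto simp: path_image_compose)
  ultimately have side: "\<Phi> (h \<circ> left) = \<Phi> (h \<circ> right)"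
    using h(5) by (intro homotopic[OF homotopic_paths_eq]) (simp_all add: left_def right_def linepath_def)
  have paths: "path bottom" "path top" "path left" "path right"
    and ends: "pathfinish bottom = pathstart right" "pathfinish left = pathstart top"
      "pathstart bottom = pathstart left" "pathfinish right = pathfinish top"
    by (simp_all add: bottom_def top_def left_def right_def)
  have "homotopic_paths ?Q (bottom +++ right) (left +++ top)"
    using paths ends sub by (intro convex_homotopic_paths convex_Times convex_real_interval) (simp_all add: path_image_join)
  then have "\<Phi> (h \<circ> (bottom +++ right)) = \<Phi> (h \<circ> (left +++ top))"
    by (rule Q.homotopic)
  then have "\<Phi> p \<otimes> \<Phi> (h \<circ> right) = \<Phi> (h \<circ> right) \<otimes> \<Phi> q"
    using Q.join[OF paths(1) sub(1) paths(4) sub(4) ends(1)] Q.join[OF paths(3) sub(3) paths(2) sub(2) ends(2)]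
    by (simp add: hp hq side)
  then show ?thesis
    using Q.closed[OF paths(4) sub(4)] Q.closed[OF paths(1) sub(1)] Q.closed[OF paths(2) sub(2)]
    by (simp add: hp hq m_comm)
qed

text \<open>Two paths in a convex set with the same end points are homotopic, so only the end points matter.\<close>

lemma subpath_join:
  assumes "path p" "path_image p \<subseteq> S" "u \<in> {0..1}" "v \<in> {0..1}" "w \<in> {0..1}"
  shows "\<Phi> (subpath u w p) = \<Phi> (subpath u v p) \<otimes> \<Phi> (subpath v w p)"
proof -
  have "homotopic_paths S (subpath u v p +++ subpath v w p) (subpath u w p)"
    using assms by (intro homotopic_join_subpaths) auto
  then have "\<Phi> (subpath u w p) = \<Phi> (subpath u v p +++ subpath v w p)"
    by (rule homotopic[symmetric])
  also have "\<dots> = \<Phi> (subpath u v p) \<otimes> \<Phi> (subpath v w p)"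
    by (rule join[OF path_subpath path_image_subpath_in path_subpath path_image_subpath_in])
      (use assms in simp_all)
  finally show ?thesis .
qed

text \<open>The tethers \<open>\<tau>\<close> from a base point \<open>b\<close> close every piece of a path to a loop. The loops add up, so that
  an identity between functionals needs to be checked on small loops only.\<close>

lemma tether_mult:
  assumes p: "path p" "path_image p \<subseteq> S" "u \<in> {0..1}" "v \<in> {0..1}" "w \<in> {0..1}"
    and \<tau>: "\<And>t. t \<in> {0..1} \<Longrightarrow> path (\<tau> t) \<and> path_image (\<tau> t) \<subseteq> S \<and> pathstart (\<tau> t) = b \<and> pathfinish (\<tau> t) = p t"
  shows "\<Phi> (\<tau> u +++ (subpath u w p +++ reversepath (\<tau> w))) =
    \<Phi> (\<tau> u +++ (subpath u v p +++ reversepath (\<tau> v))) \<otimes> \<Phi> (\<tau> v +++ (subpath v w p +++ reversepath (\<tau> w)))"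
proof -
  have tether: "\<Phi> (\<tau> s +++ (subpath s t p +++ reversepath (\<tau> t))) =
      \<Phi> (\<tau> s) \<otimes> (\<Phi> (subpath s t p) \<otimes> inv (\<Phi> (\<tau> t)))" if "s \<in> {0..1}" "t \<in> {0..1}" for s t
    using that p \<tau>[OF that(1)] \<tau>[OF that(2)] path_image_subpath_in[OF p(2) that]
    by (simp add: join reversepath path_image_join)
  have c: "\<Phi> (\<tau> t) \<in> carrier M" if "t \<in> {0..1}" for t
    using \<tau>[OF that] by (simp add: closed)
  have d: "\<Phi> (subpath s t p) \<in> carrier M" if "s \<in> {0..1}" "t \<in> {0..1}" for s t
    using that p path_image_subpath_in[OF p(2) that] by (simp add: closed)
  have cancel: "inv (\<Phi> (\<tau> v)) \<otimes> (\<Phi> (\<tau> v) \<otimes> z) = z" if "z \<in> carrier M" for z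
    using c[OF p(4)] that by (simp add: m_assoc[symmetric])
  show ?thesis
    using c[OF p(3)] c[OF p(4)] c[OF p(5)] d[OF p(3,4)] d[OF p(4,5)]
    unfolding tether[OF p(3,5)] tether[OF p(3,4)] tether[OF p(4,5)] subpath_join[OF p]
    by (simp add: m_assoc cancel)
qed

end

text \<open>Continuity of \<open>p\<close> at \<open>t\<close> in terms of short intervals around \<open>t\<close>, as bisection arguments require
  it.\<close>

lemma path_near_subpath:
  assumes "path p" "t \<in> {0..1}" "open U" "p t \<in> U"
  obtains d where "d > 0"
    "\<And>u v. \<lbrakk>0 \<le> u; u \<le> t; t \<le> v; v \<le> 1; v - u < d\<rbrakk> \<Longrightarrow> p ` {u..v} \<subseteq> U \<and> path_image (subpath u v p) \<subseteq> U"
proof -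
  have "continuous_on {0..1} p" using assms(1) by (simp add: path_def)
  then obtain d where d: "d > 0" "\<And>s. \<lbrakk>s \<in> {0..1}; dist s t < d\<rbrakk> \<Longrightarrow> p s \<in> U"
    using assms unfolding continuous_on_topological
    by (metis (no_types, lifting) eventually_at_topological open_contains_ball mem_ball dist_commute subsetD)
  have "p ` {u..v} \<subseteq> U" if "0 \<le> u" "u \<le> t" "t \<le> v" "v \<le> 1" "v - u < d" for u v
    using that by (auto intro!: d(2) simp: dist_real_def)
  moreover have "path_image (subpath u v p) = p ` {u..v}" if "u \<le> t" "t \<le> v" for u v
    using that by (simp add: path_image_subpath)
  ultimately show thesis
    by (intro that[OF d(1)]) auto
qed

section \<open>Loops in a convex region of the plane with punctures\<close>

definition complex_add :: "complex monoid" where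
  "complex_add = \<lparr>carrier = UNIV, mult = (+), one = 0\<rparr>"

lemma comm_group_complex_add: "comm_group complex_add"
  by (rule comm_groupI) (auto simp: complex_add_def add.assoc intro: exI[of _ "- _"] add.commute right_minus)

text \<open>On open paths the winding number is \<open>1/(2\<pi>i)\<close> times the increment of a logarithm, hence additive
  and homotopy invariant there as well; but it takes complex values.\<close>

lemma path_functional_winding_number:
  "path_functional complex_add (- {k}) (\<lambda>p. winding_number p k)"
proof (rule path_functional.intro[OF comm_group_complex_add path_functional_axioms.intro])
  show "winding_number (p +++ q) k = winding_number p k \<otimes>\<^bsub>complex_add\<^esub> winding_number q k"
    if "path p" "path_image p \<subseteq> - {k}" "path q" "path_image q \<subseteq> - {k}" "pathfinish p = pathstart q" for p q
    using that by (subst winding_number_join) (auto simp: complex_add_def)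
qed (auto simp: complex_add_def winding_number_homotopic_paths)

text \<open>The winding number of a loop as an element of type \<open>int\<close>, to serve as an exponent in the target
  group of a functional.\<close>

definition wind :: "(real \<Rightarrow> complex) \<Rightarrow> complex \<Rightarrow> int" where
  "wind p k = \<lfloor>Re (winding_number p k)\<rfloor>"

lemma of_int_wind:
  assumes "path p" "pathfinish p = pathstart p" "k \<notin> path_image p"
  shows "of_int (wind p k) = winding_number p k"
  using integer_winding_number[OF assms] by (auto simp: wind_def Ints_def)

lemma wind_outside_convex:
  assumes "path p" "pathfinish p = pathstart p" "convex S" "path_image p \<subseteq> S" "k \<notin> S"
  shows "wind p k = 0"
  using winding_number_zero_outside[OF assms(1,3,2,5,4)] by (simp add: wind_def)

definition circle_loop :: "complex \<Rightarrow> real \<Rightarrow> int \<Rightarrow> real \<Rightarrow> complex" where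
  "circle_loop k r m t = k + of_real r * exp (2 * of_real pi * \<i> * of_int m * of_real t)"

lemma circle_loop:
  assumes "r > 0"
  shows "path (circle_loop k r m)" "pathstart (circle_loop k r m) = k + of_real r"
    "pathfinish (circle_loop k r m) = k + of_real r" "path_image (circle_loop k r m) \<subseteq> sphere k r"
    "winding_number (circle_loop k r m) k = of_int m"
proof -
  show p: "path (circle_loop k r m)"
    unfolding path_def circle_loop_def by (intro continuous_intros)
  show "pathstart (circle_loop k r m) = k + of_real r"
    by (simp add: pathstart_def circle_loop_def)
  show "pathfinish (circle_loop k r m) = k + of_real r"
    using exp_integer_2pi[of "of_int m"] by (simp add: pathfinish_def circle_loop_def mult_ac)
  show "path_image (circle_loop k r m) \<subseteq> sphere k r"
    using assms by (auto simp: path_image_def circle_loop_def dist_norm norm_mult)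
  let ?q = "\<lambda>t. of_real (ln r) + 2 * of_real pi * \<i> * of_int m * of_real t"
  have q: "path ?q" unfolding path_def by (intro continuous_intros)
  have "(\<lambda>t. circle_loop k r m t - k) = exp \<circ> ?q"
    using assms by (auto simp: circle_loop_def exp_add exp_of_real)
  then have "winding_number (circle_loop k r m) k = winding_number (exp \<circ> ?q) 0"
    by (subst winding_number_offset) simp
  also have "\<dots> = of_int m"
    unfolding winding_number_compose_exp[OF q] by (simp add: pathfinish_def pathstart_def)
  finally show "winding_number (circle_loop k r m) k = of_int m" .
qed

lemma path_functional_convex_loop:
  assumes "path_functional M S \<Phi>" "convex S" "path p" "path_image p \<subseteq> S" "pathfinish p = pathstart p"
  shows "\<Phi> p = \<one>\<^bsub>M\<^esub>"
proof -
  interpret path_functional M S \<Phi> by fact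
  have "homotopic_paths S p (\<lambda>_. pathstart p)"
    using assms by (intro convex_homotopic_paths)
      (auto simp: path_const path_image_const pathstart_def pathfinish_def path_image_def)
  then show ?thesis
    using homotopic const[of "pathstart p"] assms by auto
qed

text \<open>Loops with equal winding numbers around \<open>k\<close> are freely homotopic in the plane without \<open>k\<close>. A radial
  contraction towards \<open>k\<close> brings the homotopy back into \<open>S\<close>.\<close>

lemma path_functional_one_puncture_eq:
  assumes "path_functional M (S - {k}) \<Phi>" "convex S" "open S" "k \<in> S"
    and p: "path p" "path_image p \<subseteq> S - {k}" "pathfinish p = pathstart p"
    and q: "path q" "path_image q \<subseteq> S - {k}" "pathfinish q = pathstart q"
    and "winding_number p k = winding_number q k"
  shows "\<Phi> p = \<Phi> q"
proof -
  interpret path_functional M "S - {k}" \<Phi> by fact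
  obtain r where r: "r > 0" "cball k r \<subseteq> S"
    using assms open_contains_cball by blast
  \<comment> \<open>The plane without \<open>k\<close> is mapped radially into a punctured disc inside \<open>S\<close>.\<close>
  define \<rho> where "\<rho> z = k + of_real (min 1 (r / norm (z - k))) * (z - k)" for z
  have \<rho>_cont: "continuous_on (- {k}) \<rho>"
    unfolding \<rho>_def by (intro continuous_intros) auto
  have \<rho>_in: "\<rho> z \<in> S - {k}" if "z \<noteq> k" for z
  proof -
    have "norm (z - k) > 0" using that by simp
    then have "min 1 (r / norm (z - k)) * norm (z - k) \<le> r" "min 1 (r / norm (z - k)) > 0"
      using r(1) by (auto simp: min_def field_simps)
    then have "dist k (\<rho> z) \<le> r"
      by (auto simp: \<rho>_def dist_norm norm_mult)
    moreover have "\<rho> z \<noteq> k"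
      using \<open>min 1 (r / norm (z - k)) > 0\<close> that by (simp only: \<rho>_def add_cancel_left_right) simp
    ultimately show ?thesis
      using r by (auto simp: subset_iff)
  qed
  have seg: "closed_segment z (\<rho> z) \<subseteq> S - {k}" if "z \<in> S - {k}" for z
  proof -
    have "closed_segment z (\<rho> z) \<subseteq> S"
      using that \<rho>_in[of z] assms(2) by (intro closed_segment_subset) auto
    moreover have "k \<notin> closed_segment z (\<rho> z)"
    proof
      assume "k \<in> closed_segment z (\<rho> z)"
      then obtain u where u: "0 \<le> u" "u \<le> 1" "k = (1 - u) *\<^sub>R z + u *\<^sub>R \<rho> z"
        by (auto simp: closed_segment_def)
      define c where "c = min 1 (r / norm (z - k))"
      have c: "c > 0" using r(1) that by (auto simp: c_def)
      have "(of_real (1 - u + u * c)) * (z - k) = 0"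
        using u(3) by (simp add: \<rho>_def scaleR_conv_of_real algebra_simps flip: c_def)
      then have "1 - u + u * c = 0" using that by (simp only: mult_eq_0_iff of_real_eq_0_iff) auto
      moreover have "1 - u + u * c > 0"
      proof (cases "u = 0")
        case False
        then have "u * c > 0" using u(1) c by simp
        then show ?thesis using u(2) by linarith
      qed simp
      ultimately show False by simp
    qed
    ultimately show ?thesis by blast
  qed
  have retract: "\<Phi> (\<rho> \<circ> g) = \<Phi> g"
    if g: "path g" "path_image g \<subseteq> S - {k}" "pathfinish g = pathstart g" for g
  proof (rule homotopic_loops[symmetric], rule homotopic_loops_linear)
    show "path (\<rho> \<circ> g)"
      using g by (intro path_continuous_image continuous_on_subset[OF \<rho>_cont]) auto
    show "closed_segment (g t) ((\<rho> \<circ> g) t) \<subseteq> S - {k}" if "t \<in> {0..1}" for t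
      using seg[of "g t"] g(2) that by (simp add: path_image_def image_subset_iff)
  qed (use g in \<open>auto simp: pathfinish_compose pathstart_compose\<close>)
  have "homotopic_loops (- {k}) p q"
    using winding_number_homotopic_loops_eq[of p k q] assms by auto
  then have "homotopic_loops (S - {k}) (\<rho> \<circ> p) (\<rho> \<circ> q)"
    by (rule homotopic_loops_continuous_image) (use \<rho>_cont \<rho>_in in auto)
  then have "\<Phi> (\<rho> \<circ> p) = \<Phi> (\<rho> \<circ> q)"
    by (rule homotopic_loops)
  then show ?thesis using retract p q by simp
qed

text \<open>The value \<open>e\<close> is that of a small circle around \<open>k\<close>, and every loop can be compared with the circle
  run through \<open>wind p k\<close> times.\<close>

lemma path_functional_one_puncture:
  assumes "path_functional M (S - {k}) \<Phi>" "convex S" "open S" "k \<in> S"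
  obtains e where "e \<in> carrier M"
    "\<And>p. \<lbrakk>path p; path_image p \<subseteq> S - {k}; pathfinish p = pathstart p\<rbrakk> \<Longrightarrow> \<Phi> p = e [^]\<^bsub>M\<^esub> wind p k"
proof -
  interpret path_functional M "S - {k}" \<Phi> by fact
  obtain r where r: "r > 0" "cball k r \<subseteq> S"
    using assms open_contains_cball by blast
  define d where "d = circle_loop k r"
  have d: "path (d m)" "pathstart (d m) = k + of_real r" "pathfinish (d m) = k + of_real r"
    "path_image (d m) \<subseteq> S - {k}" "winding_number (d m) k = of_int m" for m
    using circle_loop[OF r(1), of k m] r by (auto simp: d_def subset_iff)
  have dm: "\<Phi> (d m) \<in> carrier M" for m
    using d by (intro closed) auto
  have step: "\<Phi> (d (m + 1)) = \<Phi> (d m) \<otimes>\<^bsub>M\<^esub> \<Phi> (d 1)" for m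
  proof -
    have notin: "k \<notin> path_image (d m)" for m using d(4)[of m] by auto
    have "\<Phi> (d (m + 1)) = \<Phi> (d m +++ d 1)"
      using d(4)[of m] d(4)[of 1] d(4)[of "m + 1"]
      by (intro path_functional_one_puncture_eq[OF assms])
        (auto simp: d winding_number_join notin path_image_join)
    then show ?thesis
      using d by (simp add: join)
  qed
  have "\<Phi> (d 0) = \<one>\<^bsub>M\<^esub>"
  proof -
    have "d 0 = (\<lambda>_. k + of_real r)" by (auto simp: d_def circle_loop_def)
    then show ?thesis using const[of "k + of_real r"] d(4)[of 0] by (simp add: path_image_const)
  qed
  then have pow: "\<Phi> (d m) = \<Phi> (d 1) [^]\<^bsub>M\<^esub> m" for m :: int
  proof (induction m rule: int_induct[where k = 0])
    case (step2 i)
    have "\<Phi> (d i) = \<Phi> (d (i - 1)) \<otimes>\<^bsub>M\<^esub> \<Phi> (d 1)" using step[of "i - 1"] by simp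
    moreover have "\<Phi> (d 1) [^]\<^bsub>M\<^esub> i = \<Phi> (d 1) [^]\<^bsub>M\<^esub> (i - 1) \<otimes>\<^bsub>M\<^esub> \<Phi> (d 1)"
      using int_pow_mult[OF dm[of 1], of "i - 1" 1] dm[of 1] by (simp add: int_pow_1)
    ultimately show ?case using step2 dm by (metis int_pow_closed right_cancel)
  qed (use dm in \<open>simp_all add: step int_pow_mult\<close>)
  show thesis
  proof (rule that[OF dm[of 1]])
    fix p assume p: "path p" "path_image p \<subseteq> S - {k}" "pathfinish p = pathstart p"
    then have "winding_number p k = of_int (wind p k)"
      by (subst of_int_wind) auto
    then have "\<Phi> p = \<Phi> (d (wind p k))"
      using p d by (intro path_functional_one_puncture_eq[OF assms]) simp_all
    then show "\<Phi> p = \<Phi> (d 1) [^]\<^bsub>M\<^esub> wind p k" using pow[of "wind p k"] by (rule trans)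
  qed
qed

lemma tethered_wind_add:
  assumes p: "path p" "path_image p \<subseteq> - {k}" "u \<in> {0..1}" "v \<in> {0..1}" "w \<in> {0..1}"
    and \<tau>: "\<And>t. t \<in> {0..1} \<Longrightarrow> path (\<tau> t) \<and> path_image (\<tau> t) \<subseteq> - {k} \<and> pathstart (\<tau> t) = b \<and> pathfinish (\<tau> t) = p t"
  shows "wind (\<tau> u +++ (subpath u w p +++ reversepath (\<tau> w))) k =
    wind (\<tau> u +++ (subpath u v p +++ reversepath (\<tau> v))) k + wind (\<tau> v +++ (subpath v w p +++ reversepath (\<tau> w))) k"
proof -
  have loop: "of_int (wind (\<tau> s +++ (subpath s t p +++ reversepath (\<tau> t))) k)
      = winding_number (\<tau> s +++ (subpath s t p +++ reversepath (\<tau> t))) k" if "s \<in> {0..1}" "t \<in> {0..1}" for s t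
  proof (rule of_int_wind)
    show "k \<notin> path_image (\<tau> s +++ (subpath s t p +++ reversepath (\<tau> t)))"
      using \<tau>[OF that(1)] \<tau>[OF that(2)] p path_image_subpath_in[OF p(2) that]
      by (auto simp: path_image_join)
  qed (use \<tau>[OF that(1)] \<tau>[OF that(2)] p that in auto)
  interpret path_functional complex_add "- {k}" "\<lambda>p. winding_number p k"
    by (rule path_functional_winding_number)
  have "of_int (wind (\<tau> u +++ (subpath u w p +++ reversepath (\<tau> w))) k) =
    (of_int (wind (\<tau> u +++ (subpath u v p +++ reversepath (\<tau> v))) k + wind (\<tau> v +++ (subpath v w p +++ reversepath (\<tau> w))) k) :: complex)"
    using tether_mult[of p u v w \<tau> b] assms by (simp add: loop complex_add_def)
  then show ?thesis by (simp only: of_int_eq_iff)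
qed

text \<open>In other words, the first homology of a punctured convex region is generated by one circle around
  each puncture. The induction splits the region along a line that separates two punctures: the two
  halves are widened to overlap in a convex strip free of punctures. Loops that stay in one half are
  covered by the induction hypothesis, and a general loop is a sum of such loops, because it can be
  tethered to a point of the strip at all of its points.\<close>

lemma path_functional_punctured_convex:
  assumes "path_functional M (S - K) \<Phi>" "convex S" "open S" "finite K" "K \<subseteq> S"
  shows "\<exists>e. e \<in> K \<rightarrow> carrier M \<and> (\<forall>p. path p \<longrightarrow> path_image p \<subseteq> S - K \<longrightarrow> pathfinish p = pathstart p
           \<longrightarrow> \<Phi> p = (\<Otimes>\<^bsub>M\<^esub>k\<in>K. e k [^]\<^bsub>M\<^esub> wind p k))"
  using assms
proof (induction "card K" arbitrary: S K rule: less_induct)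
  case less
  interpret path_functional M "S - K" \<Phi> by (rule less.prems)
  consider "K = {}" | k where "K = {k}" | k1 k2 where "k1 \<in> K" "k2 \<in> K" "k1 \<noteq> k2" by blast
  then show ?case
  proof cases
    case 1
    then show ?thesis
      using path_functional_convex_loop[OF less.prems(1)] less.prems(2) by auto
  next
    case (2 k)
    then obtain e where "e \<in> carrier M"
      "\<And>p. \<lbrakk>path p; path_image p \<subseteq> S - {k}; pathfinish p = pathstart p\<rbrakk> \<Longrightarrow> \<Phi> p = e [^]\<^bsub>M\<^esub> wind p k"
      using path_functional_one_puncture[of M S k \<Phi>] less.prems by auto
    then show ?thesis
      using 2 by (intro exI[of _ "\<lambda>_. e"]) auto
  next
    case (3 k1 k2)
    \<comment> \<open>The levels of \<open>f\<close> are the lines perpendicular to the segment from \<open>k1\<close> to \<open>k2\<close>; the level \<open>c\<close>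
      separates these two points and contains no puncture, and neither does the strip of width \<open>2\<epsilon>\<close>
      around it.\<close>
    define f where "f z = (k2 - k1) \<bullet> z" for z :: complex
    have "0 < (k2 - k1) \<bullet> (k2 - k1)"
      using 3 by simp
    then have f12: "f k1 < f k2"
      by (simp only: f_def inner_diff_right)
    have "infinite ({f k1<..<f k2} - f ` K)"
      using f12 less.prems(4) by (simp add: Diff_infinite_finite infinite_Ioo)
    then obtain c where c: "f k1 < c" "c < f k2" "c \<notin> f ` K"
      by (metis Diff_iff finite.emptyI greaterThanLessThan_iff infinite_imp_nonempty ex_in_conv)
    obtain \<epsilon> where \<epsilon>: "\<epsilon> > 0" "\<And>k. k \<in> K \<Longrightarrow> \<epsilon> \<le> dist c (f k)"
      using finite_set_avoid[of "f ` K" c] less.prems(4) c(3) by (metis finite_imageI imageI)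
    define S1 S2 K1 K2 where "S1 = S \<inter> {z. f z < c + \<epsilon>}" and "S2 = S \<inter> {z. f z > c - \<epsilon>}"
      and "K1 = {k \<in> K. f k < c}" and "K2 = {k \<in> K. f k > c}"
    note defs = S1_def S2_def K1_def K2_def
    have K12: "K = K1 \<union> K2" "K1 \<inter> K2 = {}" and fin: "finite K1" "finite K2"
      using c(3) less.prems(4) by (auto simp: defs)
    have card: "card K1 < card K" "card K2 < card K"
      using 3 c less.prems(4) by (intro psubset_card_mono; force simp: defs)+
    have sub: "K1 \<subseteq> S1" "K2 \<subseteq> S2" "S1 \<inter> K2 = {}" "S2 \<inter> K1 = {}"
    proof -
      have "f k \<le> c - \<epsilon>" if "k \<in> K1" for k
        using \<epsilon>(2)[of k] that by (simp add: K1_def dist_real_def abs_if split: if_splits)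
      moreover have "f k \<ge> c + \<epsilon>" if "k \<in> K2" for k
        using \<epsilon>(2)[of k] that by (simp add: K2_def dist_real_def abs_if split: if_splits)
      ultimately show "K1 \<subseteq> S1" "K2 \<subseteq> S2" "S1 \<inter> K2 = {}" "S2 \<inter> K1 = {}"
        using \<epsilon>(1) less.prems(5) K12(1) unfolding S1_def S2_def by (fastforce, fastforce, auto dest!: leD)
    qed
    have SS: "S = S1 \<union> S2" "S1 - K1 = S1 - K" "S2 - K2 = S2 - K" "S1 - K1 \<subseteq> S - K" "S2 - K2 \<subseteq> S - K"
      using \<epsilon>(1) sub K12 by (auto simp: S1_def S2_def)
    have cv: "convex S1" "convex S2"
      using less.prems(2) by (auto simp: defs f_def convex_halfspace_lt convex_halfspace_gt intro!: convex_Int)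
    have op: "open S1" "open S2"
      using less.prems(3) by (auto simp: defs f_def open_halfspace_lt open_halfspace_gt intro!: open_Int)
    obtain e1 where e1: "e1 \<in> K1 \<rightarrow> carrier M"
      "\<And>p. \<lbrakk>path p; path_image p \<subseteq> S1 - K1; pathfinish p = pathstart p\<rbrakk> \<Longrightarrow> \<Phi> p = (\<Otimes>\<^bsub>M\<^esub>k\<in>K1. e1 k [^]\<^bsub>M\<^esub> wind p k)"
      using less.hyps[OF card(1) subset[OF SS(4)] cv(1) op(1) fin(1) sub(1)] by blast
    obtain e2 where e2: "e2 \<in> K2 \<rightarrow> carrier M"
      "\<And>p. \<lbrakk>path p; path_image p \<subseteq> S2 - K2; pathfinish p = pathstart p\<rbrakk> \<Longrightarrow> \<Phi> p = (\<Otimes>\<^bsub>M\<^esub>k\<in>K2. e2 k [^]\<^bsub>M\<^esub> wind p k)"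
      using less.hyps[OF card(2) subset[OF SS(5)] cv(2) op(2) fin(2) sub(2)] by blast
    define e where "e k = (if k \<in> K1 then e1 k else e2 k)" for k
    have e: "e \<in> K \<rightarrow> carrier M"
      using e1(1) e2(1) K12 by (auto simp: e_def)
    define F where "F p = (\<Otimes>\<^bsub>M\<^esub>k\<in>K. e k [^]\<^bsub>M\<^esub> wind p k)" for p
    have F1: "\<Phi> p = F p" if p: "path p" "path_image p \<subseteq> S1 - K" "pathfinish p = pathstart p" for p
    proof -
      have "wind p k = 0" if "k \<in> K2" for k
        using that sub p cv by (intro wind_outside_convex[of p S1]) auto
      then have "F p = (\<Otimes>\<^bsub>M\<^esub>k\<in>K1. e1 k [^]\<^bsub>M\<^esub> wind p k)"
        unfolding F_def using e1(1) e2(1) K12 fin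
        by (intro finprod_mono_neutral_cong) (auto simp: e_def Pi_iff)
      then show ?thesis using e1(2)[OF p(1) _ p(3)] p SS by simp
    qed
    have F2: "\<Phi> p = F p" if p: "path p" "path_image p \<subseteq> S2 - K" "pathfinish p = pathstart p" for p
    proof -
      have "wind p k = 0" if "k \<in> K1" for k
        using that sub p cv by (intro wind_outside_convex[of p S2]) auto
      then have "F p = (\<Otimes>\<^bsub>M\<^esub>k\<in>K2. e2 k [^]\<^bsub>M\<^esub> wind p k)"
        unfolding F_def using e1(1) e2(1) K12 fin
        by (intro finprod_mono_neutral_cong) (auto simp: e_def Pi_iff)
      then show ?thesis using e2(2)[OF p(1) _ p(3)] p SS by simp
    qed
    obtain m where m: "m \<in> S1" "m \<in> S2"
    proof
      define s where "s = (c - f k1) / (f k2 - f k1)"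
      have s: "0 \<le> s" "s \<le> 1" using c by (auto simp: s_def field_simps)
      let ?m = "(1 - s) *\<^sub>R k1 + s *\<^sub>R k2"
      have "f ?m = f k1 + s * (f k2 - f k1)"
        by (simp add: f_def algebra_simps inner_add_right)
      also have "\<dots> = c" using c by (simp add: s_def)
      finally have "f ?m = c" .
      moreover have "?m \<in> S"
        using convexD_alt[OF less.prems(2), of k1 k2 s] 3 less.prems(5) s by auto
      ultimately show "?m \<in> S1" "?m \<in> S2" using \<epsilon>(1) by (auto simp: S1_def S2_def)
    qed
    then have mK: "m \<notin> K" using sub K12 by auto
    have pc: "path_connected (S1 - K)" "path_connected (S2 - K)"
      using op cv less.prems(4)
      by (auto intro!: path_connected_open_diff_countable convex_connected countable_finite)
    \<comment> \<open>A tether to a point of the strip has to stay in both halves; there the straight segment serves.\<close>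
    have "\<exists>\<tau>. path \<tau> \<and> pathstart \<tau> = m \<and> pathfinish \<tau> = z \<and> (z \<in> S1 \<longrightarrow> path_image \<tau> \<subseteq> S1 - K) \<and>
        (z \<in> S2 \<longrightarrow> path_image \<tau> \<subseteq> S2 - K)" if z: "z \<in> S - K" for z
    proof -
      consider "z \<in> S1" "z \<in> S2" | "z \<in> S1" "z \<notin> S2" | "z \<notin> S1" "z \<in> S2" using z SS(1) by blast
      then show ?thesis
      proof cases
        case 1
        then have "closed_segment m z \<subseteq> S1 \<inter> S2"
          using m cv by (intro closed_segment_subset convex_Int) auto
        moreover have "S1 \<inter> S2 \<inter> K = {}" using sub K12 by blast
        ultimately show ?thesis by (intro exI[of _ "linepath m z"]) auto
      next
        case 2
        then obtain g where "path g" "path_image g \<subseteq> S1 - K" "pathstart g = m" "pathfinish g = z"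
          using pc(1) m mK z unfolding path_connected_def by (metis DiffI DiffD2)
        then show ?thesis using 2 by auto
      next
        case 3
        then obtain g where "path g" "path_image g \<subseteq> S2 - K" "pathstart g = m" "pathfinish g = z"
          using pc(2) m mK z unfolding path_connected_def by (metis DiffI DiffD2)
        then show ?thesis using 3 by auto
      qed
    qed
    then have "\<forall>z\<in>S - K. \<exists>\<tau>. path \<tau> \<and> pathstart \<tau> = m \<and> pathfinish \<tau> = z \<and> (z \<in> S1 \<longrightarrow> path_image \<tau> \<subseteq> S1 - K) \<and>
        (z \<in> S2 \<longrightarrow> path_image \<tau> \<subseteq> S2 - K)" by blast
    from bchoice[OF this] obtain \<tau> where \<tau>: "\<And>z. z \<in> S - K \<Longrightarrow> path (\<tau> z) \<and> pathstart (\<tau> z) = m \<and> pathfinish (\<tau> z) = z \<and>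
        (z \<in> S1 \<longrightarrow> path_image (\<tau> z) \<subseteq> S1 - K) \<and> (z \<in> S2 \<longrightarrow> path_image (\<tau> z) \<subseteq> S2 - K)"
      by blast
    have "\<Phi> p = F p" if p: "path p" "path_image p \<subseteq> S - K" "pathfinish p = pathstart p" for p
    proof -
      let ?L = "\<lambda>u v. \<tau> (p u) +++ (subpath u v p +++ reversepath (\<tau> (p v)))"
      have pin: "p t \<in> S - K" if "t \<in> {0..1}" for t
        using p(2) that by (simp add: path_image_def image_subset_iff)
      have \<tau>p: "path (\<tau> (p t)) \<and> path_image (\<tau> (p t)) \<subseteq> S - K \<and> pathstart (\<tau> (p t)) = m \<and> pathfinish (\<tau> (p t)) = p t"
        if "t \<in> {0..1}" for t
        using \<tau>[OF pin[OF that]] pin[OF that] SS by auto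
      have "0 \<le> (0::real) \<and> (1::real) \<le> 1 \<longrightarrow> \<Phi> (?L 0 1) = F (?L 0 1)"
      proof (rule Bolzano[of 0 1 "\<lambda>u v. 0 \<le> u \<and> v \<le> 1 \<longrightarrow> \<Phi> (?L u v) = F (?L u v)"])
        fix u v w :: real
        assume uv: "0 \<le> u \<and> v \<le> 1 \<longrightarrow> \<Phi> (?L u v) = F (?L u v)" and vw: "0 \<le> v \<and> w \<le> 1 \<longrightarrow> \<Phi> (?L v w) = F (?L v w)"
          and le: "u \<le> v" "v \<le> w"
        show "0 \<le> u \<and> w \<le> 1 \<longrightarrow> \<Phi> (?L u w) = F (?L u w)"
        proof
          assume "0 \<le> u \<and> w \<le> 1"
          then have I: "u \<in> {0..1}" "v \<in> {0..1}" "w \<in> {0..1}" using le by auto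
          have "\<Phi> (?L u w) = \<Phi> (?L u v) \<otimes>\<^bsub>M\<^esub> \<Phi> (?L v w)"
            by (rule tether_mult[OF p(1,2) I, of "\<lambda>t. \<tau> (p t)" m]) (rule \<tau>p)
          also have "\<dots> = F (?L u v) \<otimes>\<^bsub>M\<^esub> F (?L v w)" using uv vw I by auto
          also have "\<dots> = (\<Otimes>\<^bsub>M\<^esub>k\<in>K. e k [^]\<^bsub>M\<^esub> wind (?L u v) k \<otimes>\<^bsub>M\<^esub> e k [^]\<^bsub>M\<^esub> wind (?L v w) k)"
            unfolding F_def using e by (intro finprod_multf[symmetric]) (auto intro!: int_pow_closed)
          also have "\<dots> = F (?L u w)"
            unfolding F_def
          proof (rule finprod_cong', goal_cases)
            case (3 k)
            have "wind (?L u w) k = wind (?L u v) k + wind (?L v w) k"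
              by (rule tethered_wind_add[OF p(1) _ I, of k "\<lambda>t. \<tau> (p t)" m]) (use 3 p(2) \<tau>p in blast)+
            then show ?case using e 3 by (simp add: int_pow_mult Pi_iff)
          qed (use e in \<open>auto intro!: int_pow_closed\<close>)
          finally show "\<Phi> (?L u w) = F (?L u w)" .
        qed
      next
        fix t :: real assume t: "0 \<le> t" "t \<le> 1"
        \<comment> \<open>The two halves are treated alike; \<open>U\<close> stands for one of them.\<close>
        have local: "\<exists>d>0. \<forall>u v. u \<le> t \<and> t \<le> v \<and> v - u < d \<longrightarrow> 0 \<le> u \<and> v \<le> 1 \<longrightarrow> \<Phi> (?L u v) = F (?L u v)"
          if U: "open U" "p t \<in> U" and FU: "\<And>q. \<lbrakk>path q; path_image q \<subseteq> U - K; pathfinish q = pathstart q\<rbrakk> \<Longrightarrow> \<Phi> q = F q"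
            and \<tau>U: "\<And>z. \<lbrakk>z \<in> S - K; z \<in> U\<rbrakk> \<Longrightarrow> path_image (\<tau> z) \<subseteq> U - K" for U
        proof -
          obtain d where d: "d > 0" "\<And>u v. \<lbrakk>0 \<le> u; u \<le> t; t \<le> v; v \<le> 1; v - u < d\<rbrakk> \<Longrightarrow>
              p ` {u..v} \<subseteq> U \<and> path_image (subpath u v p) \<subseteq> U"
            using path_near_subpath[OF p(1) _ U] t by auto
          have "\<Phi> (?L u v) = F (?L u v)" if uv: "u \<le> t" "t \<le> v" "v - u < d" "0 \<le> u" "v \<le> 1" for u v
          proof -
            have I: "u \<in> {0..1}" "v \<in> {0..1}" using uv t by auto
            have "p u \<in> U" "p v \<in> U" and sU: "path_image (subpath u v p) \<subseteq> U - K"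
              using d(2)[of u v] uv path_image_subpath_in[OF p(2) I] by auto
            then have "path_image (\<tau> (p u)) \<subseteq> U - K" "path_image (\<tau> (p v)) \<subseteq> U - K"
              using pin[OF I(1)] pin[OF I(2)] \<tau>U by auto
            then show ?thesis
              using \<tau>p[OF I(1)] \<tau>p[OF I(2)] sU p(1) I
              by (intro FU) (auto simp: path_image_join)
          qed
          then show ?thesis using d(1) by blast
        qed
        consider "p t \<in> S1" | "p t \<in> S2" using pin[of t] t SS by auto
        then show "\<exists>d>0. \<forall>u v. u \<le> t \<and> t \<le> v \<and> v - u < d \<longrightarrow> 0 \<le> u \<and> v \<le> 1 \<longrightarrow> \<Phi> (?L u v) = F (?L u v)"
        proof cases
          case 1
          then show ?thesis using \<tau> by (intro local[OF op(1) 1 F1]) simp_all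
        next
          case 2
          then show ?thesis using \<tau> by (intro local[OF op(2) 2 F2]) simp_all
        qed
      qed simp
      then have eq: "\<Phi> (?L 0 1) = F (?L 0 1)" by simp
      have p01: "p 1 = p 0" using p(3) by (simp add: pathfinish_def pathstart_def)
      have "\<Phi> (?L 0 1) = \<Phi> p"
        using \<tau>p[of 0] p by (simp add: p01 conjugate_loop pathstart_def)
      moreover have "wind (?L 0 1) k = wind p k" if "k \<in> K" for k
      proof -
        have "path_image (\<tau> (p 0)) \<subseteq> - {k}" "path_image p \<subseteq> - {k}"
          using \<tau>p[of 0] p(2) that by auto
        then show ?thesis
          using path_functional.conjugate_loop[OF path_functional_winding_number[of k], of "\<tau> (p 0)" p] \<tau>p[of 0] p
          by (simp add: p01 pathstart_def wind_def)
      qed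
      then have "F (?L 0 1) = F p"
        unfolding F_def using e by (intro finprod_cong') (auto intro!: int_pow_closed)
      ultimately show ?thesis using eq by simp
    qed
    then show ?thesis using e unfolding F_def by blast
  qed
qed

lemma path_functional_punctured_plane_eq:
  assumes "path_functional M (- K) \<Phi>" "finite K"
    and p: "path p" "path_image p \<subseteq> - K" "pathfinish p = pathstart p"
    and q: "path q" "path_image q \<subseteq> - K" "pathfinish q = pathstart q"
    and eq: "\<And>k. k \<in> K \<Longrightarrow> winding_number p k = winding_number q k"
  shows "\<Phi> p = \<Phi> q"
proof -
  interpret path_functional M "- K" \<Phi> by fact
  have "path_functional M (UNIV - K) \<Phi>" using assms(1) by (simp add: Compl_eq_Diff_UNIV)
  then obtain e where e: "e \<in> K \<rightarrow> carrier M" "\<And>p. \<lbrakk>path p; path_image p \<subseteq> - K; pathfinish p = pathstart p\<rbrakk>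
      \<Longrightarrow> \<Phi> p = (\<Otimes>\<^bsub>M\<^esub>k\<in>K. e k [^]\<^bsub>M\<^esub> wind p k)"
    using path_functional_punctured_convex[of M UNIV K \<Phi>] assms(2) by (auto simp: Compl_eq_Diff_UNIV)
  have "(\<Otimes>\<^bsub>M\<^esub>k\<in>K. e k [^]\<^bsub>M\<^esub> wind p k) = (\<Otimes>\<^bsub>M\<^esub>k\<in>K. e k [^]\<^bsub>M\<^esub> wind q k)"
    using e(1) eq by (intro finprod_cong') (auto simp: wind_def Pi_iff)
  then show ?thesis using e(2)[OF p] e(2)[OF q] by simp
qed

text \<open>The vectors of winding numbers of loops at \<open>b\<close> form a group, so it suffices that the unit vectors
  occur.\<close>

lemma winding_numbers_realized:
  fixes m :: "complex \<Rightarrow> int"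
  assumes "finite K" "C \<inter> K = {}" "b \<in> C"
    and c: "\<And>k. k \<in> K \<Longrightarrow> path (c k) \<and> path_image (c k) \<subseteq> C \<and> pathstart (c k) = b \<and> pathfinish (c k) = b"
    and w: "\<And>j k. \<lbrakk>j \<in> K; k \<in> K\<rbrakk> \<Longrightarrow> winding_number (c k) j = (if j = k then 1 else 0)"
  shows "\<exists>p. path p \<and> path_image p \<subseteq> C \<and> pathstart p = b \<and> pathfinish p = b \<and>
    (\<forall>k\<in>K. winding_number p k = of_int (m k))"
proof -
  define R where "R f \<longleftrightarrow> (\<exists>p. path p \<and> path_image p \<subseteq> C \<and> pathstart p = b \<and> pathfinish p = b \<and>
      (\<forall>k\<in>K. winding_number p k = f k))" for f :: "complex \<Rightarrow> complex"
  have notin: "k \<notin> path_image p" if "path_image p \<subseteq> C" "k \<in> K" for p k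
    using that assms(2) by auto
  have R0: "R (\<lambda>_. 0)"
  proof -
    have "winding_number (linepath b b) k = 0" if "k \<in> K" for k
      using that assms(2,3) by (intro winding_number_trivial) auto
    then show ?thesis
      unfolding R_def using assms(3) by (intro exI[of _ "linepath b b"]) simp
  qed
  have add: "R (\<lambda>k. f k + g k)" if fg: "R f" "R g" for f g
  proof -
    obtain p q where "path p" "path_image p \<subseteq> C" "pathstart p = b" "pathfinish p = b" "\<forall>k\<in>K. winding_number p k = f k"
      "path q" "path_image q \<subseteq> C" "pathstart q = b" "pathfinish q = b" "\<forall>k\<in>K. winding_number q k = g k"
      using fg unfolding R_def by blast
    then show ?thesis
      unfolding R_def by (intro exI[of _ "p +++ q"]) (auto simp: path_image_join winding_number_join notin)
  qed
  have neg: "R (\<lambda>k. - f k)" if fg: "R f" for f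
  proof -
    obtain p where "path p" "path_image p \<subseteq> C" "pathstart p = b" "pathfinish p = b" "\<forall>k\<in>K. winding_number p k = f k"
      using fg unfolding R_def by blast
    then show ?thesis
      unfolding R_def by (intro exI[of _ "reversepath p"]) (auto simp: winding_number_reversepath notin)
  qed
  have unit: "R (\<lambda>j. if j = k then of_int i else 0)" if "k \<in> K" for k and i :: int
  proof (induction i rule: int_induct[where k = 0])
    case base
    show ?case using R0 by (simp cong: if_cong)
  next
    case (step1 i)
    have "R (\<lambda>j. if j = k then 1 else 0)" unfolding R_def using c[OF that] w that by blast
    from add[OF step1(2) this] show ?case by (rule back_subst[of R]) auto
  next
    case (step2 i)
    have "R (\<lambda>j. if j = k then 1 else 0)" unfolding R_def using c[OF that] w that by blast
    from add[OF step2(2) neg[OF this]] show ?case by (rule back_subst[of R]) auto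
  qed
  have "R (\<lambda>k. if k \<in> J then of_int (m k) else 0)" if "J \<subseteq> K" for J
    using finite_subset[OF that assms(1)] that
  proof (induction J)
    case (insert k J)
    then have "R (\<lambda>j. if j \<in> J then of_int (m j) else 0)" "k \<in> K" by auto
    from add[OF this(1) unit[OF this(2), of "m k"]] show ?case
      by (rule back_subst[of R]) (use insert.hyps in auto)
  qed (use R0 in simp)
  from this[of K] show ?thesis
    unfolding R_def by simp
qed

text \<open>A small circle around \<open>k\<close>, tethered to \<open>b\<close>.\<close>

lemma meridian_exists:
  fixes K :: "complex set"
  assumes "finite K" "k \<in> K" "b \<notin> K"
  obtains c where "path c" "path_image c \<subseteq> - K" "pathstart c = b" "pathfinish c = b"
    "\<And>j. j \<in> K \<Longrightarrow> winding_number c j = (if j = k then 1 else 0)"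
proof -
  obtain r where r: "r > 0" "cball k r \<inter> K \<subseteq> {k}"
  proof -
    obtain d where "d > 0" "\<And>j. \<lbrakk>j \<in> K; j \<noteq> k\<rbrakk> \<Longrightarrow> d \<le> dist k j"
      using finite_set_avoid[OF assms(1)] by metis
    then have "cball k (d / 2) \<inter> K \<subseteq> {k}" by force
    with \<open>d > 0\<close> show thesis by (intro that[of "d / 2"]) auto
  qed
  let ?d = "circle_loop k r 1"
  note d = circle_loop[OF r(1), of k 1]
  have dK: "path_image ?d \<subseteq> - K" and dr: "path_image ?d \<subseteq> cball k r"
    using d(4) r by fastforce+
  have "path_connected (- K)"
    using path_connected_open_diff_countable[of UNIV K] assms(1) by (simp add: Compl_eq_Diff_UNIV countable_finite connected_UNIV)
  moreover have "k + of_real r \<in> - K"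
    using dK d(2) by (metis pathstart_in_path_image subsetD)
  ultimately obtain \<sigma> where \<sigma>: "path \<sigma>" "path_image \<sigma> \<subseteq> - K" "pathstart \<sigma> = b" "pathfinish \<sigma> = k + of_real r"
    using assms(3) unfolding path_connected_def by (metis ComplI)
  show thesis
  proof (rule that[of "\<sigma> +++ (?d +++ reversepath \<sigma>)"])
    show "winding_number (\<sigma> +++ (?d +++ reversepath \<sigma>)) j = (if j = k then 1 else 0)" if "j \<in> K" for j
    proof -
      have sub: "path_image \<sigma> \<subseteq> - {j}" "path_image ?d \<subseteq> - {j}" using \<sigma>(2) dK that by auto
      have "winding_number (\<sigma> +++ (?d +++ reversepath \<sigma>)) j = winding_number ?d j"
        by (rule path_functional.conjugate_loop[OF path_functional_winding_number])
          (use \<sigma> d sub in simp_all)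
      also have "\<dots> = (if j = k then 1 else 0)"
      proof (cases "j = k")
        case False
        then have "j \<notin> cball k r" using r(2) that by blast
        then show ?thesis
          using winding_number_zero_outside[OF d(1) convex_cball _ _ dr] d False by simp
      qed (use d in simp)
      finally show ?thesis .
    qed
  qed (use \<sigma> d dK in \<open>simp_all add: path_image_join\<close>)
qed

lemma winding_number_scaled:
  assumes "path p" "k \<notin> path_image p" "c \<noteq> 0"
  shows "winding_number (\<lambda>t. c * (p t - k)) 0 = winding_number p k"
proof -
  obtain q where q: "path q" "pathfinish q - pathstart q = 2 * of_real pi * \<i> * winding_number p k"
      "\<And>t. t \<in> {0..1} \<Longrightarrow> p t = k + exp (q t)"
    using winding_number_as_continuous_log[OF assms(1,2)] by metis
  obtain d where d: "c = exp d" using assms(3) by (metis exp_Ln)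
  have "path (\<lambda>t. d + q t)" using q(1) unfolding path_def by (intro continuous_intros)
  then have "winding_number (exp \<circ> (\<lambda>t. d + q t)) 0 = winding_number p k"
    using q(2) by (simp add: winding_number_compose_exp pathfinish_def pathstart_def)
  moreover have "winding_number (\<lambda>t. c * (p t - k)) 0 = winding_number (exp \<circ> (\<lambda>t. d + q t)) 0"
    by (rule winding_number_cong) (simp add: q(3) d exp_add)
  ultimately show ?thesis by simp
qed

section \<open>Linear forms and general position\<close>

definition linear_form :: "(complex^'n \<Rightarrow> complex) \<Rightarrow> bool" where
  "linear_form f \<longleftrightarrow> (\<forall>u v. f (u + v) = f u + f v) \<and> (\<forall>c v. f (c *s v) = c * f v)"

lemma linear_form_simps:
  assumes "linear_form f"
  shows "f (u + v) = f u + f v" "f (c *s v) = c * f v" "f (u - v) = f u - f v" "f 0 = 0"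
proof -
  show add: "f (u + v) = f u + f v" "f (c *s v) = c * f v" for u v c using assms by (auto simp: linear_form_def)
  show "f (u - v) = f u - f v" using add(1)[of "u - v" v] by simp
  show "f 0 = 0" using add(1)[of 0 0] by simp
qed

lemma continuous_on_linear_form:
  assumes "linear_form f" "continuous_on S g"
  shows "continuous_on S (\<lambda>x. f (g x))"
proof -
  have "linear f"
  proof (rule linearI)
    show "f (r *\<^sub>R v) = r *\<^sub>R f v" for r v
    proof -
      have "r *\<^sub>R v = complex_of_real r *s v"
        by (simp add: vec_eq_iff vector_scaleR_component scaleR_conv_of_real[where 'a = complex])
      then show ?thesis using assms(1) by (simp add: linear_form_simps scaleR_conv_of_real[where 'a = complex])
    qed
  qed (use assms in \<open>simp add: linear_form_simps\<close>)
  then have "bounded_linear f" by (simp add: linear_conv_bounded_linear)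
  then show ?thesis using assms(2) by (rule bounded_linear.continuous_on)
qed

lemma continuous_on_vector_scalar_mult [continuous_intros]:
  fixes g :: "'a::topological_space \<Rightarrow> complex^'n"
  assumes "continuous_on S f" "continuous_on S g"
  shows "continuous_on S (\<lambda>x. f x *s g x)"
  unfolding vector_scalar_mult_def by (intro continuous_intros assms)

text \<open>Affinity along complex lines is all that general position arguments use: on a line such a
  function vanishes identically or at one point at most.\<close>

definition complex_affine :: "(complex^'n \<Rightarrow> complex) \<Rightarrow> bool" where
  "complex_affine f \<longleftrightarrow> (\<forall>p q z. f (p + z *s (q - p)) = f p + z * (f q - f p))"

lemma finite_zeros_on_line:
  assumes "complex_affine f" "f p \<noteq> 0 \<or> f q \<noteq> 0"
  shows "finite {z. f (p + z *s (q - p)) = 0}"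
proof (cases "f q = f p")
  case True
  then show ?thesis using assms by (simp add: complex_affine_def)
next
  case False
  have "{z. f (p + z *s (q - p)) = 0} \<subseteq> {f p / (f p - f q)}"
    using False unfolding assms(1)[unfolded complex_affine_def, rule_format]
    by (auto simp: eq_divide_eq algebra_simps)
  then show ?thesis by (rule finite_subset) simp
qed

lemma finite_zeros_on_line_family:
  assumes "finite F" "\<And>f. f \<in> F \<Longrightarrow> complex_affine f" "\<And>f. f \<in> F \<Longrightarrow> f p \<noteq> 0 \<or> f q \<noteq> 0"
  shows "finite {z. \<exists>f\<in>F. f (p + z *s (q - p)) = 0}"
proof -
  have "finite (\<Union>f\<in>F. {z. f (p + z *s (q - p)) = 0})"
    by (rule finite_UN_I[OF assms(1)]) (rule finite_zeros_on_line[OF assms(2,3)])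
  then show ?thesis by (rule rev_finite_subset) blast
qed

text \<open>A complex vector space is not a finite union of affine hyperplanes. In the induction step the new
  point is sought on a line, where each function excludes at most one parameter.\<close>

lemma common_nonzero_exists:
  assumes "finite F" "\<And>f. f \<in> F \<Longrightarrow> complex_affine f" "\<And>f. f \<in> F \<Longrightarrow> \<exists>v. f v \<noteq> 0"
  shows "\<exists>v. \<forall>f\<in>F. f v \<noteq> 0"
  using assms
proof (induction F)
  case (insert g F)
  then obtain p q where p: "\<forall>f\<in>F. f p \<noteq> 0" and q: "g q \<noteq> 0" by (metis insertCI)
  have "finite {z. \<exists>f\<in>insert g F. f (p + z *s (q - p)) = 0}"
    using insert.prems(1) insert.hyps(1) p q by (intro finite_zeros_on_line_family) auto
  then obtain z where "z \<notin> {z. \<exists>f\<in>insert g F. f (p + z *s (q - p)) = 0}"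
    using ex_new_if_finite[OF infinite_UNIV_char_0] by blast
  then show ?case by blast
qed simp

lemma nonzero_dense:
  fixes U :: "(complex^'n) set"
  assumes "finite F" "\<And>f. f \<in> F \<Longrightarrow> complex_affine f" "\<And>f. f \<in> F \<Longrightarrow> \<exists>v. f v \<noteq> 0" "open U" "U \<noteq> {}"
  obtains v where "v \<in> U" "\<And>f. f \<in> F \<Longrightarrow> f v \<noteq> 0"
proof -
  obtain p where p: "p \<in> U" using assms(5) by blast
  obtain q where q: "\<And>f. f \<in> F \<Longrightarrow> f q \<noteq> 0" using common_nonzero_exists[OF assms(1-3)] by blast
  let ?V = "{z. p + z *s (q - p) \<in> U}"
  have "open ?V"
    using open_vimage[OF assms(4), of "\<lambda>z. p + z *s (q - p)"]
    by (simp add: vimage_def continuous_intros)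
  moreover have "0 \<in> ?V" using p by simp
  ultimately have "infinite ?V" using finite_imp_not_open by blast
  moreover have "finite {z. \<exists>f\<in>F. f (p + z *s (q - p)) = 0}"
    using assms(1,2) q by (intro finite_zeros_on_line_family) auto
  ultimately obtain z where "z \<in> ?V" "z \<notin> {z. \<exists>f\<in>F. f (p + z *s (q - p)) = 0}"
    by (metis (lifting) finite_subset subsetI)
  then show thesis using that by blast
qed

text \<open>On the complex line through two points of the set, the conditions exclude finitely many points of
  a convex open set of parameters, and the plane region that remains is path connected.\<close>

lemma path_connected_nonzero:
  fixes U :: "(complex^'n) set"
  assumes "finite F" "\<And>f. f \<in> F \<Longrightarrow> complex_affine f" "open U" "convex U"
  shows "path_connected (U \<inter> {v. \<forall>f\<in>F. f v \<noteq> 0})"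
  unfolding path_connected_def
proof (intro ballI)
  fix p q assume p: "p \<in> U \<inter> {v. \<forall>f\<in>F. f v \<noteq> 0}" and q: "q \<in> U \<inter> {v. \<forall>f\<in>F. f v \<noteq> 0}"
  define l where "l z = p + z *s (q - p)" for z
  have l: "continuous_on UNIV l" unfolding l_def by (intro continuous_intros)
  have "open (l -` U)" using open_vimage[OF assms(3) l] .
  moreover have "convex (l -` U)"
  proof (rule convexI)
    fix x y and u v :: real
    assume *: "x \<in> l -` U" "y \<in> l -` U" "0 \<le> u" "0 \<le> v" "u + v = 1"
    have "l (u *\<^sub>R x + v *\<^sub>R y) = u *\<^sub>R l x + v *\<^sub>R l y"
    proof -
      have "v = 1 - u" using * by simp
      show ?thesis unfolding \<open>v = 1 - u\<close>
        by (simp add: l_def vec_eq_iff vector_scaleR_component scaleR_conv_of_real[where 'a = complex] algebra_simps)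
    qed
    then show "u *\<^sub>R x + v *\<^sub>R y \<in> l -` U" using convexD[OF assms(4), of "l x" "l y" u v] * by simp
  qed
  moreover have fin: "finite {z. \<exists>f\<in>F. f (l z) = 0}"
    unfolding l_def using assms(1,2) p by (intro finite_zeros_on_line_family) auto
  ultimately have "path_connected (l -` U - {z. \<exists>f\<in>F. f (l z) = 0})"
    by (intro path_connected_open_diff_countable convex_connected countable_finite) auto
  moreover have "0 \<in> l -` U - {z. \<exists>f\<in>F. f (l z) = 0}" "1 \<in> l -` U - {z. \<exists>f\<in>F. f (l z) = 0}"
    using p q by (auto simp: l_def)
  ultimately obtain g where g: "path g" "path_image g \<subseteq> l -` U - {z. \<exists>f\<in>F. f (l z) = 0}" "pathstart g = 0" "pathfinish g = 1"
    unfolding path_connected_def by blast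
  show "\<exists>g. path g \<and> path_image g \<subseteq> U \<inter> {v. \<forall>f\<in>F. f v \<noteq> 0} \<and> pathstart g = p \<and> pathfinish g = q"
  proof (intro exI conjI)
    show "path (l \<circ> g)" using g(1) l by (intro path_continuous_image continuous_on_subset[OF l]) auto
    show "path_image (l \<circ> g) \<subseteq> U \<inter> {v. \<forall>f\<in>F. f v \<noteq> 0}" using g(2) by (auto simp: path_image_compose)
  qed (use g in \<open>auto simp: pathstart_compose pathfinish_compose l_def\<close>)
qed

section \<open>Hyperplane arrangements and winding numbers\<close>

lemma complex_affine_linear_form: "linear_form f \<Longrightarrow> complex_affine (\<lambda>v. f v + c)"
  unfolding complex_affine_def by (simp add: linear_form_simps algebra_simps)

lemma linear_form_combination:
  "\<lbrakk>linear_form f; linear_form g\<rbrakk> \<Longrightarrow> linear_form (\<lambda>v. c * f v - d * g v)"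
  by (simp add: linear_form_def algebra_simps)

locale arrangement =
  fixes I :: "'i set" and a :: "'i \<Rightarrow> complex^'n \<Rightarrow> complex"
  assumes finite_index: "finite I"
    and form: "i \<in> I \<Longrightarrow> linear_form (a i)"
    and nonzero: "i \<in> I \<Longrightarrow> \<exists>v. a i v \<noteq> 0"
    and distinct_kernels: "\<lbrakk>i \<in> I; j \<in> I; i \<noteq> j\<rbrakk> \<Longrightarrow> {v. a i v = 0} \<noteq> {v. a j v = 0}"
begin

definition compl :: "(complex^'n) set" where
  "compl = {v. \<forall>i\<in>I. a i v \<noteq> 0}"

text \<open>For an open path this is a complex number, namely the increment of a logarithm of \<open>a i\<close> along the
  path, divided by \<open>2\<pi>i\<close>.\<close>

definition wn :: "'i \<Rightarrow> (real \<Rightarrow> complex^'n) \<Rightarrow> complex" where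
  "wn i p = winding_number (a i \<circ> p) 0"

lemma continuous_form: "i \<in> I \<Longrightarrow> continuous_on S (a i)"
  using continuous_on_linear_form[OF form continuous_on_id] by simp

lemma open_compl: "open compl"
proof -
  have "compl = (\<Inter>i\<in>I. a i -` (- {0}))" by (auto simp: compl_def)
  then show ?thesis
    using finite_index continuous_form by (auto intro!: open_INT open_vimage)
qed

lemma wn_functional:
  assumes "i \<in> I"
  shows "path_functional complex_add compl (wn i)"
proof -
  have "path_functional complex_add compl (\<lambda>p. winding_number (a i \<circ> p) 0)"
    using assms by (intro path_functional.pullback[OF path_functional_winding_number] continuous_form)
      (auto simp: compl_def)
  then show ?thesis by (simp add: wn_def[abs_def])
qed

lemma wn_join:
  assumes "i \<in> I" "path p" "path_image p \<subseteq> compl" "path q" "path_image q \<subseteq> compl" "pathfinish p = pathstart q"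
  shows "wn i (p +++ q) = wn i p + wn i q"
  using path_functional.join[OF wn_functional[OF assms(1)] assms(2-6)] by (simp add: complex_add_def)

lemma wn_reversepath:
  assumes "i \<in> I" "path p" "path_image p \<subseteq> compl"
  shows "wn i (reversepath p) = - wn i p"
proof -
  have "reversepath (a i \<circ> p) = a i \<circ> reversepath p" by (simp add: reversepath_def o_def)
  moreover have "path (a i \<circ> p)" using assms by (intro path_continuous_image continuous_form)
  moreover have "0 \<notin> path_image (a i \<circ> p)" using assms by (auto simp: path_image_compose compl_def)
  ultimately show ?thesis unfolding wn_def by (metis winding_number_reversepath)
qed

lemma wn_homotopic: "\<lbrakk>i \<in> I; homotopic_paths compl p q\<rbrakk> \<Longrightarrow> wn i p = wn i q"
  using path_functional.homotopic[OF wn_functional] .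

lemma exp_wn:
  assumes "i \<in> I" "path p" "path_image p \<subseteq> compl"
  shows "a i (pathfinish p) = exp (2 * of_real pi * \<i> * wn i p) * a i (pathstart p)"
proof -
  have "path (a i \<circ> p)" using assms by (intro path_continuous_image continuous_form)
  moreover have "0 \<notin> path_image (a i \<circ> p)" using assms by (auto simp: path_image_compose compl_def)
  ultimately show ?thesis
    using winding_number_exp_2pi[of "a i \<circ> p" 0] by (simp add: wn_def pathfinish_compose pathstart_compose)
qed

text \<open>The conditions say that the complex line through \<open>x\<close> and \<open>y\<close> meets each of the hyperplanes in a
  point, that these points are distinct for distinct hyperplanes, and that \<open>x\<close> and \<open>y\<close> are not among
  them.\<close>

definition generic_pair :: "complex^'n \<Rightarrow> complex^'n \<Rightarrow> bool" where
  "generic_pair x y \<longleftrightarrow> x \<in> compl \<and> y \<in> compl \<and> (\<forall>i\<in>I. a i x \<noteq> a i y) \<and>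
     (\<forall>i\<in>I. \<forall>j\<in>I. i \<noteq> j \<longrightarrow> a i x * a j y \<noteq> a j x * a i y)"

lemma generic_pair_sym:
  assumes "generic_pair x y"
  shows "generic_pair y x"
proof -
  have "a i y \<noteq> a i x" if "i \<in> I" for i
    using assms that by (metis generic_pair_def)
  moreover have "a i y * a j x \<noteq> a j y * a i x" if "i \<in> I" "j \<in> I" "i \<noteq> j" for i j
    using assms that unfolding generic_pair_def by (metis mult.commute)
  ultimately show ?thesis using assms by (simp add: generic_pair_def)
qed

text \<open>For fixed \<open>x\<close> the condition on \<open>p\<close> is that finitely many affine functions do not vanish at \<open>p\<close>. None
  of them is zero: a relation \<open>a i x * a j p = a j x * a i p\<close> for all \<open>p\<close> would make the kernels of \<open>a i\<close>
  and \<open>a j\<close> equal.\<close>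

lemma generic_pair_as_family:
  assumes "x \<in> compl"
  shows "\<exists>F. finite F \<and> (\<forall>f\<in>F. complex_affine f) \<and> (\<forall>f\<in>F. \<exists>v. f v \<noteq> 0) \<and>
    {p. generic_pair x p} = {p. \<forall>f\<in>F. f p \<noteq> 0}"
proof -
  define F where "F = a ` I \<union> (\<lambda>i p. a i p - a i x) ` I \<union>
    (\<lambda>(i, j) p. a i x * a j p - a j x * a i p) ` {(i, j) \<in> I \<times> I. i \<noteq> j}"
  show ?thesis
  proof (intro exI[of _ F] conjI ballI)
    show "finite F"
    proof -
      have "finite {(i, j) \<in> I \<times> I. i \<noteq> j}"
        by (rule finite_subset[of _ "I \<times> I"]) (auto simp: finite_index)
      then show ?thesis unfolding F_def using finite_index by simp
    qed
    show "complex_affine f" if "f \<in> F" for f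
    proof -
      from that consider i where "i \<in> I" "f = a i" | i where "i \<in> I" "f = (\<lambda>p. a i p - a i x)"
        | i j where "i \<in> I" "j \<in> I" "f = (\<lambda>p. a i x * a j p - a j x * a i p)"
        unfolding F_def by auto
      then show ?thesis
      proof cases
        case (1 i)
        then show ?thesis using complex_affine_linear_form[OF form, of i 0] by simp
      next
        case (2 i)
        then show ?thesis using complex_affine_linear_form[OF form, of i "- a i x"] by simp
      next
        case (3 i j)
        then show ?thesis
          using complex_affine_linear_form[OF linear_form_combination[OF form form], of j i "a i x" "a j x" 0] by simp
      qed
    qed
    show "\<exists>v. f v \<noteq> 0" if "f \<in> F" for f
    proof -
      from that consider i where "i \<in> I" "f = a i" | i where "i \<in> I" "f = (\<lambda>p. a i p - a i x)"
        | i j where "i \<in> I" "j \<in> I" "i \<noteq> j" "f = (\<lambda>p. a i x * a j p - a j x * a i p)"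
        unfolding F_def by auto
      then show ?thesis
      proof cases
        case (1 i)
        then show ?thesis using nonzero by simp
      next
        case (2 i)
        then have "f 0 \<noteq> 0" using assms by (simp add: linear_form_simps[OF form] compl_def)
        then show ?thesis by blast
      next
        case (3 i j)
        then have nz: "a i x \<noteq> 0" "a j x \<noteq> 0" using assms by (auto simp: compl_def)
        obtain v where "(a i v = 0) \<noteq> (a j v = 0)"
          using distinct_kernels[OF 3(1-3)] by (auto simp: set_eq_iff)
        then show ?thesis using nz unfolding 3(4) by (intro exI[of _ v]) auto
      qed
    qed
    show "{p. generic_pair x p} = {p. \<forall>f\<in>F. f p \<noteq> 0}"
    proof -
      have "(\<forall>f\<in>F. f p \<noteq> 0) \<longleftrightarrow> generic_pair x p" for p
      proof -
        have "(\<forall>f\<in>F. f p \<noteq> 0) \<longleftrightarrow> (\<forall>i\<in>I. a i p \<noteq> 0) \<and> (\<forall>i\<in>I. a i p - a i x \<noteq> 0) \<and>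
            (\<forall>i\<in>I. \<forall>j\<in>I. i \<noteq> j \<longrightarrow> a i x * a j p - a j x * a i p \<noteq> 0)"
          unfolding F_def by (auto simp: ball_Un)
        also have "\<dots> \<longleftrightarrow> generic_pair x p"
        proof -
          have "(\<forall>i\<in>I. a i p \<noteq> a i x) \<longleftrightarrow> (\<forall>i\<in>I. a i x \<noteq> a i p)" by metis
          then show ?thesis using assms by (simp add: generic_pair_def compl_def)
        qed
        finally show ?thesis .
      qed
      then show ?thesis by blast
    qed
  qed
qed

lemma generic_pair_exists:
  assumes "x \<in> compl"
  obtains y where "generic_pair y x"
proof -
  obtain F where "finite F \<and> (\<forall>f\<in>F. complex_affine f) \<and> (\<forall>f\<in>F. \<exists>v. f v \<noteq> 0) \<and>
      {p. generic_pair x p} = {p. \<forall>f\<in>F. f p \<noteq> 0}"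
    by (rule exE[OF generic_pair_as_family[OF assms]])
  then have F: "finite F" "\<And>f. f \<in> F \<Longrightarrow> complex_affine f" "\<And>f. f \<in> F \<Longrightarrow> \<exists>v. f v \<noteq> 0"
    "{p. generic_pair x p} = {p. \<forall>f\<in>F. f p \<noteq> 0}"
    by simp_all
  obtain v where "\<forall>f\<in>F. f v \<noteq> 0" using common_nonzero_exists[OF F(1-3)] by metis
  then have "generic_pair x v" using F(4) by blast
  then show thesis by (rule that[OF generic_pair_sym])
qed

lemma path_connected_compl: "path_connected compl"
proof -
  have "path_connected (UNIV \<inter> {v. \<forall>f\<in>a ` I. f v \<noteq> 0})"
  proof (rule path_connected_nonzero)
    show "complex_affine f" if "f \<in> a ` I" for f
      using that complex_affine_linear_form[OF form, of _ 0] by auto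
  qed (use finite_index in auto)
  then show ?thesis by (simp add: compl_def)
qed

text \<open>A path is cut into pieces that lie in balls inside the complement. In each ball the points generic
  with respect to \<open>y\<close> are dense and path connected, so the pieces can be replaced by generic ones with
  nearby end points; all closed curves arising in the comparison lie in a ball and are contractible.\<close>

lemma perturb:
  assumes p: "path p" "path_image p \<subseteq> compl" and y: "y \<in> compl"
    and ends: "generic_pair y (pathstart p)" "generic_pair y (pathfinish p)"
  obtains q where "path q" "path_image q \<subseteq> {v. generic_pair y v}" "homotopic_paths compl p q"
proof -
  obtain F where "finite F \<and> (\<forall>f\<in>F. complex_affine f) \<and> (\<forall>f\<in>F. \<exists>v. f v \<noteq> 0) \<and>
      {p. generic_pair y p} = {p. \<forall>f\<in>F. f p \<noteq> 0}"
    by (rule exE[OF generic_pair_as_family[OF y]])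
  then have F: "finite F" "\<And>f. f \<in> F \<Longrightarrow> complex_affine f" "\<And>f. f \<in> F \<Longrightarrow> \<exists>v. f v \<noteq> 0"
    "{p. generic_pair y p} = {p. \<forall>f\<in>F. f p \<noteq> 0}"
    by simp_all
  obtain d where d: "d > 0" "\<And>t. t \<in> {0..1} \<Longrightarrow> ball (p t) d \<subseteq> compl"
  proof -
    obtain d where "d > 0" "(\<Union>v\<in>path_image p. ball v d) \<subseteq> compl"
      by (rule compact_subset_open_imp_ball_epsilon_subset[OF compact_path_image[OF p(1)] open_compl p(2)])
    then show thesis by (intro that[of d]) (simp_all add: path_image_def UN_subset_iff)
  qed
  have "\<exists>v. generic_pair y v \<and> dist (p t) v < d / 2 \<and> (t \<in> {0, 1} \<longrightarrow> v = p t)" for t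
  proof (cases "t \<in> {0, 1}")
    case True
    then show ?thesis using ends d(1) by (auto simp: pathstart_def pathfinish_def)
  next
    case False
    have "ball (p t) (d / 2) \<noteq> {}" using d(1) by simp
    then obtain w where "w \<in> ball (p t) (d / 2)" "\<And>f. f \<in> F \<Longrightarrow> f w \<noteq> 0"
      using nonzero_dense[OF F(1-3) open_ball] by metis
    then show ?thesis using F(4) False by (intro exI[of _ w]) auto
  qed
  then obtain v where v: "\<And>t. generic_pair y (v t)" "\<And>t. dist (p t) (v t) < d / 2" "v 0 = p 0" "v 1 = p 1"
    by (metis insertCI)
  \<comment> \<open>Short segments connect \<open>p\<close> with the generic points \<open>v t\<close>; the end points of \<open>p\<close> are generic
    already and are kept.\<close>
  let ?s = "\<lambda>t. linepath (p t) (v t)"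
  have s: "path_image (?s t) \<subseteq> ball (p t) d" "path_image (?s t) \<subseteq> compl" if "t \<in> {0..1}" for t
  proof -
    have "dist (p t) (v t) < d" using v(2)[of t] d(1) by linarith
    then show "path_image (?s t) \<subseteq> ball (p t) d"
      unfolding path_image_linepath using d(1) by (intro closed_segment_subset) simp_all
    then show "path_image (?s t) \<subseteq> compl" using d(2)[OF that] by blast
  qed
  define Q where "Q u w \<longleftrightarrow> (0 \<le> u \<and> w \<le> 1 \<longrightarrow> (\<exists>q. path q \<and> path_image q \<subseteq> {v. generic_pair y v} \<and>
      pathstart q = v u \<and> pathfinish q = v w \<and> homotopic_paths compl (subpath u w p +++ ?s w) (?s u +++ q)))" for u w
  have generic_pair_sub: "{v. generic_pair y v} \<subseteq> compl" by (auto simp: generic_pair_def)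
  have "Q 0 1"
  proof (rule Bolzano[of 0 1 Q])
    fix t u w :: real assume Q: "Q t u" "Q u w" "t \<le> u" "u \<le> w"
    show "Q t w" unfolding Q_def
    proof
      assume "0 \<le> t \<and> w \<le> 1"
      then have I: "t \<in> {0..1}" "u \<in> {0..1}" "w \<in> {0..1}" using Q by auto
      obtain q1 where q1: "path q1" "path_image q1 \<subseteq> {v. generic_pair y v}" "pathstart q1 = v t" "pathfinish q1 = v u"
          "homotopic_paths compl (subpath t u p +++ ?s u) (?s t +++ q1)"
        using Q(1) I unfolding Q_def by auto
      obtain q2 where q2: "path q2" "path_image q2 \<subseteq> {v. generic_pair y v}" "pathstart q2 = v u" "pathfinish q2 = v w"
          "homotopic_paths compl (subpath u w p +++ ?s w) (?s u +++ q2)"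
        using Q(2) I unfolding Q_def by auto
      have subs: "path_image (subpath t u p) \<subseteq> compl" "path_image (subpath u w p) \<subseteq> compl" "path_image (subpath t w p) \<subseteq> compl"
        using I by (simp_all add: path_image_subpath_in[OF p(2)])
      have pq: "path_image q1 \<subseteq> compl" "path_image q2 \<subseteq> compl" using q1 q2 generic_pair_sub by auto
      note facts = subs pq s(2)[OF I(1)] s(2)[OF I(2)] s(2)[OF I(3)] q1(1,3,4) q2(1,3,4) p(1) I
      have "homotopic_paths compl (subpath t w p +++ ?s w) ((subpath t u p +++ subpath u w p) +++ ?s w)"
        using facts p(2) by (intro homotopic_paths_join homotopic_join_subpaths[THEN homotopic_paths_sym]) auto
      also have "homotopic_paths compl \<dots> (subpath t u p +++ (subpath u w p +++ ?s w))"
        using facts by (intro homotopic_paths_assoc[THEN homotopic_paths_sym]) auto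
      also have "homotopic_paths compl \<dots> (subpath t u p +++ (?s u +++ q2))"
        using facts by (intro homotopic_paths_join q2(5)) auto
      also have "homotopic_paths compl \<dots> ((subpath t u p +++ ?s u) +++ q2)"
        using facts by (intro homotopic_paths_assoc) auto
      also have "homotopic_paths compl \<dots> ((?s t +++ q1) +++ q2)"
        using facts by (intro homotopic_paths_join q1(5)) auto
      also have "homotopic_paths compl \<dots> (?s t +++ (q1 +++ q2))"
        using facts by (intro homotopic_paths_assoc[THEN homotopic_paths_sym]) auto
      finally show "\<exists>q. path q \<and> path_image q \<subseteq> {v. generic_pair y v} \<and> pathstart q = v t \<and> pathfinish q = v w \<and>
          homotopic_paths compl (subpath t w p +++ ?s w) (?s t +++ q)"
        using q1 q2 by (intro exI[of _ "q1 +++ q2"]) (auto simp: path_image_join)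
    qed
  next
    fix t :: real assume t: "0 \<le> t" "t \<le> 1"
    obtain e where e: "e > 0" "\<And>u w. \<lbrakk>0 \<le> u; u \<le> t; t \<le> w; w \<le> 1; w - u < e\<rbrakk> \<Longrightarrow>
        p ` {u..w} \<subseteq> ball (p t) (d / 2) \<and> path_image (subpath u w p) \<subseteq> ball (p t) (d / 2)"
      using path_near_subpath[OF p(1), of t "ball (p t) (d / 2)"] t d(1) by auto
    have "Q u w" if uw: "u \<le> t" "t \<le> w" "w - u < e" for u w
      unfolding Q_def
    proof
      assume "0 \<le> u \<and> w \<le> 1"
      then have I: "u \<in> {0..1}" "w \<in> {0..1}" using uw t by auto
      have near: "p u \<in> ball (p t) (d / 2)" "p w \<in> ball (p t) (d / 2)" "path_image (subpath u w p) \<subseteq> ball (p t) (d / 2)"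
        using e(2)[of u w] uw I by auto
      have vin: "v u \<in> ball (p t) d" "v w \<in> ball (p t) d"
        using near v(2)[of u] v(2)[of w] dist_triangle[of "p t" "v u" "p u"] dist_triangle[of "p t" "v w" "p w"] by auto
      have pin: "p u \<in> ball (p t) d" "p w \<in> ball (p t) d" "path_image (subpath u w p) \<subseteq> ball (p t) d"
        using near d(1) by (auto dest!: subsetD)
      have "path_connected (ball (p t) d \<inter> {v. \<forall>f\<in>F. f v \<noteq> 0})"
        by (rule path_connected_nonzero[OF F(1,2)]) auto
      then obtain q where q: "path q" "path_image q \<subseteq> ball (p t) d \<inter> {v. generic_pair y v}" "pathstart q = v u" "pathfinish q = v w"
        using vin v(1) unfolding path_connected_def F(4)[symmetric] by blast
      have "homotopic_paths (ball (p t) d) (subpath u w p +++ ?s w) (?s u +++ q)"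
        using q I p(1) vin pin by (intro convex_homotopic_paths)
          (auto simp: path_image_join closed_segment_subset path_image_linepath)
      then have "homotopic_paths compl (subpath u w p +++ ?s w) (?s u +++ q)"
        using d(2)[of t] t by (auto intro: homotopic_paths_subset)
      then show "\<exists>q. path q \<and> path_image q \<subseteq> {v. generic_pair y v} \<and> pathstart q = v u \<and> pathfinish q = v w \<and>
          homotopic_paths compl (subpath u w p +++ ?s w) (?s u +++ q)"
        using q by auto
    qed
    then show "\<exists>e>0. \<forall>u w. u \<le> t \<and> t \<le> w \<and> w - u < e \<longrightarrow> Q u w" using e(1) by blast
  qed simp
  then obtain q where q: "path q" "path_image q \<subseteq> {v. generic_pair y v}" "pathstart q = p 0" "pathfinish q = p 1"
      "homotopic_paths compl (p +++ linepath (p 1) (p 1)) (linepath (p 0) (p 0) +++ q)"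
    unfolding Q_def by (auto simp: v)
  have "homotopic_paths compl p (p +++ linepath (p 1) (p 1))"
    using homotopic_paths_rid[OF p] homotopic_paths_sym by (auto simp: pathfinish_def)
  also note q(5)
  also have "homotopic_paths compl (linepath (p 0) (p 0) +++ q) q"
    using homotopic_paths_lid[OF q(1), of compl] q generic_pair_sub by auto
  finally show thesis using that q by blast
qed

end

section \<open>Complex lines in general position\<close>

definition cline :: "complex^'n \<Rightarrow> complex^'n \<Rightarrow> complex \<Rightarrow> complex^'n" where
  "cline y q z = y + z *s (q - y)"

lemma cline_0_1 [simp]: "cline y q 0 = y" "cline y q 1 = q"
  by (simp_all add: cline_def)

lemma continuous_on_cline [continuous_intros]:
  assumes "continuous_on S f" "continuous_on S g"
  shows "continuous_on S (\<lambda>t. cline y (f t) (g t))"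
  unfolding cline_def by (intro continuous_intros assms)

context arrangement
begin

text \<open>The parameter of the point in which the line from \<open>y\<close> (parameter 0) to \<open>q\<close> (parameter 1) meets the
  hyperplane with index \<open>i\<close>.\<close>

definition puncture :: "complex^'n \<Rightarrow> complex^'n \<Rightarrow> 'i \<Rightarrow> complex" where
  "puncture y q i = a i y / (a i y - a i q)"

lemma form_cline:
  assumes "i \<in> I" "generic_pair y q"
  shows "a i (cline y q z) = (a i q - a i y) * (z - puncture y q i)"
proof -
  have "a i y - a i q \<noteq> 0" using assms by (auto simp: generic_pair_def)
  moreover have "a i (cline y q z) = a i y + z * (a i q - a i y)"
    using assms(1) by (simp add: cline_def linear_form_simps[OF form] right_diff_distrib)
  moreover have "(a i q - a i y) * (a i y / (a i y - a i q)) = - a i y"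
    using \<open>a i y - a i q \<noteq> 0\<close> by (simp add: field_simps)
  ultimately show ?thesis by (simp add: puncture_def right_diff_distrib mult.commute)
qed

lemma cline_in_compl:
  assumes "generic_pair y q"
  shows "cline y q z \<in> compl \<longleftrightarrow> z \<notin> puncture y q ` I"
proof -
  have "a i q - a i y \<noteq> 0" if "i \<in> I" for i using assms that by (auto simp: generic_pair_def)
  then show ?thesis using form_cline[OF _ assms] by (auto simp: compl_def)
qed

lemma puncture_inj:
  assumes "generic_pair y q"
  shows "inj_on (puncture y q) I"
proof (rule inj_onI, rule ccontr)
  fix i j assume *: "i \<in> I" "j \<in> I" "puncture y q i = puncture y q j" "i \<noteq> j"
  have "a i y - a i q \<noteq> 0" "a j y - a j q \<noteq> 0" using assms * by (auto simp: generic_pair_def)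
  then have "a i y * a j q = a j y * a i q"
    using *(3) by (simp add: puncture_def field_simps)
  then show False using assms * by (auto simp: generic_pair_def)
qed

lemma puncture_01:
  assumes "generic_pair y q"
  shows "0 \<notin> puncture y q ` I" "1 \<notin> puncture y q ` I"
  using cline_in_compl[OF assms, of 0] cline_in_compl[OF assms, of 1] assms by (auto simp: generic_pair_def)

lemma cline_path:
  assumes "generic_pair y q" "path \<zeta>" "path_image \<zeta> \<subseteq> - puncture y q ` I"
  shows "path (cline y q \<circ> \<zeta>)" "path_image (cline y q \<circ> \<zeta>) \<subseteq> compl"
proof -
  show "path (cline y q \<circ> \<zeta>)"
    using assms(2) unfolding path_def o_def by (intro continuous_intros)
  show "path_image (cline y q \<circ> \<zeta>) \<subseteq> compl"
    using assms(3) cline_in_compl[OF assms(1)] by (auto simp: path_image_compose)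
qed

lemma wn_cline:
  assumes "generic_pair y q" "i \<in> I" "path \<zeta>" "path_image \<zeta> \<subseteq> - puncture y q ` I"
  shows "wn i (cline y q \<circ> \<zeta>) = winding_number \<zeta> (puncture y q i)"
proof -
  have "a i \<circ> (cline y q \<circ> \<zeta>) = (\<lambda>t. (a i q - a i y) * (\<zeta> t - puncture y q i))"
    using assms by (auto simp: form_cline)
  then show ?thesis
    unfolding wn_def using assms by (auto simp: generic_pair_def intro!: winding_number_scaled)
qed

text \<open>The compact set \<open>D\<close>, a union of meridians, does not depend on the winding numbers prescribed. This
  uniformity allows all the loops to be moved to neighbouring lines simultaneously.\<close>

lemma integer_windings_on_cline:
  assumes q: "generic_pair y q" and b: "b \<notin> puncture y q ` I"
  shows "\<exists>D. compact D \<and> D \<inter> puncture y q ` I = {} \<and> b \<in> D \<and>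
    (\<forall>m::'i \<Rightarrow> int. \<exists>\<zeta>. path \<zeta> \<and> path_image \<zeta> \<subseteq> D \<and> pathstart \<zeta> = b \<and> pathfinish \<zeta> = b \<and>
        (\<forall>i\<in>I. winding_number \<zeta> (puncture y q i) = of_int (m i)))"
proof -
  let ?K = "puncture y q ` I"
  have fin: "finite ?K" using finite_index by simp
  have "\<exists>c. path c \<and> path_image c \<subseteq> - ?K \<and> pathstart c = b \<and> pathfinish c = b \<and>
      (\<forall>j\<in>?K. winding_number c j = (if j = k then 1 else 0))" if "k \<in> ?K" for k
    using meridian_exists[OF fin that b] by metis
  then have "\<forall>k\<in>?K. \<exists>c. path c \<and> path_image c \<subseteq> - ?K \<and> pathstart c = b \<and> pathfinish c = b \<and>
      (\<forall>j\<in>?K. winding_number c j = (if j = k then 1 else 0))" by blast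
  from bchoice[OF this] obtain d where d: "\<And>k. k \<in> ?K \<Longrightarrow> path (d k) \<and> path_image (d k) \<subseteq> - ?K \<and> pathstart (d k) = b \<and> pathfinish (d k) = b \<and>
      (\<forall>j\<in>?K. winding_number (d k) j = (if j = k then 1 else 0))"
    by blast
  define D where "D = insert b (\<Union>k\<in>?K. path_image (d k))"
  show ?thesis
  proof (intro exI[of _ D] conjI allI)
    show "compact D"
      unfolding D_def using d fin by (intro compact_insert compact_UN compact_path_image) auto
    show DK: "D \<inter> ?K = {}" and bD: "b \<in> D"
      unfolding D_def using b d by fast+
    fix m :: "'i \<Rightarrow> int"
    have "\<exists>p. path p \<and> path_image p \<subseteq> D \<and> pathstart p = b \<and> pathfinish p = b \<and>
        (\<forall>k\<in>?K. winding_number p k = of_int (m (inv_into I (puncture y q) k)))"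
    proof (rule winding_numbers_realized[OF fin DK bD])
      show "path (d k) \<and> path_image (d k) \<subseteq> D \<and> pathstart (d k) = b \<and> pathfinish (d k) = b" if "k \<in> ?K" for k
        using d[OF that] that unfolding D_def by blast
      show "winding_number (d k) j = (if j = k then 1 else 0)" if "j \<in> ?K" "k \<in> ?K" for j k
        using d[OF that(2)] that(1) by blast
    qed
    then show "\<exists>\<zeta>. path \<zeta> \<and> path_image \<zeta> \<subseteq> D \<and> pathstart \<zeta> = b \<and> pathfinish \<zeta> = b \<and>
        (\<forall>i\<in>I. winding_number \<zeta> (puncture y q i) = of_int (m i))"
      using puncture_inj[OF q] by simp
  qed
qed

text \<open>The line joining \<open>x\<close> to a point in general position is a plane with one puncture for each
  hyperplane, and loops with prescribed winding numbers exist already there.\<close>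

theorem winding_vectors_realized:
  assumes "x \<in> compl"
  shows "\<exists>p. path p \<and> path_image p \<subseteq> compl \<and> pathstart p = x \<and> pathfinish p = x \<and>
    (\<forall>i\<in>I. wn i p = of_int (m i))"
proof -
  obtain y where y: "generic_pair y x" by (rule generic_pair_exists[OF assms])
  obtain D where D: "D \<inter> puncture y x ` I = {}"
    "\<exists>\<zeta>. path \<zeta> \<and> path_image \<zeta> \<subseteq> D \<and> pathstart \<zeta> = 1 \<and> pathfinish \<zeta> = 1 \<and>
        (\<forall>i\<in>I. winding_number \<zeta> (puncture y x i) = of_int (m i))"
    using integer_windings_on_cline[OF y puncture_01(2)[OF y]] by metis
  then obtain \<zeta> where \<zeta>: "path \<zeta>" "path_image \<zeta> \<subseteq> - puncture y x ` I" "pathstart \<zeta> = 1" "pathfinish \<zeta> = 1"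
    "\<forall>i\<in>I. winding_number \<zeta> (puncture y x i) = of_int (m i)"
    by (metis disjoint_eq_subset_Compl subset_trans)
  show ?thesis
    by (intro exI[of _ "cline y x \<circ> \<zeta>"] conjI)
      (use \<zeta> cline_path[OF y \<zeta>(1,2)] in \<open>simp_all add: wn_cline[OF y] pathstart_compose pathfinish_compose\<close>)
qed

text \<open>On a line the planar case applies: the value of a functional on a path from \<open>y\<close> to \<open>q\<close> within the
  line is determined by the winding numbers.\<close>

lemma path_functional_cline_eq:
  assumes "path_functional M compl \<Phi>" and q: "generic_pair y q"
    and \<zeta>: "path \<zeta>" "path_image \<zeta> \<subseteq> - puncture y q ` I" "pathstart \<zeta> = 0" "pathfinish \<zeta> = 1"
    and \<xi>: "path \<xi>" "path_image \<xi> \<subseteq> - puncture y q ` I" "pathstart \<xi> = 0" "pathfinish \<xi> = 1"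
    and eq: "\<And>i. i \<in> I \<Longrightarrow> winding_number \<zeta> (puncture y q i) = winding_number \<xi> (puncture y q i)"
  shows "\<Phi> (cline y q \<circ> \<zeta>) = \<Phi> (cline y q \<circ> \<xi>)"
proof -
  interpret path_functional M compl \<Phi> by fact
  let ?K = "puncture y q ` I"
  interpret L: path_functional M "- ?K" "\<lambda>p. \<Phi> (cline y q \<circ> p)"
    using cline_in_compl[OF q] by (intro pullback) (auto intro!: continuous_intros)
  have k: "k \<notin> path_image \<zeta>" "k \<notin> path_image \<xi>" if "k \<in> ?K" for k using \<zeta>(2) \<xi>(2) that by auto
  have "\<Phi> (cline y q \<circ> (\<zeta> +++ reversepath \<xi>)) = \<Phi> (cline y q \<circ> (\<zeta> +++ reversepath \<zeta>))"
  proof (rule path_functional_punctured_plane_eq[OF L.path_functional_axioms])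
    show "winding_number (\<zeta> +++ reversepath \<xi>) k = winding_number (\<zeta> +++ reversepath \<zeta>) k" if "k \<in> ?K" for k
      using that \<zeta> \<xi> eq k[OF that] by (auto simp: winding_number_join winding_number_reversepath)
  qed (use \<zeta> \<xi> finite_index in \<open>simp_all add: path_image_join\<close>)
  then have "\<Phi> (cline y q \<circ> \<zeta>) \<otimes>\<^bsub>M\<^esub> inv\<^bsub>M\<^esub> \<Phi> (cline y q \<circ> \<xi>) = \<Phi> (cline y q \<circ> \<zeta>) \<otimes>\<^bsub>M\<^esub> inv\<^bsub>M\<^esub> \<Phi> (cline y q \<circ> \<zeta>)"
    using \<zeta> \<xi> by (simp add: L.join L.reversepath)
  then show ?thesis
    using L.closed[OF \<zeta>(1,2)] L.closed[OF \<xi>(1,2)] by (metis Units_eq Units_l_cancel inv_closed inv_inv)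
qed

text \<open>While the line through \<open>y\<close> and \<open>p t\<close> turns about \<open>y\<close>, a path \<open>\<zeta>\<close> of parameters that avoids all the
  punctures on the way sweeps out a square in the complement. Two sides of the square are the
  initial and the final position of the path, the third is the piece of \<open>p\<close>, and the fourth is
  constant at \<open>y\<close>.\<close>

lemma moving_cline:
  assumes "path_functional M compl \<Phi>"
    and p: "path p" "path_image p \<subseteq> {v. generic_pair y v}" and uv: "u \<in> {0..1}" "v \<in> {0..1}" "u \<le> v"
    and \<zeta>: "path \<zeta>" "pathstart \<zeta> = 0" "pathfinish \<zeta> = 1"
    and avoid: "\<And>t. t \<in> {u..v} \<Longrightarrow> path_image \<zeta> \<subseteq> - puncture y (p t) ` I"
  shows "\<Phi> (cline y (p u) \<circ> \<zeta>) \<otimes>\<^bsub>M\<^esub> \<Phi> (subpath u v p) = \<Phi> (cline y (p v) \<circ> \<zeta>)"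
proof -
  interpret path_functional M compl \<Phi> by fact
  let ?Q = "{u..v} \<times> {0..1::real}"
  let ?h = "\<lambda>z::real\<times>real. cline y (p (fst z)) (\<zeta> (snd z))"
  have generic_pair: "generic_pair y (p t)" if "t \<in> {u..v}" for t
    using p(2) that uv by (auto simp: path_image_def subset_iff)
  have pc: "continuous_on {u..v} p" and \<zeta>c: "continuous_on {0..1} \<zeta>"
    using p(1) \<zeta>(1) uv by (auto simp: path_def intro: continuous_on_subset)
  have "continuous_on ?Q (\<lambda>z. p (fst z))"
    by (rule continuous_on_compose2[OF pc continuous_on_fst[OF continuous_on_id]]) auto
  moreover have "continuous_on ?Q (\<lambda>z. \<zeta> (snd z))"
    by (rule continuous_on_compose2[OF \<zeta>c continuous_on_snd[OF continuous_on_id]]) auto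
  ultimately have "continuous_on ?Q ?h" by (intro continuous_intros)
  moreover have "?h ` ?Q \<subseteq> compl"
  proof (clarify, goal_cases)
    case (1 _ t s)
    then have "\<zeta> s \<notin> puncture y (p t) ` I" using avoid[of t] unfolding path_image_def by (simp add: image_subset_iff)
    then show ?case using cline_in_compl[OF generic_pair[of t]] 1 by simp
  qed
  ultimately interpret Q: path_functional M ?Q "\<lambda>q. \<Phi> (?h \<circ> q)"
    by (rule pullback)
  \<comment> \<open>The sides of the parameter square.\<close>
  define left top bottom right where "left = linepath (u, 0::real) (u, 1)" and "top = linepath (u, 1::real) (v, 1)"
    and "bottom = linepath (u, 0::real) (v, 0)" and "right = linepath (v, 0::real) (v, 1)"
  note defs = left_def top_def bottom_def right_def
  have paths: "path left" "path top" "path bottom" "path right"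
    and ends: "pathfinish left = pathstart top" "pathfinish bottom = pathstart right"
      "pathstart left = pathstart bottom" "pathfinish top = pathfinish right"
    by (simp_all add: defs)
  have sub: "path_image left \<subseteq> ?Q" "path_image top \<subseteq> ?Q" "path_image bottom \<subseteq> ?Q" "path_image right \<subseteq> ?Q"
    unfolding defs path_image_linepath
    by (rule closed_segment_subset; (intro convex_Times convex_real_interval)?; use uv in simp)+
  have "homotopic_paths ?Q (left +++ top) (bottom +++ right)"
    using paths ends sub by (intro convex_homotopic_paths convex_Times convex_real_interval) (simp_all add: path_image_join)
  then have "\<Phi> (?h \<circ> (left +++ top)) = \<Phi> (?h \<circ> (bottom +++ right))"
    by (rule Q.homotopic)
  then have "\<Phi> (?h \<circ> left) \<otimes>\<^bsub>M\<^esub> \<Phi> (?h \<circ> top) = \<Phi> (?h \<circ> bottom) \<otimes>\<^bsub>M\<^esub> \<Phi> (?h \<circ> right)"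
    using Q.join[OF paths(1) sub(1) paths(2) sub(2) ends(1)] Q.join[OF paths(3) sub(3) paths(4) sub(4) ends(2)] by simp
  moreover have "?h \<circ> left = cline y (p u) \<circ> \<zeta>" "?h \<circ> right = cline y (p v) \<circ> \<zeta>"
    by (auto simp: defs linepath_def algebra_simps)
  moreover have "?h \<circ> bottom = (\<lambda>_. y)"
    using \<zeta>(2) by (auto simp: defs linepath_def pathstart_def)
  moreover have "?h \<circ> top = subpath u v p"
    using \<zeta>(3) by (auto simp: defs linepath_def pathfinish_def subpath_def algebra_simps)
  moreover have "\<Phi> (\<lambda>_. y) = \<one>\<^bsub>M\<^esub>"
    using generic_pair[of u] uv by (intro const) (auto simp: generic_pair_def)
  ultimately show ?thesis
    using Q.closed[OF paths(4) sub(4)] by simp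
qed

end

section \<open>Loops with vanishing winding numbers\<close>

context arrangement
begin

lemma path_from_0_to_1:
  assumes "generic_pair y q"
  obtains \<zeta> where "path \<zeta>" "path_image \<zeta> \<subseteq> - puncture y q ` I" "pathstart \<zeta> = 0" "pathfinish \<zeta> = 1"
proof -
  have "path_connected (- puncture y q ` I)"
    using path_connected_open_diff_countable[of UNIV "puncture y q ` I"] finite_index
    by (simp add: Compl_eq_Diff_UNIV countable_finite connected_UNIV)
  then show thesis
    using puncture_01[OF assms] that unfolding path_connected_def by (metis ComplI)
qed

text \<open>One of the paths followed by the reverse of the other is a loop.\<close>

lemma winding_difference_integer:
  assumes "i \<in> I" "path p" "path_image p \<subseteq> compl" "path q" "path_image q \<subseteq> compl"
    "pathstart q = pathstart p" "pathfinish q = pathfinish p"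
  shows "\<exists>m. wn i p - wn i q = of_int m"
proof -
  have "wn i (p +++ reversepath q) = wn i p - wn i q"
    using assms by (simp add: wn_join wn_reversepath)
  moreover have "wn i (p +++ reversepath q) \<in> \<int>"
    unfolding wn_def
  proof (rule integer_winding_number)
    show "path (a i \<circ> (p +++ reversepath q))"
      using assms by (intro path_continuous_image continuous_form) auto
    show "0 \<notin> path_image (a i \<circ> (p +++ reversepath q))"
      using assms by (auto simp: path_image_compose path_image_join compl_def)
  qed (use assms in \<open>simp add: pathfinish_compose pathstart_compose\<close>)
  ultimately show ?thesis by (metis Ints_cases)
qed

lemma cline_path_with_windings:
  assumes q: "generic_pair y q" and C: "C \<inter> puncture y q ` I = {}"
    and \<zeta>: "path \<zeta>" "path_image \<zeta> \<subseteq> C" "pathstart \<zeta> = 0" "pathfinish \<zeta> = 1"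
    and c: "\<exists>\<xi>. path \<xi> \<and> path_image \<xi> \<subseteq> C \<and> pathstart \<xi> = 0 \<and> pathfinish \<xi> = 0 \<and>
        (\<forall>i\<in>I. winding_number \<xi> (puncture y q i) = of_int (m i))"
  obtains \<eta> where "path \<eta>" "path_image \<eta> \<subseteq> C" "pathstart \<eta> = 0" "pathfinish \<eta> = 1"
    "\<forall>i\<in>I. wn i (cline y q \<circ> \<eta>) = wn i (cline y q \<circ> \<zeta>) + of_int (m i)"
proof -
  obtain \<xi> where \<xi>: "path \<xi>" "path_image \<xi> \<subseteq> C" "pathstart \<xi> = 0" "pathfinish \<xi> = 0"
      "\<forall>i\<in>I. winding_number \<xi> (puncture y q i) = of_int (m i)"
    using c by (elim exE conjE)
  have sub: "path_image \<xi> \<subseteq> - puncture y q ` I" "path_image \<zeta> \<subseteq> - puncture y q ` I" using C \<xi>(2) \<zeta>(2) by auto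
  show thesis
  proof (rule that[of "\<xi> +++ \<zeta>"]; (intro ballI)?)
    fix i assume i: "i \<in> I"
    then have "puncture y q i \<notin> path_image \<xi>" "puncture y q i \<notin> path_image \<zeta>" using sub by auto
    then show "wn i (cline y q \<circ> (\<xi> +++ \<zeta>)) = wn i (cline y q \<circ> \<zeta>) + of_int (m i)"
      using \<xi> \<zeta> sub i by (simp add: wn_cline[OF q i] path_image_join winding_number_join)
  qed (use \<xi> \<zeta> in \<open>simp_all add: path_image_join\<close>)
qed

text \<open>The punctures depend continuously on \<open>q\<close>, so they stay away from a closed set of parameters when \<open>q\<close>
  moves slightly.\<close>

lemma open_generic_avoiding:
  assumes "y \<in> compl" "closed C"
  shows "open {q. generic_pair y q \<and> C \<inter> puncture y q ` I = {}}"
proof -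
  have op: "open {q. generic_pair y q}"
  proof -
    have "{q. generic_pair y q} = compl \<inter> (\<Inter>i\<in>I. (\<lambda>q. a i y - a i q) -` (- {0})) \<inter>
      (\<Inter>i\<in>I. \<Inter>j\<in>I - {i}. (\<lambda>q. a i y * a j q - a j y * a i q) -` (- {0}))"
      using assms(1) by (auto simp: generic_pair_def)
    then show ?thesis
      using finite_index open_compl
      by (auto intro!: open_Int open_INT open_vimage continuous_intros continuous_form)
  qed
  have "continuous_on {q. generic_pair y q} (\<lambda>q. puncture y q i)" if "i \<in> I" for i
    unfolding puncture_def using that by (intro continuous_intros continuous_form) (auto simp: generic_pair_def)
  then have "open ({q. generic_pair y q} \<inter> (\<lambda>q. puncture y q i) -` (- C))" if "i \<in> I" for i
    using continuous_open_preimage[OF _ op open_Compl[OF assms(2)]] that by simp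
  then have "open ({q. generic_pair y q} \<inter> (\<Inter>i\<in>I. {q. generic_pair y q} \<inter> (\<lambda>q. puncture y q i) -` (- C)))"
    by (intro open_Int[OF op open_INT[OF finite_index]] ballI)
  moreover have "{q. generic_pair y q \<and> C \<inter> puncture y q ` I = {}} =
      {q. generic_pair y q} \<inter> (\<Inter>i\<in>I. {q. generic_pair y q} \<inter> (\<lambda>q. puncture y q i) -` (- C))"
    by auto
  ultimately show ?thesis by simp
qed

text \<open>Taking the abelianization of the fundamental group as target, this says that its elements are
  determined by winding numbers. The loop, after a perturbation \<open>q\<close>, is swept by the lines through a
  fixed generic point \<open>y\<close> and \<open>q t\<close>. In each of these lines there are paths from \<open>y\<close> to \<open>q t\<close>, and the value
  of \<open>\<Phi>\<close> on such a path depends on its winding numbers only. The claim \<open>Q u v\<close> is that paths at the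
  parameters \<open>u\<close> and \<open>v\<close> whose winding numbers differ by those of the piece of \<open>q\<close> between \<open>u\<close> and \<open>v\<close> also
  have values that differ by the value of this piece. The claim holds for \<open>u\<close> and \<open>v\<close> close together,
  where the same parameter path can be used in all lines in between, and it is transitive; so it
  holds for 0 and 1. As the winding numbers of \<open>q\<close> vanish, it applies to one and the same path at
  both ends, which gives \<open>\<Phi> q = \<one>\<close>.\<close>

theorem zero_windings_imp_trivial:
  assumes \<Phi>: "path_functional M compl \<Phi>"
    and p: "path p" "path_image p \<subseteq> compl" "pathfinish p = pathstart p"
    and zero: "\<And>i. i \<in> I \<Longrightarrow> wn i p = 0"
  shows "\<Phi> p = \<one>\<^bsub>M\<^esub>"
proof -
  interpret path_functional M compl \<Phi> by fact
  have "pathstart p \<in> compl" using p(2) by auto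
  then obtain y where y: "generic_pair y (pathstart p)" by (rule generic_pair_exists)
  have yc: "y \<in> compl" using y by (simp add: generic_pair_def)
  obtain q where q: "path q" "path_image q \<subseteq> {v. generic_pair y v}" "homotopic_paths compl p q"
    using perturb[OF p(1,2) yc y] y p(3) by metis
  have qc: "path_image q \<subseteq> compl" using q(2) by (auto simp: generic_pair_def)
  have generic_pair: "generic_pair y (q t)" if "t \<in> {0..1}" for t using q(2) that by (auto simp: path_image_def image_subset_iff)
  define match where "match u \<zeta> v \<xi> \<longleftrightarrow>
      (\<forall>i\<in>I. wn i (cline y (q u) \<circ> \<zeta>) + wn i (subpath u v q) = wn i (cline y (q v) \<circ> \<xi>))" for u \<zeta> v \<xi>
  define Z where "Z t = {\<zeta>. path \<zeta> \<and> path_image \<zeta> \<subseteq> - puncture y (q t) ` I \<and> pathstart \<zeta> = 0 \<and> pathfinish \<zeta> = 1}" for t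
  have sub: "path (subpath u v q)" "path_image (subpath u v q) \<subseteq> compl" if "u \<in> {0..1}" "v \<in> {0..1}" for u v
    using that q(1) path_image_subpath_in[OF qc that] by auto
  have Zc: "path (cline y (q t) \<circ> \<zeta>)" "path_image (cline y (q t) \<circ> \<zeta>) \<subseteq> compl" "pathstart (cline y (q t) \<circ> \<zeta>) = y"
    "pathfinish (cline y (q t) \<circ> \<zeta>) = q t" if "t \<in> {0..1}" "\<zeta> \<in> Z t" for t \<zeta>
    using that cline_path[OF generic_pair[OF that(1)], of \<zeta>] by (auto simp: Z_def pathstart_compose pathfinish_compose)
  have Zne: "\<exists>\<zeta>. \<zeta> \<in> Z t" if t: "t \<in> {0..1}" for t
  proof -
    obtain \<zeta> where "path \<zeta>" "path_image \<zeta> \<subseteq> - puncture y (q t) ` I" "pathstart \<zeta> = 0" "pathfinish \<zeta> = 1"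
      by (rule path_from_0_to_1[OF generic_pair[OF t]])
    then show ?thesis unfolding Z_def by blast
  qed
  define Q where "Q u v \<longleftrightarrow> (0 \<le> u \<and> v \<le> 1 \<longrightarrow> (\<forall>\<zeta>\<in>Z u. \<forall>\<xi>\<in>Z v. match u \<zeta> v \<xi> \<longrightarrow>
      \<Phi> (cline y (q u) \<circ> \<zeta>) \<otimes>\<^bsub>M\<^esub> \<Phi> (subpath u v q) = \<Phi> (cline y (q v) \<circ> \<xi>)))" for u v
  have "Q 0 1"
  proof (rule Bolzano[of 0 1 Q])
    fix u v w :: real assume uvw: "Q u v" "Q v w" "u \<le> v" "v \<le> w"
    show "Q u w" unfolding Q_def
    proof (intro impI ballI)
      fix \<zeta> \<xi> assume "0 \<le> u \<and> w \<le> 1" and \<zeta>: "\<zeta> \<in> Z u" and \<xi>: "\<xi> \<in> Z w" and match: "match u \<zeta> w \<xi>"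
      then have I: "u \<in> {0..1}" "v \<in> {0..1}" "w \<in> {0..1}" using uvw by auto
      \<comment> \<open>For transitivity an intermediate path \<open>\<eta>\<close> with the matching winding numbers is needed at \<open>v\<close>: an
        arbitrary path has them up to integers, and a loop in the line corrects it.\<close>
      obtain \<eta>0 where \<eta>0: "\<eta>0 \<in> Z v" using Zne[OF I(2)] by blast
      have "\<exists>m. wn i ((cline y (q u) \<circ> \<zeta>) +++ subpath u v q) - wn i (cline y (q v) \<circ> \<eta>0) = of_int m" if "i \<in> I" for i
        using winding_difference_integer[OF that, of "(cline y (q u) \<circ> \<zeta>) +++ subpath u v q" "cline y (q v) \<circ> \<eta>0"]
          Zc[OF I(1) \<zeta>] Zc[OF I(2) \<eta>0] sub[OF I(1,2)] by (simp add: path_image_join)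
      then obtain m where m: "\<And>i. i \<in> I \<Longrightarrow> wn i ((cline y (q u) \<circ> \<zeta>) +++ subpath u v q) - wn i (cline y (q v) \<circ> \<eta>0) = of_int (m i)"
        by metis
      obtain D where D: "D \<inter> puncture y (q v) ` I = {}"
        "\<exists>\<xi>. path \<xi> \<and> path_image \<xi> \<subseteq> D \<and> pathstart \<xi> = 0 \<and> pathfinish \<xi> = 0 \<and>
          (\<forall>i\<in>I. winding_number \<xi> (puncture y (q v) i) = of_int (m i))"
        using integer_windings_on_cline[OF generic_pair[OF I(2)] puncture_01(1)[OF generic_pair[OF I(2)]]] by metis
      then have c: "\<exists>\<xi>. path \<xi> \<and> path_image \<xi> \<subseteq> - puncture y (q v) ` I \<and> pathstart \<xi> = 0 \<and> pathfinish \<xi> = 0 \<and>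
          (\<forall>i\<in>I. winding_number \<xi> (puncture y (q v) i) = of_int (m i))"
        by (metis disjoint_eq_subset_Compl subset_trans)
      have \<eta>0': "path \<eta>0" "path_image \<eta>0 \<subseteq> - puncture y (q v) ` I" "pathstart \<eta>0 = 0" "pathfinish \<eta>0 = 1"
        using \<eta>0 by (simp_all add: Z_def)
      obtain \<eta> where \<eta>: "path \<eta>" "path_image \<eta> \<subseteq> - puncture y (q v) ` I" "pathstart \<eta> = 0" "pathfinish \<eta> = 1"
        "\<forall>i\<in>I. wn i (cline y (q v) \<circ> \<eta>) = wn i (cline y (q v) \<circ> \<eta>0) + of_int (m i)"
        by (rule cline_path_with_windings[OF generic_pair[OF I(2)] _ \<eta>0' c]) auto
      have \<eta>Z: "\<eta> \<in> Z v" using \<eta> by (simp add: Z_def)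
      have m1: "match u \<zeta> v \<eta>"
        unfolding match_def
      proof
        fix i assume i: "i \<in> I"
        show "wn i (cline y (q u) \<circ> \<zeta>) + wn i (subpath u v q) = wn i (cline y (q v) \<circ> \<eta>)"
          using m[OF i] \<eta>(5) Zc[OF I(1) \<zeta>] sub[OF I(1,2)] i by (simp add: wn_join algebra_simps)
      qed
      have add: "wn i (subpath u w q) = wn i (subpath u v q) + wn i (subpath v w q)" if "i \<in> I" for i
        using path_functional.subpath_join[OF wn_functional[OF that] q(1) qc I] by (simp add: complex_add_def)
      have m2: "match v \<eta> w \<xi>"
        unfolding match_def
      proof
        fix i assume i: "i \<in> I"
        show "wn i (cline y (q v) \<circ> \<eta>) + wn i (subpath v w q) = wn i (cline y (q w) \<circ> \<xi>)"
        proof -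
          have "wn i (cline y (q u) \<circ> \<zeta>) + wn i (subpath u v q) = wn i (cline y (q v) \<circ> \<eta>)"
            "wn i (cline y (q u) \<circ> \<zeta>) + wn i (subpath u w q) = wn i (cline y (q w) \<circ> \<xi>)"
            using m1 match i by (simp_all add: match_def)
          then show ?thesis unfolding add[OF i] by (simp only: add.assoc[symmetric])
        qed
      qed
      have "\<Phi> (cline y (q u) \<circ> \<zeta>) \<otimes>\<^bsub>M\<^esub> \<Phi> (subpath u w q) =
          (\<Phi> (cline y (q u) \<circ> \<zeta>) \<otimes>\<^bsub>M\<^esub> \<Phi> (subpath u v q)) \<otimes>\<^bsub>M\<^esub> \<Phi> (subpath v w q)"
        using closed[OF Zc(1,2)[OF I(1) \<zeta>]] closed[OF sub[OF I(1,2)]] closed[OF sub[OF I(2,3)]]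
        by (simp add: subpath_join[OF q(1) qc I] m_assoc)
      also have "\<dots> = \<Phi> (cline y (q v) \<circ> \<eta>) \<otimes>\<^bsub>M\<^esub> \<Phi> (subpath v w q)"
        using uvw(1) I \<zeta> \<eta>Z m1 by (simp add: Q_def)
      also have "\<dots> = \<Phi> (cline y (q w) \<circ> \<xi>)"
        using uvw(2) I \<xi> \<eta>Z m2 by (simp add: Q_def)
      finally show "\<Phi> (cline y (q u) \<circ> \<zeta>) \<otimes>\<^bsub>M\<^esub> \<Phi> (subpath u w q) = \<Phi> (cline y (q w) \<circ> \<xi>)" .
    qed
  next
    fix t :: real assume "0 \<le> t" "t \<le> 1"
    then have t: "t \<in> {0..1}" by simp
    obtain \<zeta>0 where \<zeta>0: "\<zeta>0 \<in> Z t" using Zne[OF t] by blast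
    obtain D where D: "compact D" "D \<inter> puncture y (q t) ` I = {}"
      "\<And>m. \<exists>\<xi>. path \<xi> \<and> path_image \<xi> \<subseteq> D \<and> pathstart \<xi> = 0 \<and> pathfinish \<xi> = 0 \<and>
          (\<forall>i\<in>I. winding_number \<xi> (puncture y (q t) i) = of_int (m i))"
      using integer_windings_on_cline[OF generic_pair[OF t] puncture_01(1)[OF generic_pair[OF t]]] by metis
    \<comment> \<open>All parameter paths are taken in the compact set \<open>C\<close>, which the punctures of the neighbouring
      lines avoid.\<close>
    define C where "C = path_image \<zeta>0 \<union> D"
    have "compact C"
      unfolding C_def using \<zeta>0 D(1) by (simp add: Z_def compact_Un compact_path_image)
    then have opU: "open {v. generic_pair y v \<and> C \<inter> puncture y v ` I = {}}" (is "open ?U")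
      by (intro open_generic_avoiding yc compact_imp_closed)
    have Ct: "C \<inter> puncture y (q t) ` I = {}"
      using \<zeta>0 D(2) unfolding C_def Z_def by blast
    then have qU: "q t \<in> ?U" using generic_pair[OF t] by simp
    have "\<exists>d>0. \<forall>u v. 0 \<le> u \<longrightarrow> u \<le> t \<longrightarrow> t \<le> v \<longrightarrow> v \<le> 1 \<longrightarrow> v - u < d \<longrightarrow> q ` {u..v} \<subseteq> ?U"
      by (rule path_near_subpath[OF q(1) t opU qU]) blast
    then obtain d where d: "d > 0" "\<And>u v. \<lbrakk>0 \<le> u; u \<le> t; t \<le> v; v \<le> 1; v - u < d\<rbrakk> \<Longrightarrow> q ` {u..v} \<subseteq> ?U"
      by (elim exE conjE) simp
    have "Q u v" if uv: "u \<le> t" "t \<le> v" "v - u < d" for u v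
      unfolding Q_def
    proof (intro impI ballI)
      fix \<zeta> \<xi> assume "0 \<le> u \<and> v \<le> 1" and \<zeta>: "\<zeta> \<in> Z u" and \<xi>: "\<xi> \<in> Z v" and match: "match u \<zeta> v \<xi>"
      then have I: "u \<in> {0..1}" "v \<in> {0..1}" and le: "u \<le> v" using uv t by auto
      have avoid: "C \<inter> puncture y (q s) ` I = {}" if "s \<in> {u..v}" for s
        using d(2)[of u v] uv I that by (auto simp: image_subset_iff)
      have \<zeta>0C: "path \<zeta>0" "path_image \<zeta>0 \<subseteq> C" "pathstart \<zeta>0 = 0" "pathfinish \<zeta>0 = 1"
        using \<zeta>0 by (auto simp: C_def Z_def)
      have \<zeta>0Z: "\<zeta>0 \<in> Z s" if "s \<in> {u..v}" for s
        using avoid[OF that] \<zeta>0C by (auto simp: Z_def)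
      have av: "path_image \<eta> \<subseteq> - puncture y (q s) ` I" if "path_image \<eta> \<subseteq> C" "s \<in> {u..v}" for \<eta> s
        using that avoid by blast
      have wn_moving: "wn i (cline y (q u) \<circ> \<eta>) + wn i (subpath u s q) = wn i (cline y (q s) \<circ> \<eta>)"
        if "i \<in> I" "path \<eta>" "path_image \<eta> \<subseteq> C" "pathstart \<eta> = 0" "pathfinish \<eta> = 1" "s \<in> {u..v}" for i \<eta> s
        using moving_cline[OF wn_functional[OF that(1)] q(1,2) I(1) _ _ that(2,4,5), of s] av[OF that(3)] that(6) I
        by (simp add: complex_add_def)
      have tuv: "t \<in> {u..v}" "u \<in> {u..v}" "v \<in> {u..v}" using uv by auto
      \<comment> \<open>The paths \<open>\<zeta>\<close> and \<open>\<xi>\<close> are replaced by one path \<open>\<eta>\<close> inside \<open>C\<close> that has the winding numbers of \<open>\<zeta>\<close>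
        at \<open>u\<close>, and hence those of \<open>\<xi>\<close> at \<open>v\<close>.\<close>
      have "\<exists>m. wn i (cline y (q u) \<circ> \<zeta>) - wn i (cline y (q u) \<circ> \<zeta>0) = of_int m" if "i \<in> I" for i
        using winding_difference_integer[OF that, of "cline y (q u) \<circ> \<zeta>" "cline y (q u) \<circ> \<zeta>0"]
          Zc[OF I(1) \<zeta>] Zc[OF I(1) \<zeta>0Z[OF tuv(2)]] by simp
      then obtain m where m: "\<And>i. i \<in> I \<Longrightarrow> wn i (cline y (q u) \<circ> \<zeta>) - wn i (cline y (q u) \<circ> \<zeta>0) = of_int (m i)"
        by metis
      have c: "\<exists>\<xi>. path \<xi> \<and> path_image \<xi> \<subseteq> C \<and> pathstart \<xi> = 0 \<and> pathfinish \<xi> = 0 \<and>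
          (\<forall>i\<in>I. winding_number \<xi> (puncture y (q t) i) = of_int (m i))"
        using D(3)[of m] unfolding C_def by (metis sup.coboundedI2)
      obtain \<eta> where \<eta>: "path \<eta>" "path_image \<eta> \<subseteq> C" "pathstart \<eta> = 0" "pathfinish \<eta> = 1"
        "\<forall>i\<in>I. wn i (cline y (q t) \<circ> \<eta>) = wn i (cline y (q t) \<circ> \<zeta>0) + of_int (m i)"
        by (rule cline_path_with_windings[OF generic_pair[OF t] Ct \<zeta>0C c])
      have \<eta>Z: "\<eta> \<in> Z s" if "s \<in> {u..v}" for s
        using \<eta> av[OF \<eta>(2) that] by (simp add: Z_def)
      have \<eta>u: "wn i (cline y (q u) \<circ> \<eta>) = wn i (cline y (q u) \<circ> \<zeta>)" if "i \<in> I" for i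
      proof -
        have cancel: "x + b = y + b + c \<Longrightarrow> z - y = c \<Longrightarrow> x = z" for b c x y z :: complex by (auto simp: algebra_simps)
        show ?thesis
          by (rule cancel[OF _ m[OF that], of _ "wn i (subpath u t q)"])
            (simp add: wn_moving[OF that _ _ _ _ tuv(1)] \<eta> \<zeta>0C that)
      qed
      have \<eta>v: "wn i (cline y (q v) \<circ> \<eta>) = wn i (cline y (q v) \<circ> \<xi>)" if "i \<in> I" for i
        using wn_moving[OF that \<eta>(1-4) tuv(3)] match \<eta>u[OF that] that by (simp add: match_def)
      have cline_eq: "\<Phi> (cline y (q s) \<circ> \<alpha>) = \<Phi> (cline y (q s) \<circ> \<beta>)"
        if "s \<in> {0..1}" "\<alpha> \<in> Z s" "\<beta> \<in> Z s" "\<And>i. i \<in> I \<Longrightarrow> wn i (cline y (q s) \<circ> \<alpha>) = wn i (cline y (q s) \<circ> \<beta>)" for s \<alpha> \<beta>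
        using that(2,3,4) by (intro path_functional_cline_eq[OF \<Phi> generic_pair[OF that(1)]])
          (auto simp: Z_def wn_cline[OF generic_pair[OF that(1)], symmetric])
      have "\<Phi> (cline y (q u) \<circ> \<zeta>) = \<Phi> (cline y (q u) \<circ> \<eta>)"
        by (rule cline_eq[OF I(1) \<zeta> \<eta>Z[OF tuv(2)]]) (simp add: \<eta>u)
      moreover have "\<Phi> (cline y (q v) \<circ> \<xi>) = \<Phi> (cline y (q v) \<circ> \<eta>)"
        by (rule cline_eq[OF I(2) \<xi> \<eta>Z[OF tuv(3)]]) (simp add: \<eta>v)
      moreover have "\<Phi> (cline y (q u) \<circ> \<eta>) \<otimes>\<^bsub>M\<^esub> \<Phi> (subpath u v q) = \<Phi> (cline y (q v) \<circ> \<eta>)"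
        using av[OF \<eta>(2)] by (intro moving_cline[OF \<Phi> q(1,2) I le \<eta>(1,3,4)])
      ultimately show "\<Phi> (cline y (q u) \<circ> \<zeta>) \<otimes>\<^bsub>M\<^esub> \<Phi> (subpath u v q) = \<Phi> (cline y (q v) \<circ> \<xi>)" by simp
    qed
    then show "\<exists>d>0. \<forall>u v. u \<le> t \<and> t \<le> v \<and> v - u < d \<longrightarrow> Q u v" using d(1) by blast
  qed simp
  obtain \<zeta> where \<zeta>: "\<zeta> \<in> Z 0" using Zne[of 0] by auto
  have q01: "q 1 = q 0"
    using homotopic_paths_imp_pathstart[OF q(3)] homotopic_paths_imp_pathfinish[OF q(3)] p(3)
    by (simp add: pathstart_def pathfinish_def)
  have "Z 1 = Z 0" by (simp add: Z_def q01)
  moreover have "match 0 \<zeta> 1 \<zeta>"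
    using zero wn_homotopic[OF _ q(3)] by (simp add: match_def q01)
  ultimately have "\<Phi> (cline y (q 0) \<circ> \<zeta>) \<otimes>\<^bsub>M\<^esub> \<Phi> q = \<Phi> (cline y (q 0) \<circ> \<zeta>)"
    using \<open>Q 0 1\<close> \<zeta> by (simp add: Q_def q01)
  then have "\<Phi> q = \<one>\<^bsub>M\<^esub>"
    using closed[OF Zc(1,2)[OF _ \<zeta>]] closed[OF q(1) qc] by (simp add: r_cancel_one)
  then show ?thesis using homotopic[OF q(3)] by simp
qed

end

section \<open>The abelianized fundamental group as a functional on paths\<close>

lemma path_join_eq_joinpaths: "path_join p q = p +++ q"
  by (simp add: path_join_def joinpaths_def fun_eq_iff)

lemma loops_at_top_of_set:
  "p \<in> loops_at (top_of_set S) x \<longleftrightarrow> path p \<and> path_image p \<subseteq> S \<and> pathstart p = x \<and> pathfinish p = x"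
  by (auto simp: loops_at_def pathin_def path_def path_image_def pathstart_def pathfinish_def)

lemma loop_homotopy_rel_top_of_set:
  assumes "p \<in> loops_at (top_of_set S) x" "q \<in> loops_at (top_of_set S) x"
  shows "(p, q) \<in> loop_homotopy_rel (top_of_set S) x \<longleftrightarrow> homotopic_paths S p q"
  using assms by (auto simp: loop_homotopy_rel_def homotopic_paths_def loops_at_top_of_set)
    (auto simp: pathstart_def pathfinish_def)

text \<open>The class of a loop in the abelianized fundamental group extends to a functional on all paths:
  every path is closed up by chosen paths to the base point.\<close>

lemma abelianization_functional:
  fixes S :: "'a::real_normed_vector set" and x :: 'a
  defines "P \<equiv> fundamental_group (top_of_set S) x"
  assumes S: "path_connected S" and x: "x \<in> S"
  shows "\<exists>\<Phi>. path_functional (P Mod derived P (carrier P)) S \<Phi> \<and>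
    (\<forall>p\<in>loops_at (top_of_set S) x. \<Phi> p = derived P (carrier P) #>\<^bsub>P\<^esub> loop_class (top_of_set S) x p)"
proof -
  let ?T = "top_of_set S"
  let ?D = "derived P (carrier P)"
  let ?M = "P Mod ?D"
  interpret P: group P unfolding P_def by (rule group_fundamental_group) (use x in simp)
  have D: "?D \<lhd> P" by (rule P.derived_is_normal[OF P.normal_self])
  interpret M: comm_group ?M by (rule P.derived_quot_is_comm_group)
  have "\<forall>z\<in>S. \<exists>t. path t \<and> path_image t \<subseteq> S \<and> pathstart t = x \<and> pathfinish t = z"
    using S x unfolding path_connected_def by blast
  from bchoice[OF this] obtain \<tau>0 where \<tau>0: "\<And>z. z \<in> S \<Longrightarrow> path (\<tau>0 z) \<and> path_image (\<tau>0 z) \<subseteq> S \<and> pathstart (\<tau>0 z) = x \<and> pathfinish (\<tau>0 z) = z"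
    by blast
  \<comment> \<open>The tether of \<open>x\<close> is constant, so that closing up a loop at \<open>x\<close> does not change its class.\<close>
  define \<tau> where "\<tau> z = (if z = x then linepath x x else \<tau>0 z)" for z
  have \<tau>: "path (\<tau> z)" "path_image (\<tau> z) \<subseteq> S" "pathstart (\<tau> z) = x" "pathfinish (\<tau> z) = z" if "z \<in> S" for z
    using \<tau>0[OF that] x by (auto simp: \<tau>_def)
  define close where "close p = \<tau> (pathstart p) +++ (p +++ reversepath (\<tau> (pathfinish p)))" for p
  have ends: "pathstart p \<in> S" "pathfinish p \<in> S" if "path_image p \<subseteq> S" for p :: "real \<Rightarrow> 'a"
    using that by auto
  have close: "close p \<in> loops_at ?T x" if "path p" "path_image p \<subseteq> S" for p
    using that \<tau>[OF ends(1)[OF that(2)]] \<tau>[OF ends(2)[OF that(2)]]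
    by (simp add: loops_at_top_of_set close_def path_image_join)
  define cl where "cl p = loop_class ?T x p" for p
  have cl_in: "cl p \<in> carrier P" if "p \<in> loops_at ?T x" for p
    using that unfolding cl_def P_def fundamental_group_carrier_iff by blast
  have cl_hom: "cl p = cl q" if "p \<in> loops_at ?T x" "homotopic_paths S p q" for p q
  proof -
    have "q \<in> loops_at ?T x"
      using that homotopic_paths_imp_path[OF that(2)] homotopic_paths_imp_subset[OF that(2)]
        homotopic_paths_imp_pathstart[OF that(2)] homotopic_paths_imp_pathfinish[OF that(2)]
      by (simp add: loops_at_top_of_set)
    then show ?thesis using that unfolding cl_def by (subst loop_class_eq_iff) (simp_all add: loop_homotopy_rel_top_of_set)
  qed
  have cl_mult: "cl p \<otimes>\<^bsub>P\<^esub> cl q = cl (p +++ q)" if "p \<in> loops_at ?T x" "q \<in> loops_at ?T x" for p q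
    using fundamental_group_mult[OF that] by (simp add: cl_def P_def path_join_eq_joinpaths)
  define \<Phi> where "\<Phi> p = ?D #>\<^bsub>P\<^esub> cl (close p)" for p
  have coset_mult: "(?D #>\<^bsub>P\<^esub> a) \<otimes>\<^bsub>?M\<^esub> (?D #>\<^bsub>P\<^esub> b) = ?D #>\<^bsub>P\<^esub> (a \<otimes>\<^bsub>P\<^esub> b)" if "a \<in> carrier P" "b \<in> carrier P" for a b
    using normal.rcos_sum[OF D that] by (simp add: FactGroup_def)
  have "path_functional ?M S \<Phi>"
  proof (rule path_functional.intro[OF M.comm_group_axioms path_functional_axioms.intro])
    fix p q :: "real \<Rightarrow> 'a"
    show "\<Phi> p \<in> carrier ?M" if "path p" "path_image p \<subseteq> S"
      using cl_in[OF close[OF that]] by (auto simp: \<Phi>_def FactGroup_def RCOSETS_def)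
    show "\<Phi> p = \<Phi> q" if hom: "homotopic_paths S p q"
    proof -
      note pq = homotopic_paths_imp_path[OF hom] homotopic_paths_imp_subset[OF hom]
        homotopic_paths_imp_pathstart[OF hom] homotopic_paths_imp_pathfinish[OF hom]
      have p: "path p" "path_image p \<subseteq> S" using pq by auto
      have "homotopic_paths S (close p) (close q)"
        using \<tau>[OF ends(1)[OF p(2)]] \<tau>[OF ends(2)[OF p(2)]] pq hom
        unfolding close_def by (auto intro!: homotopic_paths_join)
      then show ?thesis unfolding \<Phi>_def using cl_hom[OF close[OF p]] by simp
    qed
    show "\<Phi> (p +++ q) = \<Phi> p \<otimes>\<^bsub>?M\<^esub> \<Phi> q"
      if p: "path p" "path_image p \<subseteq> S" and q: "path q" "path_image q \<subseteq> S" and pq: "pathfinish p = pathstart q"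
    proof -
      let ?a = "\<tau> (pathstart p)" and ?b = "\<tau> (pathfinish p)" and ?c = "\<tau> (pathfinish q)"
      note a = \<tau>[OF ends(1)[OF p(2)]] and b = \<tau>[OF ends(2)[OF p(2)]] and c = \<tau>[OF ends(2)[OF q(2)]]
      note facts = p q a b c pq[symmetric]
      have "homotopic_paths S (close p +++ close q) (close (p +++ q))"
      proof -
        let ?r = "reversepath ?b" and ?s = "reversepath ?c"
        have "homotopic_paths S (close p +++ close q) (?a +++ ((p +++ ?r) +++ (?b +++ (q +++ ?s))))"
          unfolding close_def pq[symmetric]
          by (intro homotopic_paths_sym[OF homotopic_paths_assoc]) (use facts in \<open>auto simp: path_image_join\<close>)
        also have "homotopic_paths S \<dots> (?a +++ (p +++ (?r +++ (?b +++ (q +++ ?s)))))"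
          using facts by (intro homotopic_paths_join homotopic_paths_sym[OF homotopic_paths_assoc]) (auto simp: path_image_join)
        also have "homotopic_paths S \<dots> (?a +++ (p +++ ((?r +++ ?b) +++ (q +++ ?s))))"
          using facts by (intro homotopic_paths_join homotopic_paths_assoc) (auto simp: path_image_join)
        also have "homotopic_paths S \<dots> (?a +++ (p +++ (linepath (pathfinish p) (pathfinish p) +++ (q +++ ?s))))"
          using facts homotopic_paths_linv[of ?b S] by (intro homotopic_paths_join) (auto simp: path_image_join)
        also have "homotopic_paths S \<dots> (?a +++ (p +++ (q +++ ?s)))"
        proof -
          have h: "homotopic_paths S (linepath (pathfinish p) (pathfinish p) +++ (q +++ ?s)) (q +++ ?s)"
            using facts homotopic_paths_lid[of "q +++ ?s" S] by (simp add: path_image_join)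
          show ?thesis
            by (rule homotopic_paths_join[OF _ homotopic_paths_join[OF _ h]]) (use facts in \<open>simp_all add: path_image_join\<close>)
        qed
        also have "homotopic_paths S \<dots> (?a +++ ((p +++ q) +++ ?s))"
          using facts by (intro homotopic_paths_join homotopic_paths_assoc) (auto simp: path_image_join)
        finally show ?thesis by (simp add: close_def)
      qed
      moreover have "close p +++ close q \<in> loops_at ?T x"
        using path_join_in_loops_at[OF close[OF p] close[OF q]] by (simp add: path_join_eq_joinpaths)
      ultimately have "cl (close (p +++ q)) = cl (close p +++ close q)" using cl_hom by metis
      then have "cl (close (p +++ q)) = cl (close p) \<otimes>\<^bsub>P\<^esub> cl (close q)"
        by (simp only: cl_mult[OF close[OF p] close[OF q]])
      then show ?thesis
        unfolding \<Phi>_def by (simp only: coset_mult[OF cl_in[OF close[OF p]] cl_in[OF close[OF q]]])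
    qed
  qed
  moreover have "\<Phi> p = ?D #>\<^bsub>P\<^esub> cl p" if p: "p \<in> loops_at ?T x" for p
  proof -
    have p': "path p" "path_image p \<subseteq> S" "pathstart p = x" "pathfinish p = x" using p by (auto simp: loops_at_top_of_set)
    have "homotopic_paths S (close p) (linepath x x +++ (p +++ linepath x x))"
      using p' x by (simp add: close_def \<tau>_def path_image_join)
    also have "homotopic_paths S \<dots> (linepath x x +++ p)"
      using p' x homotopic_paths_rid[of p S] by (intro homotopic_paths_join) auto
    also have "homotopic_paths S \<dots> p" using p' homotopic_paths_lid[of p S] by auto
    finally show ?thesis unfolding \<Phi>_def using cl_hom[OF close[OF p'(1,2)]] by simp
  qed
  ultimately show ?thesis unfolding cl_def by blast
qed

section \<open>Finite matrix groups, polynomial functions and reflections\<close>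

lemma matrix_inv_mult:
  fixes A :: "complex^'n^'n"
  assumes "invertible A"
  shows "A ** matrix_inv A = mat 1" "matrix_inv A ** A = mat 1" "invertible (matrix_inv A)"
proof -
  have "A ** matrix_inv A = mat 1 \<and> matrix_inv A ** A = mat 1"
    using assms unfolding invertible_def matrix_inv_def by (rule someI_ex)
  then show "A ** matrix_inv A = mat 1" "matrix_inv A ** A = mat 1" "invertible (matrix_inv A)"
    by (auto simp: invertible_def)
qed

lemma group_general_linear: "group (general_linear :: (complex^'n^'n) monoid)"
proof (rule groupI)
  fix A :: "complex^'n^'n" assume "A \<in> carrier general_linear"
  then show "\<exists>B\<in>carrier general_linear. B \<otimes>\<^bsub>general_linear\<^esub> A = \<one>\<^bsub>general_linear\<^esub>"
    using matrix_inv_mult[of A] by (auto simp: general_linear_def intro!: bexI[of _ "matrix_inv A"])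
qed (auto simp: general_linear_def invertible_mult matrix_mul_assoc invertible_def[of "mat 1"] intro: exI[of _ "mat 1"])

locale finite_matrix_group =
  fixes W :: "(complex^'n^'n) set"
  assumes sub: "subgroup W general_linear" and fin: "finite W"
begin

lemma invertible: "w \<in> W \<Longrightarrow> invertible w"
  using subgroup.subset[OF sub] by (auto simp: general_linear_def)

lemma one_mem: "mat 1 \<in> W"
  using subgroup.one_closed[OF sub] by (simp add: general_linear_def)

lemma mult_mem: "\<lbrakk>v \<in> W; w \<in> W\<rbrakk> \<Longrightarrow> v ** w \<in> W"
  using subgroup.m_closed[OF sub] by (simp add: general_linear_def)

lemma inv_general_linear: "w \<in> W \<Longrightarrow> inv\<^bsub>general_linear\<^esub> w = matrix_inv w"
  using invertible[of w] matrix_inv_mult[of w]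
  by (intro group.inv_equality[OF group_general_linear]) (simp_all add: general_linear_def)

lemma inv_mem: "w \<in> W \<Longrightarrow> matrix_inv w \<in> W"
  using subgroup.m_inv_closed[OF sub] by (simp add: inv_general_linear)

lemma inv_vec: 
  assumes "w \<in> W"
  shows "w *v (matrix_inv w *v x) = x" "matrix_inv w *v (w *v x) = x"
  using matrix_inv_mult[OF invertible[OF assms]] by (simp_all add: matrix_vector_mul_assoc)

lemma bij_mult_right:
  assumes "u \<in> W"
  shows "bij_betw (\<lambda>w. w ** u) W W"
proof (rule bij_betw_byWitness[of _ "\<lambda>w. w ** matrix_inv u"])
qed (use assms matrix_inv_mult[OF invertible[OF assms]] in
    \<open>auto simp: mult_mem inv_mem matrix_mul_assoc[symmetric]\<close>)

end

interpretation cfun: vector_space "\<lambda>(c::complex) (f::'a \<Rightarrow> complex) v. c * f v"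
  by unfold_locales (auto simp: fun_eq_iff algebra_simps)

text \<open>Polynomial functions of degree at most \<open>d\<close>. Generating them by linear forms instead of coordinates
  makes their invariance under matrices immediate.\<close>

inductive poly_deg :: "nat \<Rightarrow> (complex^'n \<Rightarrow> complex) \<Rightarrow> bool" where
  const: "poly_deg d (\<lambda>_. c)"
| add: "\<lbrakk>poly_deg d f; poly_deg d g\<rbrakk> \<Longrightarrow> poly_deg d (\<lambda>v. f v + g v)"
| mult: "\<lbrakk>poly_deg d f; linear_form l\<rbrakk> \<Longrightarrow> poly_deg (Suc d) (\<lambda>v. l v * f v)"

lemma poly_deg_Suc: "poly_deg d f \<Longrightarrow> poly_deg (Suc d) f"
  by (induction rule: poly_deg.induct) (auto intro: poly_deg.intros)

lemma poly_deg_mono: "\<lbrakk>poly_deg d f; d \<le> e\<rbrakk> \<Longrightarrow> poly_deg e f"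
  by (induction e) (auto simp: le_Suc_eq intro: poly_deg_Suc)

lemma linear_form_scale: "linear_form l \<Longrightarrow> linear_form (\<lambda>v. c * l v)"
  by (simp add: linear_form_def algebra_simps)

lemma linear_form_matrix: "linear_form l \<Longrightarrow> linear_form (\<lambda>v. l (w *v v))"
  by (simp add: linear_form_def matrix_vector_right_distrib vector_scalar_commute)

lemma poly_deg_scale: "poly_deg d f \<Longrightarrow> poly_deg d (\<lambda>v. c * f v)"
proof (induction rule: poly_deg.induct)
  case (add d f g)
  then show ?case using poly_deg.add[OF add.IH] by (simp add: distrib_left)
next
  case (mult d f l)
  then show ?case using poly_deg.mult[OF mult.IH mult.hyps(2)] by (simp add: mult.left_commute)
qed (simp add: poly_deg.const)

lemma poly_deg_matrix: "poly_deg d f \<Longrightarrow> poly_deg d (\<lambda>v. f (w *v v))"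
  by (induction rule: poly_deg.induct) (auto intro: poly_deg.intros linear_form_matrix)

lemma poly_deg_sum: "(\<And>i. i \<in> J \<Longrightarrow> poly_deg d (f i)) \<Longrightarrow> poly_deg d (\<lambda>v. \<Sum>i\<in>J. f i v)"
  by (induction J rule: infinite_finite_induct) (auto intro: poly_deg.intros)

lemma poly_deg_0: "poly_deg 0 f \<Longrightarrow> \<exists>c. f = (\<lambda>_. c)"
  by (induction "0::nat" f rule: poly_deg.induct) auto

text \<open>The filtration by degree starts with the zero function, which no \<open>poly_deg d\<close> isolates.\<close>

definition poly_deg_less :: "nat \<Rightarrow> (complex^'n \<Rightarrow> complex) \<Rightarrow> bool" where
  "poly_deg_less d f \<longleftrightarrow> (case d of 0 \<Rightarrow> f = (\<lambda>_. 0) | Suc e \<Rightarrow> poly_deg e f)"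

lemma poly_deg_less_simps [simp]:
  "poly_deg_less 0 f \<longleftrightarrow> f = (\<lambda>_. 0)" "poly_deg_less (Suc d) f \<longleftrightarrow> poly_deg d f"
  by (simp_all add: poly_deg_less_def)

lemma poly_deg_less_mult:
  "\<lbrakk>poly_deg_less d f; linear_form l\<rbrakk> \<Longrightarrow> poly_deg d (\<lambda>v. l v * f v)"
  by (cases d) (auto intro: poly_deg.intros)

text \<open>The function \<open>f - f \<circ> s\<close> vanishes on the hyperplane of the reflection \<open>s\<close> and is therefore divisible
  by the form \<open>a\<close>; the induction gives the quotient together with the bound on its degree.\<close>

lemma divided_difference:
  assumes s: "\<And>v. s *v v = v + a v *s u" and "poly_deg d f"
  shows "\<exists>g. poly_deg_less d g \<and> (\<forall>v. f v - f (s *v v) = a v * g v)"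
  using assms(2)
proof (induction rule: poly_deg.induct)
  case (const d c)
  show ?case by (rule exI[of _ "\<lambda>_. 0"]) (cases d; auto intro: poly_deg.const)
next
  case (add d f g)
  then obtain f' g' where *: "poly_deg_less d f'" "\<forall>v. f v - f (s *v v) = a v * f' v"
    "poly_deg_less d g'" "\<forall>v. g v - g (s *v v) = a v * g' v" by blast
  have "poly_deg_less d (\<lambda>v. f' v + g' v)"
    using *(1,3) by (cases d) (auto intro: poly_deg.add)
  moreover have "f v + g v - (f (s *v v) + g (s *v v)) = a v * (f' v + g' v)" for v
    using *(2)[rule_format, of v] *(4)[rule_format, of v] by (simp add: algebra_simps)
  ultimately show ?case by blast
next
  case (mult d f l)
  then obtain g where g: "poly_deg_less d g" "\<And>v. f v - f (s *v v) = a v * g v" by blast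
  let ?h = "\<lambda>v. l v * g v + (- l u) * f (s *v v)"
  have "poly_deg d ?h"
    by (intro poly_deg.add poly_deg_less_mult poly_deg_scale poly_deg_matrix mult g)
  moreover have "l v * f v - l (s *v v) * f (s *v v) = a v * ?h v" for v
  proof -
    have "l (s *v v) = l v + a v * l u" using mult(2) by (simp add: s linear_form_simps)
    then have "l v * f v - l (s *v v) * f (s *v v) = l v * (f v - f (s *v v)) - a v * l u * f (s *v v)"
      by (simp add: algebra_simps)
    then show ?thesis by (simp only: g(2)) (simp add: algebra_simps)
  qed
  ultimately show ?case by (intro exI[of _ ?h]) simp
qed

lemma proper_subspace_eq_hyperplane:
  assumes "is_hyperplane H" "vec.subspace K" "H \<subseteq> K" "K \<noteq> UNIV"
  shows "K = (H :: (complex^'n) set)"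
proof -
  have "vec.dim K < vec.dim (UNIV :: (complex^'n) set)"
    using assms(2,4) by (intro vec.dim_psubset) (auto simp: vec.span_eq_iff[THEN iffD2])
  then have "vec.dim K \<le> vec.dim H"
    using assms(1) by (simp add: is_hyperplane_def card_cart_basis)
  then show ?thesis
    using vec.subspace_dim_equal[of H K] assms by (auto simp: is_hyperplane_def)
qed

lemma subspace_kernel: "linear_form a \<Longrightarrow> vec.subspace {v. a v = 0}"
  by (auto simp: vec.subspace_def linear_form_simps)

lemma linear_form_component: "linear_form (\<lambda>v. (s *v v - v) $ i)" for s :: "complex^'n^'n"
  by (simp add: linear_form_def matrix_vector_right_distrib vector_scalar_commute algebra_simps)

text \<open>The vectors \<open>s v - v\<close> vanish on a hyperplane, so they span a line, and their coefficient is a linear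
  form.\<close>

lemma reflection_form:
  assumes "is_reflection s"
  obtains a u where "linear_form a" "\<And>v. s *v v = v + a v *s u" "fixed_space s = {v. a v = 0}" "u \<noteq> 0"
    "is_hyperplane (fixed_space s)"
proof -
  obtain H where H: "is_hyperplane H" "\<And>v. v \<in> H \<Longrightarrow> s *v v = v" and s: "s \<noteq> mat 1" "invertible s"
    using assms by (auto simp: is_reflection_def)
  obtain v1 i where v1: "(s *v v1 - v1) $ i \<noteq> 0"
  proof -
    have "\<exists>v. s *v v \<noteq> v"
      using s(1) by (metis matrix_eq matrix_vector_mul_lid)
    then show thesis using that by (auto simp: vec_eq_iff)
  qed
  define c where "c = (s *v v1 - v1) $ i"
  define a where "a v = inverse c * (s *v v - v) $ i" for v
  have a: "linear_form a" unfolding a_def by (intro linear_form_scale linear_form_component)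
  have av1: "a v1 = 1" using v1 by (simp add: a_def c_def)
  have ker: "{v. a v = 0} = H"
  proof (rule proper_subspace_eq_hyperplane[OF H(1) subspace_kernel[OF a]])
    show "H \<subseteq> {v. a v = 0}" using H(2) by (auto simp: a_def)
    show "{v. a v = 0} \<noteq> UNIV" using av1 by (metis UNIV_I mem_Collect_eq zero_neq_one)
  qed
  define u where "u = s *v v1 - v1"
  have su: "s *v v = v + a v *s u" for v
  proof -
    have "v - a v *s v1 \<in> H" using a av1 unfolding ker[symmetric] by (simp add: linear_form_simps)
    then have "s *v (v - a v *s v1) = v - a v *s v1" by (rule H(2))
    then show ?thesis
      by (simp add: u_def matrix_vector_mult_diff_distrib vector_scalar_commute algebra_simps)
  qed
  have u0: "u \<noteq> 0" using v1 unfolding u_def by auto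
  have ker_s: "fixed_space s = {v. a v = 0}"
    using u0 by (auto simp: fixed_space_def su)
  show thesis using that[OF a su ker_s u0] H(1) ker_s ker by simp
qed

section \<open>Orbits compared by the degrees of polynomials\<close>

lemma sum_fun_apply: "(\<Sum>i\<in>A. F i) x = (\<Sum>i\<in>A. F i x :: complex)"
  by (induction A rule: infinite_finite_induct) auto

lemma poly_deg_separates:
  fixes P :: "(complex^'n) set"
  assumes "finite P" "p \<in> P"
  shows "\<exists>e f. poly_deg e f \<and> (\<forall>q\<in>P. f q = (if q = p then 1 else 0))"
proof -
  have "\<exists>e f. poly_deg e f \<and> f p = 1 \<and> (\<forall>q\<in>Q. f q = 0)" if "finite Q" "p \<notin> Q" for Q
    using that
  proof (induction Q)
    case empty
    then show ?case by (intro exI[of _ 0] exI[of _ "\<lambda>_. 1"]) (simp add: poly_deg.const)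
  next
    case (insert q Q)
    then obtain e f where f: "poly_deg e f" "f p = 1" "\<forall>q\<in>Q. f q = 0" by auto
    obtain i where i: "p $ i \<noteq> q $ i" using insert.prems by (auto simp: vec_eq_iff)
    define l where "l v = inverse (p $ i - q $ i) * (v $ i)" for v :: "complex^'n"
    have l: "linear_form l" unfolding l_def by (rule linear_form_scale) (simp add: linear_form_def)
    have "poly_deg (Suc e) (\<lambda>v. l v * f v + (- l q) * f v)"
      by (rule poly_deg.add[OF poly_deg.mult[OF f(1) l] poly_deg_scale[OF poly_deg_Suc[OF f(1)]]])
    moreover have "l p * f p + (- l q) * f p = 1"
    proof -
      have "l p - l q = inverse (p $ i - q $ i) * (p $ i - q $ i)" unfolding l_def by (rule right_diff_distrib[symmetric])
      then show ?thesis using i f(2) by simp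
    qed
    ultimately show ?case using f(3) by (intro exI[of _ "Suc e"] exI[of _ "\<lambda>v. l v * f v + (- l q) * f v"]) auto
  qed
  from this[of "P - {p}"] assms show ?thesis by fastforce
qed

text \<open>Restrictions are extended by zero, so that those to \<open>U\<close> and to \<open>Y\<close> live in one vector space.\<close>

definition restrict_fun :: "'a set \<Rightarrow> ('a \<Rightarrow> complex) \<Rightarrow> 'a \<Rightarrow> complex" where
  "restrict_fun U f = (\<lambda>p. if p \<in> U then f p else 0)"

lemma linear_restrict_fun: "Vector_Spaces.linear (\<lambda>(c::complex) f v. c * f v) (\<lambda>(c::complex) f v. c * f v) (restrict_fun U)"
  by unfold_locales (auto simp: restrict_fun_def fun_eq_iff)

lemma restrict_fun_eq_iff: "restrict_fun U f = restrict_fun U g \<longleftrightarrow> (\<forall>p\<in>U. f p = g p)"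
  by (auto simp: restrict_fun_def fun_eq_iff)

lemma subspace_poly_deg: "cfun.subspace {f. poly_deg d f}"
  unfolding cfun.subspace_def
  by (auto simp: zero_fun_def plus_fun_def intro: poly_deg.intros poly_deg_scale)

lemma span_indicators:
  assumes "finite U"
  shows "restrict_fun U f \<in> cfun.span ((\<lambda>p q. if q = p then 1 else 0) ` U)"
proof -
  have "restrict_fun U f = (\<Sum>p\<in>U. (\<lambda>q. f p * (if q = p then 1 else 0)))"
    using assms by (auto simp: restrict_fun_def fun_eq_iff sum_fun_apply sum.delta if_distrib cong: if_cong)
  also have "\<dots> \<in> cfun.span ((\<lambda>p q. if q = p then 1 else 0) ` U)"
    by (intro cfun.span_sum cfun.span_scale cfun.span_base) auto
  finally show ?thesis .
qed

lemma independent_indicators: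
  assumes "finite Y"
  shows "cfun.independent ((\<lambda>p q. if q = p then 1 else (0::complex)) ` Y)" "inj_on (\<lambda>p q. if q = p then 1 else (0::complex)) Y"
proof -
  let ?\<delta> = "\<lambda>p q. if q = p then 1 else (0::complex)"
  show inj: "inj_on ?\<delta> Y" by (rule inj_onI) (metis zero_neq_one)
  show "cfun.independent (?\<delta> ` Y)"
  proof (rule cfun.independent_if_scalars_zero)
    fix c x assume c: "(\<Sum>x\<in>?\<delta> ` Y. (\<lambda>v. c x * x v)) = 0" and "x \<in> ?\<delta> ` Y"
    then obtain p where p: "p \<in> Y" "x = ?\<delta> p" by auto
    have "(\<Sum>q\<in>Y. c (?\<delta> q) * ?\<delta> q p) = 0"
      using fun_cong[OF c, of p] by (simp add: sum.reindex[OF inj] o_def sum_fun_apply)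
    then show "c x = 0"
      using p assms by (simp add: if_distrib cong: if_cong)
  qed (use assms in simp)
qed

text \<open>By induction on the degree there is a set \<open>Q\<close> of polynomials whose restrictions to \<open>U\<close> form a basis
  of all restrictions of polynomials of that degree: a basis for smaller degree is extended. The
  hypothesis implies that the restrictions of \<open>Q\<close> to \<open>Y\<close> still span, since a polynomial minus its
  expansion in \<open>Q\<close> vanishes on \<open>U\<close> and agrees on \<open>Y\<close> with one of smaller degree. In large degree all
  functions on \<open>Y\<close> are restrictions, whence \<open>card Y \<le> card Q \<le> card U\<close>.\<close>

lemma card_le_by_degree_reduction:
  fixes U Y :: "(complex^'n) set"
  assumes fin: "finite U" "finite Y"
    and red: "\<And>e f. \<lbrakk>poly_deg e f; \<forall>p\<in>U. f p = 0\<rbrakk> \<Longrightarrow> \<exists>g. poly_deg_less e g \<and> (\<forall>p\<in>Y. f p = g p)"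
  shows "card Y \<le> card U"
proof -
  let ?r = "restrict_fun U" and ?R = "restrict_fun Y"
  let ?\<delta> = "\<lambda>p q. if q = p then 1 else (0::complex)"
  interpret r: Vector_Spaces.linear "\<lambda>(c::complex) (f::complex^'n \<Rightarrow> complex) v. c * f v" "\<lambda>(c::complex) f v. c * f v" ?r
    by (rule linear_restrict_fun)
  interpret R: Vector_Spaces.linear "\<lambda>(c::complex) (f::complex^'n \<Rightarrow> complex) v. c * f v" "\<lambda>(c::complex) f v. c * f v" ?R
    by (rule linear_restrict_fun)
  have "\<exists>Q. Q \<subseteq> {f. poly_deg_less e f} \<and> inj_on ?r Q \<and> cfun.independent (?r ` Q) \<and>
      ?r ` {f. poly_deg_less e f} \<subseteq> cfun.span (?r ` Q) \<and> ?R ` {f. poly_deg_less e f} \<subseteq> cfun.span (?R ` Q)" for e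
  proof (induction e)
    case 0
    then show ?case
      by (intro exI[of _ "{}"]) (auto simp: restrict_fun_def zero_fun_def cfun.independent_empty)
  next
    case (Suc e)
    then obtain Q where Q: "Q \<subseteq> {f. poly_deg_less e f}" "inj_on ?r Q" "cfun.independent (?r ` Q)"
      "?R ` {f. poly_deg_less e f} \<subseteq> cfun.span (?R ` Q)" by blast
    define S where "S = {f :: complex^'n \<Rightarrow> complex. poly_deg e f}"
    have QS: "Q \<subseteq> S" using Q(1) by (cases e; unfold S_def) (auto intro: poly_deg.const poly_deg_Suc)
    obtain B where B: "?r ` Q \<subseteq> B" "B \<subseteq> ?r ` S" "cfun.independent B" "?r ` S \<subseteq> cfun.span B"
      using cfun.maximal_independent_subset_extend[OF image_mono[OF QS] Q(3)] by metis
    \<comment> \<open>Lifts of the basis \<open>B\<close> to polynomials; on the old basis the lifts in \<open>Q\<close> are kept.\<close>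
    define h where "h b = (if b \<in> ?r ` Q then inv_into Q ?r b else inv_into S ?r b)" for b
    have h: "h b \<in> S" "?r (h b) = b" if "b \<in> B" for b
    proof (atomize (full), cases "b \<in> ?r ` Q")
      case True
      then show "h b \<in> S \<and> ?r (h b) = b"
        using inv_into_into[OF True] f_inv_into_f[OF True] QS unfolding h_def by auto
    next
      case False
      have bS: "b \<in> ?r ` S" using that B(2) by blast
      show "h b \<in> S \<and> ?r (h b) = b"
        using inv_into_into[OF bS] f_inv_into_f[OF bS] False unfolding h_def by simp
    qed
    have hQ: "Q \<subseteq> h ` B"
    proof
      fix q assume "q \<in> Q"
      then have "h (?r q) = q" "?r q \<in> B" using Q(2) B(1) by (auto simp: h_def)
      then show "q \<in> h ` B" by (metis imageI)
    qed
    have rhB: "?r ` h ` B = B" using h by force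
    have inj: "inj_on ?r (h ` B)" using h by (auto simp: inj_on_def)
    have "?R f \<in> cfun.span (?R ` h ` B)" if f: "f \<in> S" for f
    proof -
      have "?r f \<in> cfun.span (?r ` h ` B)" using f B(4) rhB by auto
      then obtain k where k: "k \<in> cfun.span (h ` B)" "?r k = ?r f" by (auto simp: r.span_image)
      have "cfun.subspace S" unfolding S_def by (rule subspace_poly_deg)
      then have "k \<in> S" using k(1) h(1) cfun.span_minimal[of "h ` B" S] by blast
      then have "f - k \<in> S" using f cfun.subspace_diff[OF \<open>cfun.subspace S\<close>] by blast
      moreover have "\<forall>p\<in>U. (f - k) p = 0" using k(2) by (simp add: restrict_fun_eq_iff)
      ultimately obtain g where g: "poly_deg_less e g" "\<forall>p\<in>Y. (f - k) p = g p" using red[of e "f - k"] unfolding S_def by auto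
      have "?R f = ?R k + ?R g"
        using g(2) by (auto simp: restrict_fun_def fun_eq_iff algebra_simps)
      moreover have "?R k \<in> cfun.span (?R ` h ` B)" using k(1) by (auto simp: R.span_image)
      moreover have "?R g \<in> cfun.span (?R ` h ` B)"
        using Q(4) g(1) cfun.span_mono[OF image_mono[OF hQ], of ?R] by blast
      ultimately show ?thesis using cfun.span_add by metis
    qed
    then show ?case
      using h(1) inj B(3,4) rhB unfolding poly_deg_less_simps S_def[symmetric] by (intro exI[of _ "h ` B"]) (auto simp: image_subset_iff)
  qed
  note key = this
  have "\<exists>e. \<forall>p\<in>Y. \<exists>f. poly_deg e f \<and> ?R f = ?\<delta> p"
  proof -
    have "\<forall>p\<in>Y. \<exists>e. \<exists>f. poly_deg e f \<and> ?R f = ?\<delta> p"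
    proof
      fix p assume p: "p \<in> Y"
      then obtain e f where "poly_deg e f" "\<forall>q\<in>Y. f q = (if q = p then 1 else 0)"
        using poly_deg_separates[OF fin(2)] by blast
      then show "\<exists>e. \<exists>f. poly_deg e f \<and> ?R f = ?\<delta> p"
        using p by (intro exI[of _ e] exI[of _ f]) (auto simp: restrict_fun_def fun_eq_iff)
    qed
    from bchoice[OF this] obtain d where d: "\<forall>p\<in>Y. \<exists>f. poly_deg (d p) f \<and> ?R f = ?\<delta> p" by blast
    have "d p \<le> Max (d ` Y)" if "p \<in> Y" for p using that fin by simp
    then show ?thesis using d by (metis poly_deg_mono)
  qed
  then obtain e where e: "\<forall>p\<in>Y. \<exists>f. poly_deg e f \<and> ?R f = ?\<delta> p" by blast
  obtain Q where Q: "inj_on ?r Q" "cfun.independent (?r ` Q)" "?R ` {f. poly_deg_less (Suc e) f} \<subseteq> cfun.span (?R ` Q)"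
    using key[of "Suc e"] by blast
  have "?r ` Q \<subseteq> cfun.span (?\<delta> ` U)" using span_indicators[OF fin(1)] by blast
  then have "finite (?r ` Q)" "card (?r ` Q) \<le> card (?\<delta> ` U)"
    using cfun.independent_span_bound[OF _ Q(2), of "?\<delta> ` U"] fin by auto
  then have finQ: "finite Q" and cardQ: "card Q \<le> card U"
    using Q(1) fin(1) card_image[OF Q(1)] card_image_le[OF fin(1), of ?\<delta>] by (auto dest: finite_imageD)
  have "?\<delta> ` Y \<subseteq> cfun.span (?R ` Q)"
    using e Q(3) by (fastforce simp: image_subset_iff)
  then have "card (?\<delta> ` Y) \<le> card (?R ` Q)"
    using cfun.independent_span_bound[OF _ independent_indicators(1)[OF fin(2)], of "?R ` Q"] finQ by auto
  then show ?thesis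
    using card_image[OF independent_indicators(2)[OF fin(2)]] card_image_le[OF finQ, of ?R] cardQ by simp
qed

section \<open>Freeness of the action off the reflecting hyperplanes\<close>

lemma matrix_vector_mult_component_affine:
  fixes w :: "complex^'n^'n"
  shows "complex_affine (\<lambda>v. (w *v v - v) $ i)"
  using complex_affine_linear_form[OF linear_form_component[of w i], of 0] by simp

lemma hyperplane_image:
  fixes A B :: "complex^'n^'n"
  assumes "is_hyperplane H" "B ** A = mat 1"
  shows "is_hyperplane ((*v) A ` H)"
proof -
  have "inj_on ((*v) A) S" for S
    using assms(2) by (metis inj_onI matrix_vector_mul_assoc matrix_vector_mul_lid)
  then show ?thesis
    using assms(1) by (simp add: is_hyperplane_def vec.subspace_image vec.dim_image_eq matrix_vector_mul_linear_gen)
qed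

lemma conjugate_reflection:
  fixes A B :: "complex^'n^'n"
  assumes s: "is_reflection s" and AB: "A ** B = mat 1" "B ** A = mat 1"
  shows "is_reflection (A ** s ** B)" "fixed_space (A ** s ** B) = (*v) A ` fixed_space s"
proof -
  have ABv: "A *v (B *v x) = x" "B *v (A *v x) = x" for x
    using AB by (simp_all add: matrix_vector_mul_assoc)
  show fs: "fixed_space (A ** s ** B) = (*v) A ` fixed_space s"
  proof
    show "fixed_space (A ** s ** B) \<subseteq> (*v) A ` fixed_space s"
    proof
      fix x assume "x \<in> fixed_space (A ** s ** B)"
      then have "A *v (s *v (B *v x)) = x" by (simp add: fixed_space_def matrix_vector_mul_assoc matrix_mul_assoc)
      then have "s *v (B *v x) = B *v x" using ABv(2) by metis
      then show "x \<in> (*v) A ` fixed_space s"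
        using ABv(1)[of x] by (intro image_eqI[of _ _ "B *v x"]) (simp_all add: fixed_space_def)
    qed
    show "(*v) A ` fixed_space s \<subseteq> fixed_space (A ** s ** B)"
      by (auto simp: fixed_space_def ABv simp flip: matrix_vector_mul_assoc)
  qed
  obtain H where H: "is_hyperplane H" "\<forall>v\<in>H. s *v v = v" using s by (auto simp: is_reflection_def)
  have "A ** s ** B \<noteq> mat 1"
  proof
    assume "A ** s ** B = mat 1"
    then have "A *v (s *v (B *v x)) = x" for x by (simp add: matrix_vector_mul_assoc matrix_mul_assoc)
    then have "s *v x = x" for x using ABv by metis
    then show False using s by (metis is_reflection_def matrix_eq matrix_vector_mul_lid)
  qed
  moreover have "invertible (A ** s ** B)"
    using s AB by (intro invertible_mult) (auto simp: is_reflection_def invertible_def)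
  moreover have "\<forall>v\<in>(*v) A ` H. (A ** s ** B) *v v = v"
    using H(2) by (auto simp: ABv simp flip: matrix_vector_mul_assoc)
  ultimately show "is_reflection (A ** s ** B)"
    unfolding is_reflection_def using hyperplane_image[OF H(1) AB(2)] by blast
qed

lemma generate_matrix_induct:
  assumes "finite_matrix_group W" "generate general_linear {s \<in> W. is_reflection s} = W"
    and w: "w \<in> W" and one: "P (mat 1)"
    and refl: "\<And>s. \<lbrakk>s \<in> W; is_reflection s\<rbrakk> \<Longrightarrow> P s"
    and inv: "\<And>s. \<lbrakk>s \<in> W; P s\<rbrakk> \<Longrightarrow> P (matrix_inv s)"
    and mult: "\<And>s t. \<lbrakk>s \<in> W; t \<in> W; P s; P t\<rbrakk> \<Longrightarrow> P (s ** t)"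
  shows "P w"
proof -
  interpret finite_matrix_group W by fact
  have "w \<in> generate general_linear {s \<in> W. is_reflection s}" using assms(2) w by simp
  then have "w \<in> W \<and> P w"
  proof (induction rule: generate.induct)
    case one
    show ?case using \<open>P (mat 1)\<close> one_mem by (simp add: general_linear_def)
  next
    case (incl s)
    then show ?case using refl by blast
  next
    case (inv s)
    then show ?case using refl \<open>\<And>s. \<lbrakk>s \<in> W; P s\<rbrakk> \<Longrightarrow> P (matrix_inv s)\<close>
      by (simp add: inv_general_linear inv_mem)
  next
    case (eng s t)
    then show ?case using mult mult_mem by (simp add: general_linear_def)
  qed
  then show ?thesis by simp
qed

text \<open>Let \<open>y\<close> be a point with trivial stabilizer, \<open>Y\<close> its orbit and \<open>U\<close> the orbit of \<open>v\<close>. It suffices that \<open>Y\<close>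
  is not larger than \<open>U\<close>. Let \<open>f\<close> be a polynomial that vanishes on \<open>U\<close>. For a reflection \<open>s\<close> along the
  hyperplane \<open>a = 0\<close> the divided difference of \<open>f\<close> vanishes on \<open>U\<close> as well, because \<open>a\<close> has no zeros there.
  By induction on the degree it agrees on \<open>Y\<close> with a polynomial of smaller degree, so \<open>f - f \<circ> s\<close>
  agrees on \<open>Y\<close> with a polynomial of degree less than that of \<open>f\<close>. This property passes from
  reflections to all elements of \<open>W\<close>. The average of \<open>f\<close> over \<open>W\<close> is constant on \<open>Y\<close>, so \<open>f\<close> itself agrees
  on \<open>Y\<close> with a polynomial of smaller degree, and the comparison of orbits applies.\<close>

theorem stabilizer_trivial:
  fixes W :: "(complex^'n^'n) set"
  assumes W: "finite_matrix_group W" "generate general_linear {s \<in> W. is_reflection s} = W"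
    and v: "\<And>s. \<lbrakk>s \<in> W; is_reflection s\<rbrakk> \<Longrightarrow> v \<notin> fixed_space s"
    and w: "w \<in> W" "w *v v = v"
  shows "w = mat 1"
proof -
  interpret finite_matrix_group W by fact
  \<comment> \<open>A point \<open>y\<close> moved by all nontrivial elements: each of them has a nonzero displacement
    coordinate, and finitely many such functions have a common point where none vanishes.\<close>
  have "\<exists>i p. (u *v p - p) $ i \<noteq> 0" if u: "u \<noteq> mat 1" for u :: "complex^'n^'n"
  proof -
    obtain p where "u *v p \<noteq> p" using u by (metis matrix_eq matrix_vector_mul_lid)
    then show ?thesis by (auto simp: vec_eq_iff)
  qed
  then obtain i where i: "\<And>u :: complex^'n^'n. u \<noteq> mat 1 \<Longrightarrow> \<exists>p. (u *v p - p) $ i u \<noteq> 0" by metis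
  have "\<exists>y. \<forall>f\<in>(\<lambda>(u :: complex^'n^'n) p. (u *v p - p) $ i u) ` (W - {mat 1}). f y \<noteq> 0"
  proof (rule common_nonzero_exists)
    fix f assume "f \<in> (\<lambda>(u :: complex^'n^'n) p. (u *v p - p) $ i u) ` (W - {mat 1})"
    then obtain u where u: "u \<noteq> mat 1" "f = (\<lambda>p. (u *v p - p) $ i u)" by blast
    show "complex_affine f" unfolding u(2) by (rule matrix_vector_mult_component_affine)
    show "\<exists>p. f p \<noteq> 0" unfolding u(2) by (rule i[OF u(1)])
  qed (use fin in simp)
  then obtain y where y: "\<forall>f\<in>(\<lambda>(u :: complex^'n^'n) p. (u *v p - p) $ i u) ` (W - {mat 1}). f y \<noteq> 0"
    by (rule exE)
  have y: "u *v y \<noteq> y" if "u \<in> W" "u \<noteq> mat 1" for u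
    using bspec[OF y imageI[of u "W - {mat 1}"]] that by auto
  have inj: "inj_on (\<lambda>u. u *v y) W"
  proof (rule inj_onI)
    fix u u' assume u: "u \<in> W" "u' \<in> W" "u *v y = u' *v y"
    then have "(matrix_inv u' ** u) *v y = y" by (simp add: matrix_vector_mul_assoc[symmetric] inv_vec)
    then have "matrix_inv u' ** u = mat 1" using y u mult_mem inv_mem by blast
    then have "u' ** (matrix_inv u' ** u) = u'" by simp
    then show "u = u'" using matrix_inv_mult(1)[OF invertible[OF u(2)]] by (simp add: matrix_mul_assoc)
  qed
  let ?U = "(\<lambda>u. u *v v) ` W" and ?Y = "(\<lambda>u. u *v y) ` W"
  have off: "a (u *v v) \<noteq> 0" if "s \<in> W" "is_reflection s" "fixed_space s = {p. a p = 0}" "u \<in> W" for s a u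
  proof
    assume "a (u *v v) = 0"
    then have "s *v (u *v v) = u *v v" using that(3) by (auto simp: fixed_space_def)
    then have "(matrix_inv u ** s ** u) *v v = v"
      by (simp add: matrix_vector_mul_assoc[symmetric] inv_vec that)
    moreover have "is_reflection (matrix_inv u ** s ** u)"
      by (rule conjugate_reflection[OF that(2)]) (simp_all add: matrix_inv_mult invertible that)
    moreover have "matrix_inv u ** s ** u \<in> W" using that by (simp add: mult_mem inv_mem)
    ultimately show False using v by (auto simp: fixed_space_def)
  qed
  have "card ?Y \<le> card ?U"
  proof (rule card_le_by_degree_reduction)
    fix e and f :: "complex^'n \<Rightarrow> complex"
    assume "poly_deg e f" "\<forall>p\<in>?U. f p = 0"
    then show "\<exists>g. poly_deg_less e g \<and> (\<forall>p\<in>?Y. f p = g p)"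
    proof (induction e arbitrary: f)
      case 0
      then obtain c where "f = (\<lambda>_. c)" using poly_deg_0 by blast
      then show ?case using 0 one_mem by auto
    next
      case (Suc e)
      \<comment> \<open>The property that passes from reflections to the group they generate.\<close>
      define T where "T u \<longleftrightarrow> (\<exists>g. poly_deg e g \<and> (\<forall>p\<in>?Y. f p - f (u *v p) = g p))" for u
      have Ym: "u *v p \<in> ?Y" if "u \<in> W" "p \<in> ?Y" for u p
        using that mult_mem by (auto simp: matrix_vector_mul_assoc)
      have "T u" if "u \<in> W" for u
      proof (rule generate_matrix_induct[OF W that])
        show "T (mat 1)" unfolding T_def by (intro exI[of _ "\<lambda>_. 0"]) (simp add: poly_deg.const)
      next
        fix s assume s: "s \<in> W" "is_reflection s"
        obtain a t where a: "linear_form a" "\<And>v. s *v v = v + a v *s t" "fixed_space s = {v. a v = 0}"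
          using reflection_form[OF s(2)] by metis
        obtain g where g: "poly_deg e g" "\<And>v. f v - f (s *v v) = a v * g v"
          using divided_difference[OF a(2) Suc.prems(1)] by auto
        have "g (u *v v) = 0" if "u \<in> W" for u
        proof -
          have "f (u *v v) = 0" "f (s *v (u *v v)) = 0"
            using Suc.prems(2) that s(1) mult_mem by (auto simp: matrix_vector_mul_assoc)
          then show ?thesis using g(2)[of "u *v v"] off[OF s a(3) that] by simp
        qed
        then obtain h where h: "poly_deg_less e h" "\<forall>p\<in>?Y. g p = h p" using Suc.IH[OF g(1)] by auto
        show "T s" unfolding T_def
          using poly_deg_less_mult[OF h(1) a(1)] h(2) g(2) by (intro exI[of _ "\<lambda>v. a v * h v"]) auto
      next
        fix s assume s: "s \<in> W" "T s"
        then obtain g where g: "poly_deg e g" "\<forall>p\<in>?Y. f p - f (s *v p) = g p" unfolding T_def by blast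
        have "f p - f (matrix_inv s *v p) = (-1) * g (matrix_inv s *v p)" if "p \<in> ?Y" for p
          using g(2)[rule_format, OF Ym[OF inv_mem[OF s(1)] that]] by (simp add: inv_vec[OF s(1)] algebra_simps)
        then show "T (matrix_inv s)"
          unfolding T_def using poly_deg_scale[OF poly_deg_matrix[OF g(1)]] by blast
      next
        fix s t assume st: "s \<in> W" "t \<in> W" "T s" "T t"
        obtain g h where g: "poly_deg e g" "\<forall>p\<in>?Y. f p - f (s *v p) = g p"
          and h: "poly_deg e h" "\<forall>p\<in>?Y. f p - f (t *v p) = h p" using st unfolding T_def by blast
        have "f p - f ((s ** t) *v p) = h p + g (t *v p)" if "p \<in> ?Y" for p
          using g(2)[rule_format, OF Ym[OF st(2) that]] h(2)[rule_format, OF that]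
          by (simp add: matrix_vector_mul_assoc[symmetric] algebra_simps)
        then show "T (s ** t)"
          unfolding T_def using poly_deg.add[OF h(1) poly_deg_matrix[OF g(1), of t]] by blast
      qed
      then obtain g where g: "\<And>u. u \<in> W \<Longrightarrow> poly_deg e (g u) \<and> (\<forall>p\<in>?Y. f p - f (u *v p) = g u p)"
        unfolding T_def by metis
      define C where "C = (\<Sum>u\<in>W. f (u *v y))"
      have N: "of_nat (card W) \<noteq> (0::complex)" using fin one_mem by auto
      define h where "h p = inverse (of_nat (card W)) * (C + (\<Sum>u\<in>W. g u p))" for p
      have "poly_deg e h"
        unfolding h_def using g by (intro poly_deg_scale poly_deg.add poly_deg.const poly_deg_sum) auto
      moreover have "f p = h p" if p: "p \<in> ?Y" for p
      proof -
        obtain u0 where u0: "u0 \<in> W" "p = u0 *v y" using p by auto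
        have "(\<Sum>u\<in>W. f (u *v p)) = C"
          unfolding C_def using sum.reindex_bij_betw[OF bij_mult_right[OF u0(1)], of "\<lambda>u. f (u *v y)"]
          by (simp add: u0(2) matrix_vector_mul_assoc)
        moreover have "(\<Sum>u\<in>W. f p - f (u *v p)) = (\<Sum>u\<in>W. g u p)"
          using g p by (intro sum.cong) auto
        ultimately have "of_nat (card W) * f p = C + (\<Sum>u\<in>W. g u p)"
          by (simp add: sum_subtractf algebra_simps)
        then show ?thesis using N by (simp add: h_def field_simps)
      qed
      ultimately show ?case by auto
    qed
  qed (use fin in auto)
  moreover have "card ?Y = card W" using card_image[OF inj] .
  ultimately have "card ?U = card W" using card_image_le[OF fin, of "\<lambda>u. u *v v"] by simp
  then have "inj_on (\<lambda>u. u *v v) W" using eq_card_imp_inj_on[OF fin] by simp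
  then show ?thesis
    by (rule inj_onD) (use w one_mem in simp_all)
qed

section \<open>The covering of the orbit space\<close>

lemma abs_min_le:
  fixes a b c :: real
  assumes "a \<le> b + c" "b \<le> a + c" "0 \<le> c"
  shows "\<bar>min 1 a - min 1 b\<bar> \<le> c"
  using assms by (auto simp: min_def abs_if)

lemma tendsto_matrix_vector: "((*v) w \<longlongrightarrow> w *v v) (at v within S)" for w :: "complex^'n^'n"
proof -
  have "((*v) w \<longlongrightarrow> w *v v) (at v within UNIV)"
    using matrix_vector_mult_linear_continuous_on[of UNIV w] unfolding continuous_on_def by (rule bspec) simp
  then show ?thesis by (rule tendsto_within_subset) simp
qed

lemma tendsto_if_dist_le:
  fixes f :: "'a \<Rightarrow> 'b::metric_space"
  assumes "(g \<longlongrightarrow> 0) F" "\<And>v. dist (f v) l \<le> g v"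
  shows "(f \<longlongrightarrow> l) F"
proof -
  have "((\<lambda>v. dist (f v) l) \<longlongrightarrow> 0) F"
    by (rule tendsto_sandwich[OF _ _ tendsto_const assms(1)]) (simp_all add: always_eventually assms(2))
  then show ?thesis by (rule tendsto_dist_iff[THEN iffD2])
qed

locale reflection_group =
  fixes W :: "(complex^'n^'n) set"
  assumes reflection_group: "complex_reflection_group W"

sublocale reflection_group \<subseteq> finite_matrix_group W
  by (rule finite_matrix_group.intro) (use reflection_group in \<open>simp_all add: complex_reflection_group_def\<close>)

context reflection_group
begin

abbreviation "X \<equiv> hyperplane_complement W"
abbreviation "\<pi> \<equiv> orbit_map W"

lemma mem_X: "v \<in> X \<longleftrightarrow> (\<forall>s\<in>W. is_reflection s \<longrightarrow> s *v v \<noteq> v)"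
  by (auto simp: hyperplane_complement_def reflecting_hyperplanes_def fixed_space_def)

lemma X_invariant:
  assumes "w \<in> W" "v \<in> X"
  shows "w *v v \<in> X"
  unfolding mem_X
proof (intro ballI impI notI)
  fix s assume s: "s \<in> W" "is_reflection s" "s *v (w *v v) = w *v v"
  have "is_reflection (matrix_inv w ** s ** w)"
    by (rule conjugate_reflection[OF s(2)]) (simp_all add: matrix_inv_mult invertible assms)
  moreover have "matrix_inv w ** s ** w \<in> W" using s assms by (simp add: mult_mem inv_mem)
  moreover have "(matrix_inv w ** s ** w) *v v = v"
    using s(3) by (simp add: matrix_vector_mul_assoc[symmetric] inv_vec assms)
  ultimately show False using assms(2) by (simp add: mem_X)
qed

lemma free_action:
  assumes "v \<in> X" "w \<in> W" "w *v v = v"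
  shows "w = mat 1"
proof (rule stabilizer_trivial[OF finite_matrix_group_axioms _ _ assms(2,3)])
  show "generate general_linear {s \<in> W. is_reflection s} = W"
    using reflection_group by (simp add: complex_reflection_group_def)
  show "v \<notin> fixed_space s" if "s \<in> W" "is_reflection s" for s
    using assms(1) that by (auto simp: mem_X fixed_space_def)
qed

lemma free_action_eq:
  assumes "v \<in> X" "w \<in> W" "w' \<in> W" "w *v v = w' *v v"
  shows "w = w'"
proof -
  have "(matrix_inv w' ** w) *v v = v" using assms by (simp add: matrix_vector_mul_assoc[symmetric] inv_vec)
  then have "matrix_inv w' ** w = mat 1" using assms by (intro free_action[of v]) (simp_all add: mult_mem inv_mem)
  then have "w' ** (matrix_inv w' ** w) = w'" by simp
  then show ?thesis using matrix_inv_mult(1)[OF invertible[OF assms(3)]] by (simp add: matrix_mul_assoc)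
qed

lemma orbit_map_eq_image: "\<pi> v = (\<lambda>w. w *v v) ` W"
  by (auto simp: orbit_map_def orbit_def)

lemma mem_orbit_self: "v \<in> \<pi> v"
  using one_mem by (force simp: orbit_map_eq_image)

lemma orbit_map_invariant:
  assumes "w \<in> W"
  shows "\<pi> (w *v v) = \<pi> v"
proof -
  have "(\<lambda>u. u *v (w *v v)) ` W = (\<lambda>u. u *v v) ` ((\<lambda>u. u ** w) ` W)"
    by (simp add: image_image matrix_vector_mul_assoc)
  then show ?thesis
    using bij_mult_right[OF assms] by (simp add: orbit_map_eq_image bij_betw_def)
qed

lemma finite_orbit: "finite (\<pi> v)"
  using fin by (simp add: orbit_map_eq_image)

text \<open>The distance function of an orbit, truncated to be bounded. It embeds the orbit space into a normed
  space, where covering maps between sets, their path liftings and homotopy liftings make sense.\<close>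

definition orbit_fun :: "(complex^'n) set \<Rightarrow> (complex^'n) \<Rightarrow>\<^sub>C real" where
  "orbit_fun S = Bcontfun (\<lambda>y. min 1 (infdist y S))"

lemma apply_orbit_fun: "apply_bcontfun (orbit_fun S) y = min 1 (infdist y S)"
proof -
  have "(\<lambda>y. min 1 (infdist y S)) \<in> bcontfun"
    by (rule bcontfun_normI[where b = 1]) (auto intro!: continuous_intros simp: infdist_nonneg)
  then show ?thesis by (simp add: orbit_fun_def Bcontfun_inverse)
qed

lemma infdist_orbit_attained:
  obtains w where "w \<in> W" "infdist y (\<pi> v) = dist y (w *v v)"
proof -
  have "closed (\<pi> v)" "\<pi> v \<noteq> {}" using finite_orbit mem_orbit_self by (auto intro: finite_imp_closed)
  then obtain z where "z \<in> \<pi> v" "infdist y (\<pi> v) = dist y z" using infdist_attains_inf by blast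
  then show thesis using that by (auto simp: orbit_map_eq_image)
qed

lemma orbit_fun_eq_iff: "orbit_fun (\<pi> v) = orbit_fun (\<pi> v') \<longleftrightarrow> \<pi> v = \<pi> v'"
proof
  assume eq: "orbit_fun (\<pi> v) = orbit_fun (\<pi> v')"
  have "min 1 (infdist v (\<pi> v)) = min 1 (infdist v (\<pi> v'))"
    unfolding apply_orbit_fun[symmetric] eq by (rule refl)
  then have zero: "infdist v (\<pi> v') = 0"
    unfolding infdist_zero[OF mem_orbit_self] by (simp add: min_def split: if_splits)
  obtain w where w: "w \<in> W" "infdist v (\<pi> v') = dist v (w *v v')" by (rule infdist_orbit_attained)
  then have "v = w *v v'" using zero by simp
  then show "\<pi> v = \<pi> v'" using orbit_map_invariant[OF w(1), of v'] by simp
qed simp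

lemma infdist_orbit_le: "infdist y (\<pi> p) \<le> infdist y (\<pi> q) + (\<Sum>w\<in>W. dist (w *v p) (w *v q))"
proof -
  obtain w where w: "w \<in> W" "infdist y (\<pi> q) = dist y (w *v q)" by (rule infdist_orbit_attained)
  have "infdist y (\<pi> p) \<le> dist y (w *v p)" using w(1) by (intro infdist_le) (auto simp: orbit_map_eq_image)
  also have "\<dots> \<le> dist y (w *v q) + dist (w *v p) (w *v q)"
    using dist_triangle[of y "w *v p" "w *v q"] by (simp add: dist_commute)
  also have "dist (w *v p) (w *v q) \<le> (\<Sum>w\<in>W. dist (w *v p) (w *v q))"
    using w(1) fin by (intro member_le_sum[of w W "\<lambda>w. dist (w *v p) (w *v q)"]) simp_all
  finally show ?thesis using w(2) by simp
qed

lemma dist_orbit_fun_le: "dist (orbit_fun (\<pi> p)) (orbit_fun (\<pi> q)) \<le> (\<Sum>w\<in>W. dist (w *v p) (w *v q))"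
proof (rule dist_bound)
  fix y
  have sym: "(\<Sum>w\<in>W. dist (w *v q) (w *v p)) = (\<Sum>w\<in>W. dist (w *v p) (w *v q))"
    by (rule sum.cong[OF refl dist_commute])
  show "dist (orbit_fun (\<pi> p) y) (orbit_fun (\<pi> q) y) \<le> (\<Sum>w\<in>W. dist (w *v p) (w *v q))"
    unfolding apply_orbit_fun dist_real_def
    by (rule abs_min_le[OF infdist_orbit_le infdist_orbit_le[of y q p, unfolded sym]]) (simp add: sum_nonneg)
qed

lemma continuous_on_orbit_fun: "continuous_on S (\<lambda>v. orbit_fun (\<pi> v))"
  unfolding continuous_on_def
proof
  fix v
  have "((\<lambda>p. \<Sum>w\<in>W. dist (w *v p) (w *v v)) \<longlongrightarrow> (\<Sum>w\<in>W. dist (w *v v) (w *v v))) (at v within S)"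
    by (intro tendsto_sum tendsto_dist tendsto_const tendsto_matrix_vector)
  then have "((\<lambda>p. \<Sum>w\<in>W. dist (w *v p) (w *v v)) \<longlongrightarrow> 0) (at v within S)" by simp
  then show "((\<lambda>v. orbit_fun (\<pi> v)) \<longlongrightarrow> orbit_fun (\<pi> v)) (at v within S)"
    by (rule tendsto_if_dist_le) (rule dist_orbit_fun_le)
qed

text \<open>A function near that of the orbit of a point \<open>u\<close> of \<open>U\<close> is small at \<open>u\<close>, so the corresponding orbit
  has a point near \<open>u\<close>, hence in \<open>U\<close>.\<close>

lemma open_map_orbit_fun:
  assumes "open U" "U \<subseteq> X"
  shows "openin (top_of_set ((\<lambda>v. orbit_fun (\<pi> v)) ` X)) ((\<lambda>v. orbit_fun (\<pi> v)) ` U)"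
  unfolding openin_contains_ball
proof (intro conjI ballI)
  show "(\<lambda>v. orbit_fun (\<pi> v)) ` U \<subseteq> (\<lambda>v. orbit_fun (\<pi> v)) ` X" using assms(2) by blast
  fix f assume "f \<in> (\<lambda>v. orbit_fun (\<pi> v)) ` U"
  then obtain v where v: "v \<in> U" "f = orbit_fun (\<pi> v)" by blast
  obtain e0 where e0: "e0 > 0" "ball v e0 \<subseteq> U" using assms(1) v(1) open_contains_ball by blast
  define e where "e = min e0 1"
  have e: "e > 0" "e \<le> 1" "ball v e \<subseteq> U" using e0 by (auto simp: e_def)
  have "orbit_fun (\<pi> v') \<in> (\<lambda>v. orbit_fun (\<pi> v)) ` U" if "dist f (orbit_fun (\<pi> v')) < e" for v'
  proof -
    have "dist (f v) (orbit_fun (\<pi> v') v) < e" using dist_fun_lt_imp_dist_val_lt[OF that] .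
    then have "infdist v (\<pi> v') < e"
      using e(2) mem_orbit_self[of v] infdist_nonneg[of v "\<pi> v'"]
      by (simp add: v(2) apply_orbit_fun dist_real_def min_def split: if_splits)
    moreover obtain w where w: "w \<in> W" "infdist v (\<pi> v') = dist v (w *v v')" by (rule infdist_orbit_attained)
    ultimately have "w *v v' \<in> U" using e(3) by auto
    then show ?thesis using orbit_map_invariant[OF w(1), of v'] by (metis imageI)
  qed
  then show "\<exists>e>0. ball f e \<inter> (\<lambda>v. orbit_fun (\<pi> v)) ` X \<subseteq> (\<lambda>v. orbit_fun (\<pi> v)) ` U"
    using e(1) by (intro exI[of _ e]) auto
qed

lemma open_X: "open X"
proof -
  have "finite (reflecting_hyperplanes W)" using fin by (simp add: reflecting_hyperplanes_def)
  moreover have "closed H" if H: "H \<in> reflecting_hyperplanes W" for H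
  proof -
    obtain s where s: "H = {v. s *v v = v}" using H by (auto simp: reflecting_hyperplanes_def fixed_space_def)
    show ?thesis unfolding s
      by (intro closed_Collect_eq matrix_vector_mult_linear_continuous_on continuous_on_id)
  qed
  ultimately show ?thesis
    unfolding hyperplane_complement_def by (intro open_Diff open_UNIV closed_Union) auto
qed

lemma free_neighbourhood:
  assumes "v \<in> X"
  shows "\<exists>U. open U \<and> v \<in> U \<and> U \<subseteq> X \<and> (\<forall>w\<in>W. \<forall>u\<in>U. w *v u \<in> U \<longrightarrow> w = mat 1)"
proof -
  have "finite ((\<lambda>w. w *v v) ` (W - {mat 1}))" using fin by simp
  then obtain d where d0: "d > 0" "\<forall>z\<in>(\<lambda>w. w *v v) ` (W - {mat 1}). z \<noteq> v \<longrightarrow> d \<le> dist v z"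
    using finite_set_avoid by blast
  have d: "d > 0" "d \<le> dist v (w *v v)" if "w \<in> W" "w \<noteq> mat 1" for w
    using d0 that free_action[OF assms that(1)] by auto
  define U where "U = X \<inter> ball v (d / 2) \<inter> (\<Inter>w\<in>W - {mat 1}. {u. d / 2 < dist v (w *v u)})"
  show ?thesis
  proof (intro exI[of _ U] conjI ballI impI)
    have "open {u. d / 2 < dist v (w *v u)}" for w
      by (intro open_Collect_less continuous_intros matrix_vector_mult_linear_continuous_on)
    then show "open U" unfolding U_def using fin open_X by (intro open_Int open_INT) auto
    show "v \<in> U" using d(2) d0(1) assms by (force simp: U_def)
    show "U \<subseteq> X" by (auto simp: U_def)
    fix w u assume wu: "w \<in> W" "u \<in> U" "w *v u \<in> U"
    show "w = mat 1"
    proof (rule ccontr)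
      assume "w \<noteq> mat 1"
      then have "d / 2 < dist v (w *v u)" using wu(1,2) by (simp add: U_def)
      moreover have "dist v (w *v u) < d / 2" using wu(3) by (simp add: U_def)
      ultimately show False by simp
    qed
  qed
qed

text \<open>Over the image of a neighbourhood \<open>U\<close> that is disjoint from its translates, the sheets are the
  translates of \<open>U\<close>.\<close>

lemma covering_orbit_fun: "covering_space X (\<lambda>v. orbit_fun (\<pi> v)) ((\<lambda>v. orbit_fun (\<pi> v)) ` X)"
proof
  let ?c = "\<lambda>v. orbit_fun (\<pi> v)"
  fix f assume "f \<in> ?c ` X"
  then obtain v where v: "v \<in> X" "f = ?c v" by blast
  obtain U where "open U \<and> v \<in> U \<and> U \<subseteq> X \<and> (\<forall>w\<in>W. \<forall>u\<in>U. w *v u \<in> U \<longrightarrow> w = mat 1)"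
    by (rule exE[OF free_neighbourhood[OF v(1)]])
  then have U: "open U" "v \<in> U" "U \<subseteq> X" "\<And>w u. \<lbrakk>w \<in> W; u \<in> U; w *v u \<in> U\<rbrakk> \<Longrightarrow> w = mat 1"
    by blast+
  let ?V = "(\<lambda>w. (*v) w ` U) ` W"
  have open_sheet: "open ((*v) w ` U)" if "w \<in> W" for w
  proof -
    have "(*v) w ` U = (*v) (matrix_inv w) -` U"
    proof (intro Set.set_eqI iffI)
      fix z assume "z \<in> (*v) (matrix_inv w) -` U"
      then show "z \<in> (*v) w ` U" using inv_vec(1)[OF that, of z] by (intro image_eqI[of _ _ "matrix_inv w *v z"]) simp_all
    qed (auto simp: inv_vec[OF that])
    then show ?thesis using U(1) by (simp add: open_vimage matrix_vector_mult_linear_continuous_on)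
  qed
  have sheet_X: "(*v) w ` U \<subseteq> X" if "w \<in> W" for w using U(3) X_invariant[OF that] by blast
  have sheet_c: "?c ` ((*v) w ` U) = ?c ` U" if "w \<in> W" for w
    by (simp add: image_image orbit_map_invariant[OF that])
  show "\<exists>T. f \<in> T \<and> openin (top_of_set (?c ` X)) T \<and> (\<exists>V. \<Union>V = X \<inter> ?c -` T \<and> (\<forall>u\<in>V. openin (top_of_set X) u) \<and>
      pairwise disjnt V \<and> (\<forall>u\<in>V. \<exists>q. homeomorphism u T ?c q))"
  proof (intro exI[of _ "?c ` U"] exI[of _ ?V] conjI ballI)
    show "f \<in> ?c ` U" using v U by blast
    show "openin (top_of_set (?c ` X)) (?c ` U)" by (rule open_map_orbit_fun[OF U(1,3)])
    show "\<Union>?V = X \<inter> ?c -` (?c ` U)"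
    proof
      show "\<Union>?V \<subseteq> X \<inter> ?c -` (?c ` U)" using sheet_X sheet_c by fast
      show "X \<inter> ?c -` (?c ` U) \<subseteq> \<Union>?V"
      proof
        fix p assume "p \<in> X \<inter> ?c -` (?c ` U)"
        then obtain u where "u \<in> U" "\<pi> p = \<pi> u" by (auto simp: orbit_fun_eq_iff)
        then show "p \<in> \<Union>?V" using mem_orbit_self[of p] by (auto simp: orbit_map_eq_image[of u])
      qed
    qed
    show "openin (top_of_set X) S" if "S \<in> ?V" for S
      using that open_sheet sheet_X open_X by (auto simp: openin_open_eq)
    show "pairwise disjnt ?V"
    proof (rule pairwiseI)
      fix S S' assume "S \<in> ?V" "S' \<in> ?V" "S \<noteq> S'"
      then obtain w w' where w: "w \<in> W" "w' \<in> W" "S = (*v) w ` U" "S' = (*v) w' ` U" "w \<noteq> w'" by blast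
      have False if "u \<in> U" "u' \<in> U" "w *v u = w' *v u'" for u u'
      proof -
        have "(matrix_inv w' ** w) *v u = u'" using that w by (simp add: matrix_vector_mul_assoc[symmetric] inv_vec)
        then have "matrix_inv w' ** w = mat 1" using U(4)[of "matrix_inv w' ** w" u] that w by (simp add: mult_mem inv_mem)
        then have "w' ** (matrix_inv w' ** w) = w'" by simp
        then show False using w matrix_inv_mult(1)[OF invertible[OF w(2)]] by (simp add: matrix_mul_assoc)
      qed
      then show "disjnt S S'" unfolding disjnt_def w(3,4) by blast
    qed
    fix S assume "S \<in> ?V"
    then obtain w where w: "w \<in> W" "S = (*v) w ` U" by blast
    have inj: "inj_on ?c S"
    proof (rule inj_onI)
      fix p q assume "p \<in> S" "q \<in> S" "?c p = ?c q"
      then obtain u u' where u: "u \<in> U" "u' \<in> U" "p = w *v u" "q = w *v u'" "\<pi> u = \<pi> u'"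
        using w by (auto simp: orbit_fun_eq_iff orbit_map_invariant)
      then obtain w' where "w' \<in> W" "u = w' *v u'" using mem_orbit_self[of u] by (auto simp: orbit_map_eq_image[of u'])
      then show "p = q" using U(4)[of w' u'] u by simp
    qed
    have op: "openin (top_of_set (?c ` U)) (?c ` Q)" if "openin (top_of_set S) Q" for Q
    proof -
      have "open Q" "Q \<subseteq> S" using that open_sheet[OF w(1)] openin_open_eq w(2) by auto
      then have "openin (top_of_set (?c ` X)) (?c ` Q)" using sheet_X[OF w(1)] w(2) by (intro open_map_orbit_fun) auto
      moreover have "?c ` Q \<subseteq> ?c ` U" using sheet_c[OF w(1)] w(2) \<open>Q \<subseteq> S\<close> by blast
      ultimately show ?thesis by (rule openin_subset_trans) (use U(3) in blast)
    qed
    have cS: "?c ` S = ?c ` U" unfolding w(2) by (rule sheet_c[OF w(1)])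
    obtain q where "homeomorphism S (?c ` U) ?c q"
      by (rule homeomorphism_injective_open_map[of S ?c "?c ` U", OF continuous_on_orbit_fun cS inj op])
    then show "\<exists>q. homeomorphism S (?c ` U) ?c q" by blast
  qed
qed (simp_all add: continuous_on_orbit_fun)

lemma continuous_map_orbit_map: "continuous_map (top_of_set X) (orbit_space W) \<pi>"
  unfolding orbit_space_def by (rule quotient_imp_continuous_map[OF quotient_map_quotient_topology])

lemma continuous_map_orbit_fun: "continuous_map (orbit_space W) (top_of_set ((\<lambda>v. orbit_fun (\<pi> v)) ` X)) orbit_fun"
proof -
  have "continuous_map (top_of_set X) (top_of_set ((\<lambda>v. orbit_fun (\<pi> v)) ` X)) (orbit_fun \<circ> \<pi>)"
    using continuous_on_orbit_fun by (auto simp: o_def)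
  then show ?thesis
    unfolding orbit_space_def using continuous_compose_quotient_map[OF quotient_map_quotient_topology] by blast
qed

lemma topspace_orbit_space: "topspace (orbit_space W) = \<pi> ` X"
  by (simp add: orbit_space_def topspace_quotient_topology)

theorem orbit_path_lift:
  assumes "pathin (orbit_space W) q" "q 0 = \<pi> x" "x \<in> X"
  obtains p where "path p" "path_image p \<subseteq> X" "p 0 = x" "\<And>t. t \<in> {0..1} \<Longrightarrow> \<pi> (p t) = q t"
proof -
  let ?c = "\<lambda>v. orbit_fun (\<pi> v)"
  have "continuous_map (top_of_set {0..1}) (top_of_set (?c ` X)) (orbit_fun \<circ> q)"
    using assms(1) continuous_map_orbit_fun continuous_map_compose unfolding pathin_def by blast
  then have g: "path (orbit_fun \<circ> q)" "path_image (orbit_fun \<circ> q) \<subseteq> ?c ` X"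
    by (simp_all add: path_def path_image_def image_subset_iff_funcset o_def)
  obtain p where p: "path p" "path_image p \<subseteq> X" "pathstart p = x" "\<And>t. t \<in> {0..1} \<Longrightarrow> ?c (p t) = (orbit_fun \<circ> q) t"
    by (rule covering_space_lift_path_strong[OF covering_orbit_fun assms(3) g]) (use assms(2) in \<open>auto simp: pathstart_def\<close>)
  show thesis
  proof (rule that[OF p(1,2)])
    show "p 0 = x" using p(3) by (simp add: pathstart_def)
    fix t :: real assume t: "t \<in> {0..1}"
    have "q ` {0..1} \<subseteq> \<pi> ` X"
      using assms(1) continuous_map_image_subset_topspace[of "top_of_set {0..1}" "orbit_space W" q]
      by (simp add: pathin_def topspace_orbit_space)
    then obtain v where v: "q t = \<pi> v" using t by blast
    show "\<pi> (p t) = q t" using p(4)[OF t] unfolding v o_apply orbit_fun_eq_iff .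
  qed
qed

text \<open>Homotopy lifting for the covering. The quotient topology of the orbit space enters only through
  the continuity of the two maps \<open>\<pi>\<close> and \<open>orbit_fun\<close>.\<close>

theorem homotopic_orbit_paths_iff:
  assumes p: "path p" "path_image p \<subseteq> X" "p 0 = x" and q: "path q" "path_image q \<subseteq> X" "q 0 = x"
    and ends: "\<pi> (p 1) = \<pi> x" "\<pi> (q 1) = \<pi> x"
  shows "homotopic_with (\<lambda>r. r 0 = \<pi> x \<and> r 1 = \<pi> x) (top_of_set {0..1}) (orbit_space W) (\<pi> \<circ> p) (\<pi> \<circ> q)
    \<longleftrightarrow> homotopic_paths X p q"
proof
  let ?c = "\<lambda>v. orbit_fun (\<pi> v)"
  assume "homotopic_with (\<lambda>r. r 0 = \<pi> x \<and> r 1 = \<pi> x) (top_of_set {0..1}) (orbit_space W) (\<pi> \<circ> p) (\<pi> \<circ> q)"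
  then have "homotopic_with (\<lambda>r. r 0 = ?c x \<and> r 1 = ?c x) (top_of_set {0..1}) (top_of_set (?c ` X))
      (orbit_fun \<circ> (\<pi> \<circ> p)) (orbit_fun \<circ> (\<pi> \<circ> q))"
    by (rule homotopic_with_compose_continuous_map_left[OF _ continuous_map_orbit_fun]) auto
  then have "homotopic_paths (?c ` X) (?c \<circ> p) (?c \<circ> q)"
    using p q ends by (simp add: homotopic_paths_def pathstart_def pathfinish_def o_def)
  then show "homotopic_paths X p q"
    by (rule covering_space_lift_homotopic_paths[OF covering_orbit_fun, of "?c \<circ> p" "?c \<circ> q" p q, rotated 4])
      (use p q homotopic_paths_imp_path homotopic_paths_imp_subset in \<open>auto simp: path_image_compose pathstart_def
          intro!: path_continuous_image continuous_on_orbit_fun\<close>)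
next
  assume "homotopic_paths X p q"
  then have "homotopic_with (\<lambda>r. r 0 = p 0 \<and> r 1 = p 1) (top_of_set {0..1}) (top_of_set X) p q"
    by (simp add: homotopic_paths_def pathstart_def pathfinish_def)
  then show "homotopic_with (\<lambda>r. r 0 = \<pi> x \<and> r 1 = \<pi> x) (top_of_set {0..1}) (orbit_space W) (\<pi> \<circ> p) (\<pi> \<circ> q)"
    by (rule homotopic_with_compose_continuous_map_left[OF _ continuous_map_orbit_map]) (use p ends in auto)
qed

end

section \<open>Stabilizers of reflecting hyperplanes\<close>

context reflection_group
begin

abbreviation "\<A> \<equiv> reflecting_hyperplanes W"

lemma hyperplane_form:
  assumes "H \<in> \<A>"
  obtains a where "linear_form a" "H = {v. a v = 0}" "\<exists>v. a v = 1" "is_hyperplane H"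
proof -
  obtain s where s: "s \<in> W" "is_reflection s" "H = fixed_space s" using assms by (auto simp: reflecting_hyperplanes_def)
  obtain a u where a: "linear_form a" "\<And>v. s *v v = v + a v *s u" "fixed_space s = {v. a v = 0}" "u \<noteq> 0"
    "is_hyperplane (fixed_space s)"
    using reflection_form[OF s(2)] by metis
  have "\<exists>v. a v \<noteq> 0"
  proof (rule ccontr)
    assume "\<not> (\<exists>v. a v \<noteq> 0)"
    then have "s *v v = mat 1 *v v" for v by (simp add: a(2))
    then have "s = mat 1" by (simp add: matrix_eq)
    then show False using s(2) by (simp add: is_reflection_def)
  qed
  then obtain v where "a v \<noteq> 0" by blast
  then have "a (inverse (a v) *s v) = 1" using a(1) by (simp add: linear_form_simps)
  then show thesis using that[OF a(1)] a(3,5) s(3) by metis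
qed

lemma finite_hyperplanes: "finite \<A>"
  using fin by (simp add: reflecting_hyperplanes_def)

lemma hyperplane_image_mem:
  assumes "g \<in> W" "H \<in> \<A>"
  shows "(*v) g ` H \<in> \<A>"
proof -
  obtain s where s: "s \<in> W" "is_reflection s" "H = fixed_space s" using assms by (auto simp: reflecting_hyperplanes_def)
  have inv: "g ** matrix_inv g = mat 1" "matrix_inv g ** g = mat 1" using matrix_inv_mult[OF invertible[OF assms(1)]] by simp_all
  have "g ** s ** matrix_inv g \<in> W" using assms s by (simp add: mult_mem inv_mem)
  then show ?thesis
    using conjugate_reflection[OF s(2) inv] s(3) unfolding reflecting_hyperplanes_def by blast
qed

definition fixator :: "(complex^'n) set \<Rightarrow> (complex^'n^'n) set" where
  "fixator H = {w \<in> W. \<forall>v\<in>H. w *v v = v}"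

lemma fixator_group:
  "mat 1 \<in> fixator H" "w \<in> fixator H \<Longrightarrow> w' \<in> fixator H \<Longrightarrow> w ** w' \<in> fixator H"
  "w \<in> fixator H \<Longrightarrow> matrix_inv w \<in> fixator H" "fixator H \<subseteq> W"
  by (auto simp: fixator_def one_mem mult_mem inv_mem matrix_vector_mul_assoc[symmetric])
    (metis inv_vec(2))

text \<open>The pointwise stabilizer of a hyperplane acts on the quotient line by scalars, and faithfully: a
  unipotent element \<open>v \<mapsto> v + a v *s u\<close> with \<open>u \<noteq> 0\<close> has infinite orbits.\<close>

lemma fixator_scalar:
  assumes a: "linear_form a" "H = {v. a v = 0}" "a v0 = 1" and w: "w \<in> fixator H"
  shows "a (w *v v) = a (w *v v0) * a v"
proof -
  have "v - a v *s v0 \<in> H" using a by (simp add: linear_form_simps)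
  then have "w *v (v - a v *s v0) = v - a v *s v0" using w by (simp add: fixator_def)
  then have "w *v v = v - a v *s v0 + a v *s (w *v v0)"
    by (simp add: matrix_vector_mult_diff_distrib vector_scalar_commute algebra_simps)
  then show ?thesis using a by (simp add: linear_form_simps)
qed

lemma fixator_faithful:
  assumes a: "linear_form a" "H = {v. a v = 0}" "a v0 = 1" and w: "w \<in> fixator H" "a (w *v v0) = 1"
  shows "w = mat 1"
proof -
  define u where "u = w *v v0 - v0"
  have uH: "u \<in> H" using a w(2) by (simp add: u_def linear_form_simps)
  have orbit: "v0 + of_nat k *s u \<in> \<pi> v0" for k
  proof (induction k)
    case 0
    show ?case using mem_orbit_self by simp
  next
    case (Suc k)
    then obtain z where z: "z \<in> W" "v0 + of_nat k *s u = z *v v0" by (auto simp: orbit_map_eq_image)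
    have "w *v (v0 + of_nat k *s u) = v0 + of_nat (Suc k) *s u"
    proof -
      have "w *v u = u" using w(1) uH by (simp add: fixator_def)
      moreover have "w *v v0 = v0 + u" by (simp add: u_def)
      ultimately show ?thesis
        by (simp add: matrix_vector_right_distrib vector_scalar_commute vector_sadd_rdistrib)
    qed
    then have "v0 + of_nat (Suc k) *s u = (w ** z) *v v0" by (simp add: z(2) matrix_vector_mul_assoc[symmetric])
    then show ?case using w(1) z(1) by (auto simp: orbit_map_eq_image fixator_def mult_mem)
  qed
  have "u = 0"
  proof (rule ccontr)
    assume u: "u \<noteq> 0"
    have inj: "inj (\<lambda>k::nat. v0 + of_nat k *s u)"
      by (rule injI) (use u in \<open>auto simp: vector_mul_rcancel\<close>)
    have "range (\<lambda>k::nat. v0 + of_nat k *s u) \<subseteq> \<pi> v0" using orbit by blast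
    then have "finite (range (\<lambda>k::nat. v0 + of_nat k *s u))" by (rule finite_subset[OF _ finite_orbit])
    from finite_imageD[OF this inj] show False by simp
  qed
  then have wv0: "w *v v0 = v0" by (simp add: u_def)
  have "w *v v = v" for v
  proof -
    have "v - a v *s v0 \<in> H" using a by (simp add: linear_form_simps)
    then have "w *v (v - a v *s v0) = v - a v *s v0" using w by (simp add: fixator_def)
    then show ?thesis by (simp add: matrix_vector_mult_diff_distrib vector_scalar_commute wv0)
  qed
  then show ?thesis by (simp add: matrix_eq)
qed

lemma fixator_eqI:
  assumes a: "linear_form a" "H = {v. a v = 0}" "a v0 = 1" and w: "w \<in> fixator H" "w' \<in> fixator H"
    and eq: "a (w *v v0) = a (w' *v v0)"
  shows "w = w'"
proof -
  let ?z = "matrix_inv w' ** w"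
  have z: "?z \<in> fixator H" using w by (simp add: fixator_group)
  have w'W: "w' \<in> W" using w by (simp add: fixator_def)
  have wz: "w = w' ** ?z" unfolding matrix_mul_assoc matrix_inv_mult(1)[OF invertible[OF w'W]] by simp
  have nz: "a (w' *v v0) \<noteq> 0"
  proof
    assume "a (w' *v v0) = 0"
    then have "a (w' *v (matrix_inv w' *v v0)) = 0"
      unfolding fixator_scalar[OF a w(2), of "matrix_inv w' *v v0"] by (simp only: mult_zero_left)
    then show False using a(3) inv_vec[OF w'W] by simp
  qed
  have "a (w *v v0) = a (w' *v (?z *v v0))" by (subst wz) (simp add: matrix_vector_mul_assoc)
  also have "\<dots> = a (w' *v v0) * a (?z *v v0)" by (rule fixator_scalar[OF a w(2)])
  finally have "a (?z *v v0) = 1" using eq nz by simp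
  then have "?z = mat 1" by (rule fixator_faithful[OF a z])
  then show ?thesis using wz by simp
qed

text \<open>The scalars by which the fixator acts on the quotient by \<open>H\<close> are \<open>m\<close>-th roots of unity, where \<open>m\<close> is
  its order. As the action is faithful, all \<open>m\<close>-th roots of unity occur, and the element with
  scalar \<open>exp (2\<pi>i/m)\<close> is the distinguished reflection along \<open>H\<close>.\<close>

lemma distinguished_reflection_exists:
  assumes H: "H \<in> \<A>" and a: "linear_form a" "H = {v. a v = 0}" "a v0 = 1" and hyp: "is_hyperplane H"
  obtains s where "s \<in> distinguished_reflections W" "s \<in> fixator H" "fixed_space s = H"
proof -
  let ?F = "fixator H" and ?\<chi> = "\<lambda>w. a (w *v v0)"
  have finF: "finite ?F" using fin fixator_group(4) finite_subset by blast
  define m where "m = card ?F"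
  have inj: "inj_on ?\<chi> ?F" by (rule inj_onI) (rule fixator_eqI[OF a])
  have mult: "?\<chi> (w ** w') = ?\<chi> w * ?\<chi> w'" if "w \<in> ?F" for w w'
    using fixator_scalar[OF a that, of "w' *v v0"] by (simp add: matrix_vector_mul_assoc)
  have nz: "?\<chi> w \<noteq> 0" if "w \<in> ?F" for w
  proof
    assume "?\<chi> w = 0"
    then have "?\<chi> (w ** matrix_inv w) = 0" using mult[OF that] by simp
    moreover have "w \<in> W" using that by (simp add: fixator_def)
    then have "w ** matrix_inv w = mat 1" by (intro matrix_inv_mult(1) invertible)
    ultimately show False using a(3) by simp
  qed
  have root: "?\<chi> w ^ m = 1" if w: "w \<in> ?F" for w
  proof -
    have "bij_betw ((**) w) ?F ?F"
    proof (rule bij_betw_byWitness[of _ "(**) (matrix_inv w)"])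
      have "w \<in> W" using w by (simp add: fixator_def)
      then show "\<forall>z\<in>?F. matrix_inv w ** (w ** z) = z" "\<forall>z\<in>?F. w ** (matrix_inv w ** z) = z"
        using matrix_inv_mult[OF invertible] by (simp_all add: matrix_mul_assoc)
    qed (use w fixator_group in auto)
    then have "(\<Prod>z\<in>?F. ?\<chi> (w ** z)) = (\<Prod>z\<in>?F. ?\<chi> z)" by (rule prod.reindex_bij_betw)
    then have "?\<chi> w ^ m * (\<Prod>z\<in>?F. ?\<chi> z) = (\<Prod>z\<in>?F. ?\<chi> z)"
      by (simp add: mult[OF w] prod.distrib m_def)
    moreover have "(\<Prod>z\<in>?F. ?\<chi> z) \<noteq> 0" using nz finF by simp
    ultimately show ?thesis by simp
  qed
  obtain r where r: "r \<in> W" "is_reflection r" "H = fixed_space r" using H by (auto simp: reflecting_hyperplanes_def)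
  have rF: "r \<in> ?F" "r \<noteq> mat 1" using r by (auto simp: fixator_def fixed_space_def is_reflection_def)
  have m: "m \<ge> 2"
  proof -
    have "card {mat 1, r} \<le> m" unfolding m_def using rF fixator_group(1) finF by (intro card_mono) auto
    then show ?thesis using rF(2) by (auto simp: card_insert_if)
  qed
  have roots: "?\<chi> ` ?F = {z. z ^ m = 1}"
  proof (rule card_subset_eq)
    show "finite {z::complex. z ^ m = 1}" using m by (intro finite_roots_unity) simp
    show "?\<chi> ` ?F \<subseteq> {z. z ^ m = 1}" using root by blast
    show "card (?\<chi> ` ?F) = card {z::complex. z ^ m = 1}"
      using m card_image[OF inj] by (simp add: card_roots_unity_eq m_def)
  qed
  define \<zeta> where "\<zeta> = exp (2 * of_real pi * \<i> / of_nat m)"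
  have "\<zeta> ^ m = exp (of_nat m * (2 * of_real pi * \<i> / of_nat m))" by (simp only: \<zeta>_def exp_of_nat_mult)
  also have "\<dots> = exp (2 * of_real pi * \<i>)" using m by simp
  finally have "\<zeta> ^ m = 1" by (simp only: exp_two_pi_i)
  then have "\<zeta> \<in> ?\<chi> ` ?F" unfolding roots by simp
  then obtain s where s: "s \<in> ?F" "?\<chi> s = \<zeta>" by auto
  have \<zeta>1: "\<zeta> \<noteq> 1"
  proof
    assume "\<zeta> = 1"
    have "\<zeta> = cis (2 * pi / real m)" by (simp add: \<zeta>_def cis_conv_exp mult_ac)
    then have "cos (2 * pi / real m) = 1" using \<open>\<zeta> = 1\<close> by (metis cis.simps(1) one_complex.simps(1))
    moreover have "0 < 2 * pi / real m" "2 * pi / real m \<le> pi" using m by (simp_all add: field_simps)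
    then have "cos (2 * pi / real m) < cos 0" by (intro cos_monotone_0_pi) auto
    ultimately show False by simp
  qed
  have sW: "s \<in> W" "s \<noteq> mat 1" using s \<zeta>1 a(3) by (auto simp: fixator_def)
  have refl: "is_reflection s"
    unfolding is_reflection_def using sW s(1) invertible hyp by (auto simp: fixator_def)
  have fs: "fixed_space s = H"
  proof (rule proper_subspace_eq_hyperplane[OF hyp])
    show "vec.subspace (fixed_space s)"
      by (auto simp: vec.subspace_def fixed_space_def matrix_vector_right_distrib vector_scalar_commute)
    show "H \<subseteq> fixed_space s" using s(1) by (auto simp: fixator_def fixed_space_def)
    show "fixed_space s \<noteq> UNIV"
    proof
      assume "fixed_space s = UNIV"
      then have "s *v v = v" for v by (auto simp: fixed_space_def)
      then show False using sW(2) by (simp add: matrix_eq)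
    qed
  qed
  have "c = 1 \<or> c = \<zeta>" if c: "c \<in> matrix_eigenvalues s" for c
  proof -
    obtain v where v: "v \<noteq> 0" "s *v v = c *s v" using c by (auto simp: matrix_eigenvalues_def)
    have "c * a v = \<zeta> * a v" using fixator_scalar[OF a s(1), of v] s(2) v(2) a(1) by (simp add: linear_form_simps)
    moreover have "c = 1" if "a v = 0"
    proof -
      have "s *v v = v" using that s(1) a(2) by (simp add: fixator_def)
      then have "c *s v = 1 *s v" using v(2) by simp
      then show ?thesis using v(1) vector_mul_rcancel[of c v 1] by blast
    qed
    ultimately show ?thesis by auto
  qed
  moreover have "\<zeta> \<in> matrix_eigenvalues s"
  proof -
    define h where "h = s *v v0 - \<zeta> *s v0"
    have "h \<in> H" using a s(2) by (simp add: h_def linear_form_simps)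
    then have sh: "s *v h = h" using s(1) by (simp add: fixator_def)
    have sv0: "s *v v0 = \<zeta> *s v0 + h" by (simp add: h_def)
    let ?v = "(\<zeta> - 1) *s v0 + h"
    have "s *v ?v = \<zeta> *s ?v"
      by (simp add: matrix_vector_right_distrib vector_scalar_commute sv0 sh vec_eq_iff algebra_simps)
    moreover have "?v \<noteq> 0"
    proof
      assume "?v = 0"
      then have "a ?v = 0" using linear_form_simps(4)[OF a(1)] by metis
      moreover have "a ?v = \<zeta> - 1" using a \<open>h \<in> H\<close> by (simp add: linear_form_simps)
      ultimately show False using \<zeta>1 by simp
    qed
    ultimately show ?thesis by (auto simp: matrix_eigenvalues_def)
  qed
  ultimately have "insert 1 (matrix_eigenvalues s) = {1, \<zeta>}" by blast
  then have "s \<in> distinguished_reflections W"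
    using sW refl fs by (simp add: distinguished_reflections_def \<zeta>_def m_def fixator_def)
  then show thesis using that s(1) fs by blast
qed

text \<open>Conjugation by \<open>g\<close> preserves the fixator of \<open>H\<close> and does not change the scalar of an element.\<close>

lemma stabilizer_commutes:
  assumes a: "linear_form a" "H = {v. a v = 0}" "a v0 = 1" and g: "g \<in> W" "(*v) g ` H = H" and s: "s \<in> fixator H"
  shows "g ** s ** matrix_inv g = s"
proof (rule fixator_eqI[OF a _ s])
  have gi: "matrix_inv g *v v \<in> H" if "v \<in> H" for v
  proof -
    have "v \<in> (*v) g ` H" using that g(2) by simp
    then show ?thesis using inv_vec[OF g(1)] by auto
  qed
  show t: "g ** s ** matrix_inv g \<in> fixator H"
    using s g(1) gi by (auto simp: fixator_def mult_mem inv_mem inv_vec simp flip: matrix_vector_mul_assoc)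
  let ?t = "g ** s ** matrix_inv g"
  have ag: "a (g *v v) = a (g *v v0) * a v" for v
  proof -
    have "v - a v *s v0 \<in> H" using a by (simp add: linear_form_simps)
    then have "g *v (v - a v *s v0) \<in> H" using g(2) by blast
    then have "a (g *v v - a v *s (g *v v0)) = 0" using a(2) by (simp add: matrix_vector_mult_diff_distrib vector_scalar_commute)
    then show ?thesis by (simp add: linear_form_simps[OF a(1)])
  qed
  have nz: "a (g *v v0) \<noteq> 0"
  proof
    assume "a (g *v v0) = 0"
    then have "a (g *v (matrix_inv g *v v0)) = 0"
      unfolding ag[of "matrix_inv g *v v0"] by (simp only: mult_zero_left)
    then show False using a(3) inv_vec[OF g(1)] by simp
  qed
  have "?t *v (g *v v0) = g *v (s *v v0)" by (simp add: inv_vec[OF g(1)] flip: matrix_vector_mul_assoc)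
  then have "a (?t *v (g *v v0)) = a (g *v (s *v v0))" by (rule arg_cong)
  then have "a (?t *v v0) * a (g *v v0) = a (g *v v0) * a (s *v v0)"
    by (simp only: fixator_scalar[OF a t, of "g *v v0"] ag[of "s *v v0"])
  then have "a (g *v v0) * a (?t *v v0) = a (g *v v0) * a (s *v v0)" by (simp only: mult.commute)
  then show "a (?t *v v0) = a (s *v v0)" by (simp only: mult_cancel_left nz simp_thms)
qed

text \<open>A stabilizing element commutes with the distinguished reflection along the hyperplane, and only the
  identity does so by hypothesis.\<close>

theorem free_on_hyperplanes:
  assumes "acts_freely_by_conjugation G (distinguished_reflections W)" "G \<subseteq> W" "g \<in> G" "H \<in> \<A>" "(*v) g ` H = H"
  shows "g = mat 1"
proof -
  obtain a where a: "linear_form a" "H = {v. a v = 0}" "\<exists>v. a v = 1" "is_hyperplane H"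
    by (rule hyperplane_form[OF assms(4)])
  then obtain v0 where v0: "a v0 = 1" by blast
  obtain s where s: "s \<in> distinguished_reflections W" "s \<in> fixator H"
    by (rule distinguished_reflection_exists[OF assms(4) a(1,2) v0 a(4)])
  have "g ** s ** matrix_inv g = s"
    using assms by (intro stabilizer_commutes[OF a(1,2) v0 _ _ s(2)]) auto
  then show ?thesis using assms(1,3) s(1) by (auto simp: acts_freely_by_conjugation_def)
qed

end

section \<open>Forms permuted by a freely acting group\<close>

lemma (in finite_matrix_group) finite_matrix_group_subgroup:
  assumes "subgroup G (matrix_group W)"
  shows "finite_matrix_group G"
proof (rule finite_matrix_group.intro)
  show "subgroup G general_linear"
    by (rule group.incl_subgroup[OF group_general_linear sub assms])
  show "finite G" using subgroup.subset[OF assms] fin finite_subset by auto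
qed

context reflection_group
begin

text \<open>A form is chosen for one representative in each orbit of hyperplanes and transported along the
  orbit by group elements. Freeness makes the transporting element \<open>tr H\<close> unique, so that it is
  compatible with the action of \<open>G\<close>.\<close>

lemma equivariant_forms:
  assumes G: "subgroup G (matrix_group W)"
    and free: "acts_freely_by_conjugation G (distinguished_reflections W)"
  shows "\<exists>a. (\<forall>H\<in>\<A>. linear_form (a H) \<and> H = {v. a H v = 0} \<and> (\<exists>v. a H v \<noteq> 0)) \<and>
    (\<forall>g\<in>G. \<forall>H\<in>\<A>. \<forall>v. a ((*v) g ` H) (g *v v) = a H v)"
proof -
  interpret G: finite_matrix_group G by (rule finite_matrix_group_subgroup[OF G])
  have GW: "G \<subseteq> W" using subgroup.subset[OF G] by simp
  have "\<forall>H\<in>\<A>. \<exists>a. linear_form a \<and> H = {v. a v = 0} \<and> (\<exists>v. a v = 1)"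
    using hyperplane_form by metis
  from bchoice[OF this] obtain a0 where a0: "\<And>H. H \<in> \<A> \<Longrightarrow> linear_form (a0 H) \<and> H = {v. a0 H v = 0} \<and> (\<exists>v. a0 H v = 1)"
    by blast
  \<comment> \<open>A representative \<open>rep H\<close> of the orbit of \<open>H\<close> and an element \<open>tr H\<close> that carries it to \<open>H\<close>.\<close>
  define orb where "orb H = (\<lambda>g. (*v) g ` H) ` G" for H :: "(complex^'n) set"
  define rep where "rep H = (SOME K. K \<in> orb H)" for H :: "(complex^'n) set"
  define tr where "tr H = (SOME g. g \<in> G \<and> (*v) g ` rep H = H)" for H :: "(complex^'n) set"
  have comp: "(*v) g ` (*v) h ` H = (*v) (g ** h) ` H" for g h :: "complex^'n^'n" and H
    by (simp add: image_image matrix_vector_mul_assoc)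
  have inv_image: "(*v) (matrix_inv g) ` (*v) g ` H = H" if "g \<in> G" for g H
    unfolding comp using matrix_inv_mult(2)[OF G.invertible[OF that]] by simp
  have rep: "rep H \<in> orb H" for H
  proof -
    have "H \<in> orb H" unfolding orb_def by (rule image_eqI[of _ _ "mat 1"]) (simp_all add: G.one_mem)
    then show ?thesis unfolding rep_def by (rule someI)
  qed
  have tr: "tr H \<in> G \<and> (*v) (tr H) ` rep H = H" for H
  proof -
    obtain g where g: "g \<in> G" "rep H = (*v) g ` H" using rep[of H] by (auto simp: orb_def)
    then have "matrix_inv g \<in> G \<and> (*v) (matrix_inv g) ` rep H = H" by (simp add: G.inv_mem inv_image)
    then show ?thesis unfolding tr_def by (rule someI)
  qed
  have rep_A: "rep H \<in> \<A>" if "H \<in> \<A>" for H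
    using rep[of H] hyperplane_image_mem that GW by (auto simp: orb_def)
  have rep_eq: "rep ((*v) g ` H) = rep H" if "g \<in> G" for g H
  proof -
    have "orb ((*v) g ` H) = (\<lambda>h. (*v) h ` H) ` (\<lambda>h. h ** g) ` G"
      unfolding orb_def comp image_image[of _ "\<lambda>h. h ** g"] ..
    moreover have "(\<lambda>h. h ** g) ` G = G" using G.bij_mult_right[OF that] by (simp add: bij_betw_def)
    ultimately have "orb ((*v) g ` H) = orb H" by (simp only: orb_def)
    then show ?thesis by (simp only: rep_def)
  qed
  have tr_eq: "tr ((*v) g ` H) = g ** tr H" if "g \<in> G" "H \<in> \<A>" for g H
  proof -
    let ?h = "matrix_inv (g ** tr H) ** tr ((*v) g ` H)"
    have m: "g ** tr H \<in> G" using that(1) tr G.mult_mem by blast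
    have "(*v) (g ** tr H) ` rep H = (*v) g ` (*v) (tr H) ` rep H" by (rule comp[symmetric])
    also have "\<dots> = (*v) g ` H" using tr[of H] by simp
    also have "\<dots> = (*v) (tr ((*v) g ` H)) ` rep H" using tr[of "(*v) g ` H"] rep_eq[OF that(1), of H] by simp
    finally have e: "(*v) (g ** tr H) ` rep H = (*v) (tr ((*v) g ` H)) ` rep H" .
    have "(*v) ?h ` rep H = (*v) (matrix_inv (g ** tr H)) ` (*v) (tr ((*v) g ` H)) ` rep H" by (rule comp[symmetric])
    also have "\<dots> = rep H" unfolding e[symmetric] by (rule inv_image[OF m])
    finally have "(*v) ?h ` rep H = rep H" .
    moreover have "?h \<in> G" by (rule G.mult_mem[OF G.inv_mem[OF m] conjunct1[OF tr]])
    ultimately have "?h = mat 1" using free_on_hyperplanes[OF free GW _ rep_A[OF that(2)]] by blast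
    then have "(g ** tr H) ** ?h = g ** tr H" by simp
    then show ?thesis using matrix_inv_mult(1)[OF G.invertible[OF m]] by (simp add: matrix_mul_assoc)
  qed
  define a where "a H v = a0 (rep H) (matrix_inv (tr H) *v v)" for H v
  have "linear_form (a H) \<and> H = {v. a H v = 0} \<and> (\<exists>v. a H v \<noteq> 0)" if "H \<in> \<A>" for H
  proof (intro conjI)
    note r = a0[OF rep_A[OF that]]
    show "linear_form (a H)" unfolding a_def using r by (intro linear_form_matrix) blast
    show "H = {v. a H v = 0}"
    proof (intro Set.set_eqI)
      fix v
      have "a H v = 0 \<longleftrightarrow> matrix_inv (tr H) *v v \<in> rep H" unfolding a_def using r by blast
      also have "\<dots> \<longleftrightarrow> v \<in> (*v) (tr H) ` rep H"
      proof
        assume "matrix_inv (tr H) *v v \<in> rep H"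
        then have "tr H *v (matrix_inv (tr H) *v v) \<in> (*v) (tr H) ` rep H" by (rule imageI)
        then show "v \<in> (*v) (tr H) ` rep H" by (simp only: G.inv_vec[OF conjunct1[OF tr]])
      next
        assume "v \<in> (*v) (tr H) ` rep H"
        then obtain u where "u \<in> rep H" "v = tr H *v u" by (elim imageE)
        then show "matrix_inv (tr H) *v v \<in> rep H" by (simp only: G.inv_vec[OF conjunct1[OF tr]])
      qed
      also have "\<dots> \<longleftrightarrow> v \<in> H" using tr[of H] by simp
      finally show "v \<in> H \<longleftrightarrow> v \<in> {v. a H v = 0}" by simp
    qed
    obtain v where "a0 (rep H) v = 1" using r by blast
    then have "a H (tr H *v v) \<noteq> 0" using G.inv_vec[of "tr H"] tr[of H] by (simp add: a_def)
    then show "\<exists>v. a H v \<noteq> 0" by blast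
  qed
  moreover have "a ((*v) g ` H) (g *v v) = a H v" if "g \<in> G" "H \<in> \<A>" for g H v
  proof -
    have m: "g ** tr H \<in> G" using that(1) tr G.mult_mem by blast
    have "matrix_inv (g ** tr H) *v (g *v v) = matrix_inv (g ** tr H) *v ((g ** tr H) *v (matrix_inv (tr H) *v v))"
      using G.inv_vec[of "tr H"] tr[of H] by (simp flip: matrix_vector_mul_assoc)
    also have "\<dots> = matrix_inv (tr H) *v v" by (rule G.inv_vec(2)[OF m])
    finally show ?thesis by (simp add: a_def rep_eq[OF that(1)] tr_eq[OF that])
  qed
  ultimately show ?thesis by blast
qed

lemma arrangement_of_forms:
  assumes "\<forall>H\<in>\<A>. linear_form (a H) \<and> H = {v. a H v = 0} \<and> (\<exists>v. a H v \<noteq> 0)"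
  shows "arrangement \<A> a" "arrangement.compl \<A> a = X"
proof -
  show *: "arrangement \<A> a"
    by (rule arrangement.intro) (use finite_hyperplanes assms in \<open>metis+\<close>)
  show "arrangement.compl \<A> a = X"
    unfolding arrangement.compl_def[OF *] hyperplane_complement_def using assms by blast
qed

section \<open>Braids as classes of paths in the complement\<close>

text \<open>Paths in the complement that cover the loops in the orbit space which represent the braids
  above \<open>w\<close>.\<close>

definition lift_path :: "complex^'n \<Rightarrow> complex^'n^'n \<Rightarrow> (real \<Rightarrow> complex^'n) \<Rightarrow> bool" where
  "lift_path x w p \<longleftrightarrow> w \<in> W \<and> path p \<and> path_image p \<subseteq> X \<and> pathstart p = x \<and> pathfinish p = w *v x"

definition braid :: "complex^'n \<Rightarrow> (real \<Rightarrow> complex^'n) \<Rightarrow> (real \<Rightarrow> (complex^'n) set) set" where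
  "braid x p = loop_class (orbit_space W) (\<pi> x) (\<pi> \<circ> p)"

lemma lift_path_01: "lift_path x w p \<Longrightarrow> p 0 = x" "lift_path x w p \<Longrightarrow> p 1 = w *v x"
  by (simp_all add: lift_path_def pathstart_def pathfinish_def)

lemma lift_path_loop:
  assumes "lift_path x w p"
  shows "\<pi> \<circ> p \<in> loops_at (orbit_space W) (\<pi> x)"
proof -
  have "continuous_map (top_of_set {0..1}) (top_of_set X) p"
    using assms by (auto simp: lift_path_def path_def path_image_def)
  then have "pathin (orbit_space W) (\<pi> \<circ> p)"
    unfolding pathin_def by (rule continuous_map_compose[OF _ continuous_map_orbit_map])
  then show ?thesis
    using lift_path_01[OF assms] assms by (simp add: loops_at_def lift_path_def orbit_map_invariant)
qed

lemma braid_carrier_iff: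
  assumes x: "x \<in> X"
  shows "c \<in> carrier (braid_group W x) \<longleftrightarrow> (\<exists>w p. lift_path x w p \<and> c = braid x p)"
proof
  assume "c \<in> carrier (braid_group W x)"
  then obtain q where q: "q \<in> loops_at (orbit_space W) (\<pi> x)" "c = loop_class (orbit_space W) (\<pi> x) q"
    by (auto simp: braid_group_def fundamental_group_carrier_iff)
  then have q': "pathin (orbit_space W) q" "q 0 = \<pi> x" "q 1 = \<pi> x" by (auto simp: loops_at_def)
  obtain p where p: "path p" "path_image p \<subseteq> X" "p 0 = x" "\<And>t. t \<in> {0..1} \<Longrightarrow> \<pi> (p t) = q t"
    using orbit_path_lift[OF q'(1,2) x] by metis
  have "p 1 \<in> \<pi> x" using p(4)[of 1] q'(3) mem_orbit_self[of "p 1"] by simp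
  then obtain w where w: "w \<in> W" "p 1 = w *v x" by (auto simp: orbit_map_eq_image)
  have lift: "lift_path x w p" using p w by (simp add: lift_path_def pathstart_def pathfinish_def)
  have "c = braid x p"
    unfolding q(2) braid_def
    by (rule loop_class_eqI[OF q'(1), of "\<lambda>t. t" "\<lambda>t. t"])
      (use q q' p lift_path_loop[OF lift] in \<open>auto simp: continuous_on_id\<close>)
  then show "\<exists>w p. lift_path x w p \<and> c = braid x p" using lift by blast
next
  assume "\<exists>w p. lift_path x w p \<and> c = braid x p"
  then show "c \<in> carrier (braid_group W x)"
    using lift_path_loop by (auto simp: braid_group_def fundamental_group_carrier_iff braid_def)
qed

text \<open>Lifting along the covering turns the equality of braids into a statement about paths in \<open>X\<close>.\<close>

lemma braid_eq_iff:
  assumes "lift_path x w p" "lift_path x w' p'"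
  shows "braid x p = braid x p' \<longleftrightarrow> homotopic_paths X p p'"
proof -
  have "braid x p = braid x p' \<longleftrightarrow> homotopic_with (\<lambda>r. r 0 = \<pi> x \<and> r 1 = \<pi> x) (top_of_set {0..1}) (orbit_space W) (\<pi> \<circ> p) (\<pi> \<circ> p')"
    unfolding braid_def using loop_class_eq_iff[OF lift_path_loop[OF assms(1)] lift_path_loop[OF assms(2)]]
      lift_path_loop[OF assms(1)] lift_path_loop[OF assms(2)] by (simp add: loop_homotopy_rel_def)
  also have "\<dots> \<longleftrightarrow> homotopic_paths X p p'"
    using assms lift_path_01[OF assms(1)] lift_path_01[OF assms(2)]
    by (intro homotopic_orbit_paths_iff) (simp_all add: lift_path_def orbit_map_invariant)
  finally show ?thesis .
qed

lemma translate_path: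
  assumes "w \<in> W" "path p" "path_image p \<subseteq> X"
  shows "path ((*v) w \<circ> p)" "path_image ((*v) w \<circ> p) \<subseteq> X"
  using assms X_invariant
  by (auto simp: path_image_compose intro!: path_continuous_image matrix_vector_mult_linear_continuous_on)

lemma braid_mult:
  assumes p: "lift_path x w p" and q: "lift_path x w' q"
  shows "lift_path x (w ** w') (p +++ ((*v) w \<circ> q))"
    "braid x p \<otimes>\<^bsub>braid_group W x\<^esub> braid x q = braid x (p +++ ((*v) w \<circ> q))"
proof -
  have w: "w \<in> W" using p by (simp add: lift_path_def)
  show "lift_path x (w ** w') (p +++ ((*v) w \<circ> q))"
    using p q translate_path[OF w, of q]
    by (auto simp: lift_path_def path_image_join pathstart_compose pathfinish_compose mult_mem matrix_vector_mul_assoc)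
  have "\<pi> \<circ> (p +++ ((*v) w \<circ> q)) = path_join (\<pi> \<circ> p) (\<pi> \<circ> q)"
    by (simp add: fun_eq_iff joinpaths_def path_join_def orbit_map_invariant[OF w])
  then show "braid x p \<otimes>\<^bsub>braid_group W x\<^esub> braid x q = braid x (p +++ ((*v) w \<circ> q))"
    unfolding braid_def braid_group_def
    using fundamental_group_mult[OF lift_path_loop[OF p] lift_path_loop[OF q]] by simp
qed

lemma group_braid_group:
  assumes "x \<in> X"
  shows "group (braid_group W x)"
  unfolding braid_group_def using assms by (intro group_fundamental_group) (simp add: topspace_orbit_space)

lemma const_lift: "x \<in> X \<Longrightarrow> lift_path x (mat 1) (linepath x x)"
  by (simp add: lift_path_def one_mem)

lemma braid_one: "\<one>\<^bsub>braid_group W x\<^esub> = braid x (linepath x x)"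
  by (simp add: braid_group_def fundamental_group_def braid_def linepath_refl o_def)

lemma braid_inv:
  assumes x: "x \<in> X" and p: "lift_path x w p"
  shows "lift_path x (matrix_inv w) ((*v) (matrix_inv w) \<circ> reversepath p)"
    "inv\<^bsub>braid_group W x\<^esub> (braid x p) = braid x ((*v) (matrix_inv w) \<circ> reversepath p)"
proof -
  interpret B: group "braid_group W x" by (rule group_braid_group[OF x])
  have w: "w \<in> W" "path p" "path_image p \<subseteq> X" using p by (simp_all add: lift_path_def)
  show q: "lift_path x (matrix_inv w) ((*v) (matrix_inv w) \<circ> reversepath p)"
    using p translate_path[OF inv_mem[OF w(1)], of "reversepath p"]
    by (simp add: lift_path_def inv_mem pathstart_compose pathfinish_compose inv_vec)
  have "(*v) w \<circ> ((*v) (matrix_inv w) \<circ> reversepath p) = reversepath p"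
    using inv_vec[OF w(1)] by (simp add: fun_eq_iff)
  note rev = this
  have lift: "lift_path x (w ** matrix_inv w) (p +++ reversepath p)" using braid_mult(1)[OF p q] rev by simp
  from rev have "braid x p \<otimes>\<^bsub>braid_group W x\<^esub> braid x ((*v) (matrix_inv w) \<circ> reversepath p) = braid x (p +++ reversepath p)"
    using braid_mult(2)[OF p q] by simp
  also have "braid x (p +++ reversepath p) = \<one>\<^bsub>braid_group W x\<^esub>"
    unfolding braid_one braid_eq_iff[OF lift const_lift[OF x]]
    using homotopic_paths_rinv[OF w(2,3)] p by (simp add: lift_path_def)
  finally have one: "braid x p \<otimes>\<^bsub>braid_group W x\<^esub> braid x ((*v) (matrix_inv w) \<circ> reversepath p) = \<one>\<^bsub>braid_group W x\<^esub>" .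
  have c: "braid x p \<in> carrier (braid_group W x)" "braid x ((*v) (matrix_inv w) \<circ> reversepath p) \<in> carrier (braid_group W x)"
    using p q braid_carrier_iff[OF x] by blast+
  show "inv\<^bsub>braid_group W x\<^esub> (braid x p) = braid x ((*v) (matrix_inv w) \<circ> reversepath p)"
    by (rule B.inv_equality[OF B.inv_comm[OF one c] c])
qed

lemma braid_projection_braid:
  assumes x: "x \<in> X" and p: "lift_path x w p"
  shows "braid_projection W x (braid x p) = w"
  unfolding braid_projection_def
proof (rule the_equality)
  have pin: "pathin (top_of_set X) q \<longleftrightarrow> path q \<and> path_image q \<subseteq> X" for q
    by (auto simp: pathin_def path_def path_image_def)
  have self: "q \<in> loops_at (orbit_space W) (\<pi> x) \<Longrightarrow> q \<in> loop_class (orbit_space W) (\<pi> x) q" for q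
    using equiv_class_self[OF equiv_loop_homotopy_rel] by metis
  show "w \<in> W \<and> (\<exists>p'. pathin (top_of_set X) p' \<and> p' 0 = x \<and> p' 1 = w *v x \<and> \<pi> \<circ> p' \<in> braid x p)"
    using p lift_path_01[OF p] self[OF lift_path_loop[OF p]] pin[of p] by (auto simp: lift_path_def braid_def)
  fix w' assume "w' \<in> W \<and> (\<exists>p'. pathin (top_of_set X) p' \<and> p' 0 = x \<and> p' 1 = w' *v x \<and> \<pi> \<circ> p' \<in> braid x p)"
  then obtain p' where p': "w' \<in> W" "path p'" "path_image p' \<subseteq> X" "p' 0 = x" "p' 1 = w' *v x" "\<pi> \<circ> p' \<in> braid x p"
    using pin by auto
  then have l: "lift_path x w' p'" by (simp add: lift_path_def pathstart_def pathfinish_def)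
  have "(\<pi> \<circ> p, \<pi> \<circ> p') \<in> loop_homotopy_rel (orbit_space W) (\<pi> x)" using p'(6) by (simp add: braid_def)
  then have "braid x p = braid x p'"
    unfolding braid_def by (rule equiv_class_eq[OF equiv_loop_homotopy_rel])
  then have "homotopic_paths X p p'" using braid_eq_iff[OF p l] by simp
  then have "w *v x = w' *v x" using homotopic_paths_imp_pathfinish p l by (metis lift_path_def)
  then show "w' = w" using free_action_eq[OF x p'(1), of w] p by (simp add: lift_path_def)
qed

lemma braid_projection_hom:
  assumes x: "x \<in> X"
  shows "group_hom (braid_group W x) (matrix_group W) (braid_projection W x)"
proof (rule group_hom.intro[OF group_braid_group[OF x]])
  show "group (matrix_group W)" by (rule subgroup.subgroup_is_group[OF sub group_general_linear])
  have "braid_projection W x c \<in> W" if c: "c \<in> carrier (braid_group W x)" for c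
  proof -
    obtain w p where p: "lift_path x w p" "c = braid x p" using c braid_carrier_iff[OF x] by blast
    then show ?thesis using braid_projection_braid[OF x p(1)] by (simp add: lift_path_def)
  qed
  moreover have "braid_projection W x (c \<otimes>\<^bsub>braid_group W x\<^esub> d) = braid_projection W x c ** braid_projection W x d"
    if c: "c \<in> carrier (braid_group W x)" and d: "d \<in> carrier (braid_group W x)" for c d
  proof -
    obtain w p where p: "lift_path x w p" "c = braid x p" using c braid_carrier_iff[OF x] by blast
    obtain w' q where q: "lift_path x w' q" "d = braid x q" using d braid_carrier_iff[OF x] by blast
    show ?thesis
      unfolding p(2) q(2) braid_mult(2)[OF p(1) q(1)]
        braid_projection_braid[OF x braid_mult(1)[OF p(1) q(1)]] braid_projection_braid[OF x p(1)] braid_projection_braid[OF x q(1)] ..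
  qed
  ultimately show "group_hom_axioms (braid_group W x) (matrix_group W) (braid_projection W x)"
    by (auto simp: group_hom_axioms_def hom_def general_linear_def)
qed

lemma pure_loop_iff: "p \<in> loops_at (top_of_set X) x \<longleftrightarrow> lift_path x (mat 1) p"
  by (auto simp: loops_at_top_of_set lift_path_def one_mem)

lemma pure_braid_inclusion_class:
  assumes p: "lift_path x (mat 1) p"
  shows "pure_braid_inclusion W x (loop_class (top_of_set X) x p) = braid x p"
proof -
  have "loop_class (orbit_space W) (\<pi> x) (\<pi> \<circ> q) = braid x p" if q: "(p, q) \<in> loop_homotopy_rel (top_of_set X) x" for q
  proof -
    have ql: "q \<in> loops_at (top_of_set X) x" "p \<in> loops_at (top_of_set X) x" using q by (simp_all add: loop_homotopy_rel_def)
    then have "homotopic_paths X p q" using q loop_homotopy_rel_top_of_set by blast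
    then have "braid x p = braid x q" using braid_eq_iff[OF p, of "mat 1" q] ql(1) by (simp add: pure_loop_iff)
    then show ?thesis by (simp add: braid_def)
  qed
  moreover have "(p, p) \<in> loop_homotopy_rel (top_of_set X) x"
    using p homotopic_paths_refl[of X p] by (subst loop_homotopy_rel_top_of_set) (auto simp: pure_loop_iff lift_path_def)
  ultimately show ?thesis
    unfolding pure_braid_inclusion_def fundamental_group_map_def by blast
qed

lemma pure_braid_carrier_iff:
  "c \<in> carrier (pure_braid_group W x) \<longleftrightarrow> (\<exists>p. lift_path x (mat 1) p \<and> c = loop_class (top_of_set X) x p)"
  by (auto simp: pure_braid_group_def fundamental_group_carrier_iff pure_loop_iff)

lemma pure_braid_mult:
  assumes "lift_path x (mat 1) p" "lift_path x (mat 1) q"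
  shows "loop_class (top_of_set X) x p \<otimes>\<^bsub>pure_braid_group W x\<^esub> loop_class (top_of_set X) x q = loop_class (top_of_set X) x (p +++ q)"
    "lift_path x (mat 1) (p +++ q)"
  using assms fundamental_group_mult[of p "top_of_set X" x q]
  by (auto simp: pure_braid_group_def pure_loop_iff path_join_eq_joinpaths lift_path_def path_image_join)

lemma pure_braid_inclusion_hom:
  assumes x: "x \<in> X"
  shows "group_hom (pure_braid_group W x) (braid_group W x) (pure_braid_inclusion W x)"
proof (rule group_hom.intro[OF _ group_braid_group[OF x]])
  show "group (pure_braid_group W x)" unfolding pure_braid_group_def using x by (intro group_fundamental_group) simp
  have "pure_braid_inclusion W x c \<in> carrier (braid_group W x)" if c: "c \<in> carrier (pure_braid_group W x)" for c
  proof -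
    obtain p where p: "lift_path x (mat 1) p" "c = loop_class (top_of_set X) x p" using c by (auto simp: pure_braid_carrier_iff)
    show ?thesis unfolding p(2) pure_braid_inclusion_class[OF p(1)] braid_carrier_iff[OF x] using p(1) by blast
  qed
  moreover have "pure_braid_inclusion W x (c \<otimes>\<^bsub>pure_braid_group W x\<^esub> d) =
      pure_braid_inclusion W x c \<otimes>\<^bsub>braid_group W x\<^esub> pure_braid_inclusion W x d"
    if c: "c \<in> carrier (pure_braid_group W x)" and d: "d \<in> carrier (pure_braid_group W x)" for c d
  proof -
    obtain p where p: "lift_path x (mat 1) p" "c = loop_class (top_of_set X) x p" using c by (auto simp: pure_braid_carrier_iff)
    obtain q where q: "lift_path x (mat 1) q" "d = loop_class (top_of_set X) x q" using d by (auto simp: pure_braid_carrier_iff)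
    have "(*v) (mat 1) \<circ> q = q" by (simp add: fun_eq_iff)
    then have "braid x p \<otimes>\<^bsub>braid_group W x\<^esub> braid x q = braid x (p +++ q)" using braid_mult(2)[OF p(1) q(1)] by simp
    then show ?thesis
      unfolding p(2) q(2) pure_braid_mult(1)[OF p(1) q(1)] pure_braid_inclusion_class[OF pure_braid_mult(2)[OF p(1) q(1)]]
        pure_braid_inclusion_class[OF p(1)] pure_braid_inclusion_class[OF q(1)] by simp
  qed
  ultimately show "group_hom_axioms (pure_braid_group W x) (braid_group W x) (pure_braid_inclusion W x)"
    by (auto simp: group_hom_axioms_def hom_def)
qed

lemma pure_braids_eq_kernel:
  assumes x: "x \<in> X"
  shows "pure_braid_inclusion W x ` carrier (pure_braid_group W x) = kernel (braid_group W x) (matrix_group W) (braid_projection W x)"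
proof (intro Set.set_eqI iffI)
  fix c assume "c \<in> pure_braid_inclusion W x ` carrier (pure_braid_group W x)"
  then obtain p where p: "lift_path x (mat 1) p" "c = braid x p" using pure_braid_inclusion_class by (auto simp: pure_braid_carrier_iff)
  then show "c \<in> kernel (braid_group W x) (matrix_group W) (braid_projection W x)"
    using braid_projection_braid[OF x p(1)] braid_carrier_iff[OF x] by (auto simp: kernel_def general_linear_def)
next
  fix c assume "c \<in> kernel (braid_group W x) (matrix_group W) (braid_projection W x)"
  then have c: "c \<in> carrier (braid_group W x)" "braid_projection W x c = mat 1" by (auto simp: kernel_def general_linear_def)
  then obtain w p where p: "lift_path x w p" "c = braid x p" using braid_carrier_iff[OF x] by blast
  then have "w = mat 1" using braid_projection_braid[OF x p(1)] c(2) by simp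
  then have "c = pure_braid_inclusion W x (loop_class (top_of_set X) x p)" "loop_class (top_of_set X) x p \<in> carrier (pure_braid_group W x)"
    using pure_braid_inclusion_class p by (auto simp: pure_braid_carrier_iff)
  then show "c \<in> pure_braid_inclusion W x ` carrier (pure_braid_group W x)" by blast
qed

text \<open>The pure braids form the kernel of the projection to \<open>W\<close>, and the derived subgroup of a normal
  subgroup is normal.\<close>

lemma pure_braid_commutators_normal:
  assumes x: "x \<in> X"
  shows "pure_braid_commutators W x \<lhd> braid_group W x"
proof -
  interpret i: group_hom "pure_braid_group W x" "braid_group W x" "pure_braid_inclusion W x" by (rule pure_braid_inclusion_hom[OF x])
  interpret q: group_hom "braid_group W x" "matrix_group W" "braid_projection W x" by (rule braid_projection_hom[OF x])
  have "pure_braid_commutators W x = derived (braid_group W x) (kernel (braid_group W x) (matrix_group W) (braid_projection W x))"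
    unfolding pure_braid_commutators_def using i.derived_img[of "carrier (pure_braid_group W x)"] pure_braids_eq_kernel[OF x] by simp
  then show ?thesis using group.derived_is_normal[OF group_braid_group[OF x] q.normal_kernel] by simp
qed

end

section \<open>Calibrated braids\<close>

text \<open>If a subgroup \<open>E\<close> meets the kernel of \<open>h\<close> in elements of \<open>N\<close> only, then modulo \<open>N\<close> nothing of \<open>E\<close> is
  lost by \<open>h\<close>.\<close>

lemma (in group_hom) iso_onto_image_mod_normal:
  assumes N: "N \<lhd> G" and NK: "N \<subseteq> kernel G H h" and E: "subgroup E G" and EK: "E \<inter> kernel G H h \<subseteq> N"
  shows "subgroup ((#>) N ` E) (G Mod N)"
    and "(\<lambda>c. the_elem (h ` c)) \<in> iso ((G Mod N)\<lparr>carrier := (#>) N ` E\<rparr>) (H\<lparr>carrier := h ` E\<rparr>)"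
proof -
  interpret N: normal N G by (rule N)
  interpret r: group_hom G "G Mod N" "(#>) N"
    by (intro group_hom.intro group_hom_axioms.intro N.factorgroup_is_group N.r_coset_hom_Mod G.group_axioms)
  show "subgroup ((#>) N ` E) (G Mod N)" by (rule r.subgroup_img_is_subgroup[OF E])
  have EG: "e \<in> carrier G" if "e \<in> E" for e using subgroup.mem_carrier[OF E that] .
  have on_coset: "the_elem (h ` (N #> e)) = h e" if e: "e \<in> E" for e
  proof -
    have "h (n \<otimes> e) = h e" if "n \<in> N" for n
    proof -
      have "n \<in> carrier G" "h n = \<one>\<^bsub>H\<^esub>" using NK that by (auto simp: kernel_def)
      then show ?thesis using EG[OF e] by simp
    qed
    moreover have "\<one> \<otimes> e \<in> N #> e" using N.one_closed by (auto simp: r_coset_def)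
    ultimately have "h ` (N #> e) = {h e}" using EG[OF e] by (auto simp: r_coset_def image_iff)
    then show ?thesis by simp
  qed
  have cosets_eq: "N #> e = N #> e'" if e: "e \<in> E" "e' \<in> E" and eq: "h e = h e'" for e e'
  proof -
    have "e \<otimes> inv e' \<in> E" using E e by (simp add: subgroup.m_closed subgroup.m_inv_closed)
    moreover have "h (e \<otimes> inv e') = \<one>\<^bsub>H\<^esub>" using EG e eq by simp
    ultimately have "e \<otimes> inv e' \<in> N" using EK EG e by (auto simp: kernel_def)
    then have "e \<otimes> inv e' \<otimes> e' \<in> N #> e'" by (auto simp: r_coset_def)
    then have "e \<in> N #> e'" using EG e by (simp add: G.m_assoc)
    then show ?thesis using G.repr_independence[OF _ EG[OF e(2)] N.subgroup_axioms] by simp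
  qed
  show "(\<lambda>c. the_elem (h ` c)) \<in> iso ((G Mod N)\<lparr>carrier := (#>) N ` E\<rparr>) (H\<lparr>carrier := h ` E\<rparr>)"
  proof (rule isoI)
    show "(\<lambda>c. the_elem (h ` c)) \<in> hom ((G Mod N)\<lparr>carrier := (#>) N ` E\<rparr>) (H\<lparr>carrier := h ` E\<rparr>)"
    proof (rule homI)
      fix c assume "c \<in> carrier ((G Mod N)\<lparr>carrier := (#>) N ` E\<rparr>)"
      then show "the_elem (h ` c) \<in> carrier (H\<lparr>carrier := h ` E\<rparr>)" using on_coset by auto
    next
      fix c d
      assume "c \<in> carrier ((G Mod N)\<lparr>carrier := (#>) N ` E\<rparr>)" "d \<in> carrier ((G Mod N)\<lparr>carrier := (#>) N ` E\<rparr>)"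
      then have "c \<in> (#>) N ` E" "d \<in> (#>) N ` E" by simp_all
      then obtain e f where e: "e \<in> E" "c = N #> e" and f: "f \<in> E" "d = N #> f" by (elim imageE)
      have "c <#> d = N #> (e \<otimes> f)" unfolding e(2) f(2) by (rule N.rcos_sum[OF EG[OF e(1)] EG[OF f(1)]])
      moreover have "e \<otimes> f \<in> E" using E e f by (simp add: subgroup.m_closed)
      ultimately have "the_elem (h ` (c <#> d)) = h (e \<otimes> f)" using on_coset by simp
      also have "\<dots> = the_elem (h ` c) \<otimes>\<^bsub>H\<^esub> the_elem (h ` d)" using e f EG on_coset by simp
      finally show "the_elem (h ` (c \<otimes>\<^bsub>(G Mod N)\<lparr>carrier := (#>) N ` E\<rparr>\<^esub> d)) =
          the_elem (h ` c) \<otimes>\<^bsub>H\<lparr>carrier := h ` E\<rparr>\<^esub> the_elem (h ` d)" by simp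
    qed
    show "bij_betw (\<lambda>c. the_elem (h ` c)) (carrier ((G Mod N)\<lparr>carrier := (#>) N ` E\<rparr>)) (carrier (H\<lparr>carrier := h ` E\<rparr>))"
    proof (rule bij_betw_imageI)
      show "inj_on (\<lambda>c. the_elem (h ` c)) (carrier ((G Mod N)\<lparr>carrier := (#>) N ` E\<rparr>))"
      proof (rule inj_onI)
        fix c d assume cd: "c \<in> carrier ((G Mod N)\<lparr>carrier := (#>) N ` E\<rparr>)" "d \<in> carrier ((G Mod N)\<lparr>carrier := (#>) N ` E\<rparr>)"
          and eq: "the_elem (h ` c) = the_elem (h ` d)"
        then have "c \<in> (#>) N ` E" "d \<in> (#>) N ` E" by simp_all
        then obtain e f where e: "e \<in> E" "c = N #> e" and f: "f \<in> E" "d = N #> f" by (elim imageE)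
        then have "h e = h f" using eq on_coset by simp
        then show "c = d" unfolding e(2) f(2) by (rule cosets_eq[OF e(1) f(1)])
      qed
      show "(\<lambda>c. the_elem (h ` c)) ` carrier ((G Mod N)\<lparr>carrier := (#>) N ` E\<rparr>) = carrier (H\<lparr>carrier := h ` E\<rparr>)"
        using on_coset by (simp add: image_image)
    qed
  qed
qed

locale equivariant_arrangement = reflection_group W + arrangement "reflecting_hyperplanes W" a
  for W :: "(complex^'n^'n) set" and a :: "(complex^'n) set \<Rightarrow> complex^'n \<Rightarrow> complex" +
  fixes G :: "(complex^'n^'n) set" and x :: "complex^'n"
  assumes compl_eq: "compl = hyperplane_complement W"
    and base: "x \<in> hyperplane_complement W"
    and G: "subgroup G (matrix_group W)"
    and equivariant: "\<lbrakk>g \<in> G; H \<in> reflecting_hyperplanes W\<rbrakk> \<Longrightarrow> a ((*v) g ` H) (g *v v) = a H v"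
begin

abbreviation "\<P> \<equiv> pure_braid_group W x"
abbreviation "\<B> \<equiv> braid_group W x"
abbreviation "\<K> \<equiv> pure_braid_commutators W x"

lemma in_W: "g \<in> G \<Longrightarrow> g \<in> W"
  using subgroup.subset[OF G] by auto

lemma lift_path_compl:
  assumes "lift_path x w p"
  shows "path p" "path_image p \<subseteq> compl" "pathstart p = x" "pathfinish p = w *v x"
  using assms by (simp_all add: lift_path_def compl_eq)

text \<open>The winding number induces a homomorphism from the pure braid group to an abelian group.\<close>

lemma loop_windings_on_derived:
  assumes H: "H \<in> \<A>" and p: "lift_path x (mat 1) p"
    and d: "loop_class (top_of_set X) x p \<in> derived \<P> (carrier \<P>)"
  shows "wn H p = 0"
proof -
  let ?cl = "loop_class (top_of_set X) x"
  \<comment> \<open>The winding number as a function of the homotopy class.\<close>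
  define f where "f c = wn H (SOME q. lift_path x (mat 1) q \<and> c = ?cl q)" for c
  have f: "f (?cl q) = wn H q" if q: "lift_path x (mat 1) q" for q
  proof -
    define r where "r = (SOME r. lift_path x (mat 1) r \<and> ?cl q = ?cl r)"
    have r: "lift_path x (mat 1) r \<and> ?cl q = ?cl r"
      unfolding r_def using q by (intro someI[of "\<lambda>r. lift_path x (mat 1) r \<and> ?cl q = ?cl r" q]) simp
    then have "braid x q = braid x r" using pure_braid_inclusion_class[OF q] pure_braid_inclusion_class[of x r] by simp
    then have "homotopic_paths X q r" using braid_eq_iff[OF q conjunct1[OF r]] by simp
    then have "wn H q = wn H r" using wn_homotopic[OF H] compl_eq by simp
    then show ?thesis by (simp add: f_def r_def)
  qed
  interpret i: group_hom \<P> \<B> "pure_braid_inclusion W x" by (rule pure_braid_inclusion_hom[OF base])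
  interpret C: comm_group complex_add using wn_functional[OF H] by (simp add: path_functional_def)
  have "f (c \<otimes>\<^bsub>\<P>\<^esub> c') = f c + f c'" if c: "c \<in> carrier \<P>" and c': "c' \<in> carrier \<P>" for c c'
  proof -
    obtain q where q: "lift_path x (mat 1) q" "c = ?cl q" using c by (auto simp: pure_braid_carrier_iff)
    obtain q' where q': "lift_path x (mat 1) q'" "c' = ?cl q'" using c' by (auto simp: pure_braid_carrier_iff)
    have "f (c \<otimes>\<^bsub>\<P>\<^esub> c') = wn H (q +++ q')"
      unfolding q(2) q'(2) pure_braid_mult(1)[OF q(1) q'(1)] by (rule f[OF pure_braid_mult(2)[OF q(1) q'(1)]])
    also have "\<dots> = wn H q + wn H q'"
      using lift_path_compl[OF q(1)] lift_path_compl[OF q'(1)] by (intro wn_join[OF H]) simp_all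
    finally show ?thesis using f[OF q(1)] f[OF q'(1)] q(2) q'(2) by simp
  qed
  then interpret f: group_hom \<P> complex_add f
    by (intro group_hom.intro group_hom_axioms.intro homI i.G.group_axioms C.group_axioms)
      (simp_all add: complex_add_def)
  have "f ` derived \<P> (carrier \<P>) = derived complex_add (f ` carrier \<P>)" by (rule f.derived_img[symmetric]) simp
  also have "\<dots> = {\<one>\<^bsub>complex_add\<^esub>}" by (rule C.derived_eq_singleton) auto
  finally have "f (?cl p) = 0" using d by (auto simp: complex_add_def)
  then show ?thesis using f[OF p] by simp
qed

text \<open>The class of \<open>p\<close> in the abelianization is the value at \<open>p\<close> of a path functional, which is trivial by
  \<open>zero_windings_imp_trivial\<close>.\<close>

lemma zero_windings_imp_derived:
  assumes p: "lift_path x (mat 1) p" and zero: "\<And>H. H \<in> \<A> \<Longrightarrow> wn H p = 0"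
  shows "loop_class (top_of_set X) x p \<in> derived \<P> (carrier \<P>)"
proof -
  interpret i: group_hom \<P> \<B> "pure_braid_inclusion W x" by (rule pure_braid_inclusion_hom[OF base])
  let ?D = "derived \<P> (carrier \<P>)" and ?c = "loop_class (top_of_set X) x p"
  obtain \<Phi> where \<Phi>: "path_functional (\<P> Mod ?D) X \<Phi>"
    and val: "\<forall>p\<in>loops_at (top_of_set X) x. \<Phi> p = ?D #>\<^bsub>\<P>\<^esub> loop_class (top_of_set X) x p"
    using abelianization_functional[OF path_connected_compl, of x] base
    unfolding compl_eq pure_braid_group_def by blast
  have "\<Phi> p = \<one>\<^bsub>\<P> Mod ?D\<^esub>"
    using \<Phi> lift_path_compl[OF p] zero by (intro zero_windings_imp_trivial) (simp_all add: compl_eq)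
  then have "?D #>\<^bsub>\<P>\<^esub> ?c = ?D" using val p by (simp add: pure_loop_iff FactGroup_def)
  moreover have "?c \<in> carrier \<P>" using p by (auto simp: pure_braid_carrier_iff)
  ultimately show ?thesis
    using i.G.coset_join1 i.G.derived_is_subgroup[of "carrier \<P>"] by blast
qed

lemma braid_in_commutators_iff:
  assumes p: "lift_path x (mat 1) p"
  shows "braid x p \<in> \<K> \<longleftrightarrow> (\<forall>H\<in>\<A>. wn H p = 0)"
proof
  interpret i: group_hom \<P> \<B> "pure_braid_inclusion W x" by (rule pure_braid_inclusion_hom[OF base])
  assume "braid x p \<in> \<K>"
  then obtain c where c: "c \<in> derived \<P> (carrier \<P>)" "braid x p = pure_braid_inclusion W x c"
    by (auto simp: pure_braid_commutators_def)
  then have "c \<in> carrier \<P>" using i.G.derived_in_carrier[of "carrier \<P>"] by blast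
  then obtain q where q: "lift_path x (mat 1) q" "c = loop_class (top_of_set X) x q" by (auto simp: pure_braid_carrier_iff)
  then have "braid x p = braid x q" using c(2) pure_braid_inclusion_class by simp
  then have "homotopic_paths compl p q" using braid_eq_iff[OF p q(1)] compl_eq by simp
  then show "\<forall>H\<in>\<A>. wn H p = 0" using wn_homotopic loop_windings_on_derived[OF _ q(1)] c(1) q(2) by simp
next
  assume "\<forall>H\<in>\<A>. wn H p = 0"
  then have "loop_class (top_of_set X) x p \<in> derived \<P> (carrier \<P>)" using zero_windings_imp_derived[OF p] by blast
  then show "braid x p \<in> \<K>"
    unfolding pure_braid_commutators_def pure_braid_inclusion_class[OF p, symmetric] by (rule imageI)
qed

text \<open>The normalization by \<open>2\<pi>i\<close> makes differences of logarithms comparable with winding numbers.\<close>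

definition logarithm :: "(complex^'n) set \<Rightarrow> complex" where
  "logarithm H = Ln (a H x) / (2 * of_real pi * \<i>)"

text \<open>Continuing the logarithm of the form of \<open>g H\<close> along \<open>p\<close> leads from its chosen value at \<open>x\<close> to a
  logarithm of the value at \<open>g x\<close>, which is also the value at \<open>x\<close> of the form of \<open>H\<close>. The condition
  asks that the chosen logarithm of the latter is reached.\<close>

definition calibrated :: "complex^'n^'n \<Rightarrow> (real \<Rightarrow> complex^'n) \<Rightarrow> bool" where
  "calibrated g p \<longleftrightarrow> g \<in> G \<and> lift_path x g p \<and>
     (\<forall>H\<in>\<A>. wn ((*v) g ` H) p = logarithm H - logarithm ((*v) g ` H))"

definition calibrated_braids :: "(real \<Rightarrow> (complex^'n) set) set set" where
  "calibrated_braids = {braid x p | g p. calibrated g p}"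

lemma exp_logarithm:
  assumes "H \<in> \<A>"
  shows "exp (2 * of_real pi * \<i> * logarithm H) = a H x"
proof -
  have "a H x \<noteq> 0" using base assms by (auto simp: compl_eq[symmetric] compl_def)
  then show ?thesis by (simp add: logarithm_def)
qed

lemma image_mem: "\<lbrakk>g \<in> G; H \<in> \<A>\<rbrakk> \<Longrightarrow> (*v) g ` H \<in> \<A>"
  using hyperplane_image_mem in_W by blast

text \<open>For any path \<open>p0\<close> from \<open>x\<close> to \<open>g x\<close> the condition holds up to integers, since both sides are logarithms
  of the same number. A loop \<open>l\<close> with these winding numbers, put in front of \<open>p0\<close>, corrects them.\<close>

lemma calibrated_path_exists:
  assumes g: "g \<in> G"
  shows "\<exists>p. calibrated g p"
proof -
  have gx: "g *v x \<in> X" using X_invariant in_W[OF g] base by blast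
  obtain p0 where p0: "path p0" "path_image p0 \<subseteq> compl" "pathstart p0 = x" "pathfinish p0 = g *v x"
    using path_connected_compl base gx unfolding path_connected_def compl_eq by blast
  have "\<exists>m::int. logarithm H - logarithm ((*v) g ` H) - wn ((*v) g ` H) p0 = of_int m" if H: "H \<in> \<A>" for H
  proof -
    let ?K = "(*v) g ` H" and ?e = "\<lambda>z. exp (2 * of_real pi * \<i> * z)"
    have K: "?K \<in> \<A>" by (rule image_mem[OF g H])
    have "?e (logarithm H) = a ?K (g *v x)" using exp_logarithm[OF H] equivariant[OF g H] by simp
    also have "\<dots> = ?e (wn ?K p0) * ?e (logarithm ?K)"
      using exp_wn[OF K p0(1,2)] exp_logarithm[OF K] p0(3,4) by simp
    finally have "?e (logarithm H - logarithm ?K - wn ?K p0) = 1"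
      by (simp add: right_diff_distrib exp_diff)
    then have "\<exists>n::int. Im (2 * of_real pi * \<i> * (logarithm H - logarithm ?K - wn ?K p0)) = of_int (2 * n) * pi
        \<and> Re (2 * of_real pi * \<i> * (logarithm H - logarithm ?K - wn ?K p0)) = 0"
      unfolding exp_eq_1 by blast
    then show ?thesis by (auto simp: complex_eq_iff)
  qed
  then obtain m :: "(complex^'n) set \<Rightarrow> int"
    where m: "\<And>H. H \<in> \<A> \<Longrightarrow> logarithm H - logarithm ((*v) g ` H) - wn ((*v) g ` H) p0 = of_int (m H)"
    by metis
  \<comment> \<open>The defect at \<open>g H\<close> is \<open>m H\<close>, so the hyperplane \<open>K = g H\<close> needs the winding number at \<open>g\<^sup>-\<^sup>1 K\<close>.\<close>
  define m' where "m' K = m ((*v) (matrix_inv g) ` K)" for K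
  obtain l where l: "path l" "path_image l \<subseteq> compl" "pathstart l = x" "pathfinish l = x" "\<forall>H\<in>\<A>. wn H l = of_int (m' H)"
    using winding_vectors_realized[of x m'] base compl_eq by blast
  have "wn ((*v) g ` H) (l +++ p0) = logarithm H - logarithm ((*v) g ` H)" if H: "H \<in> \<A>" for H
  proof -
    have "(*v) (matrix_inv g) ` (*v) g ` H = H" by (simp add: image_image inv_vec[OF in_W[OF g]])
    then have "wn ((*v) g ` H) l = of_int (m H)" using l(5) image_mem[OF g H] by (simp add: m'_def)
    then show ?thesis using wn_join[OF image_mem[OF g H] l(1,2) p0(1,2)] l(4) p0(3) m[OF H] by (simp add: algebra_simps)
  qed
  moreover have "lift_path x g (l +++ p0)"
    using l p0 in_W[OF g] by (simp add: lift_path_def compl_eq[symmetric] path_image_join)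
  ultimately show ?thesis using g by (auto simp: calibrated_def)
qed

lemma wn_translate:
  assumes "g \<in> G" "H \<in> \<A>"
  shows "wn ((*v) g ` H) ((*v) g \<circ> p) = wn H p"
proof -
  have "a ((*v) g ` H) \<circ> ((*v) g \<circ> p) = a H \<circ> p" using equivariant[OF assms] by (simp add: fun_eq_iff)
  then show ?thesis by (simp add: wn_def)
qed

text \<open>The translate of \<open>q\<close> by \<open>g\<close> has the same winding numbers as \<open>q\<close> up to the permutation of hyperplanes,
  so the differences of logarithms telescope.\<close>

lemma calibrated_mult:
  assumes p: "calibrated g p" and q: "calibrated h q"
  shows "calibrated (g ** h) (p +++ ((*v) g \<circ> q))"
proof -
  have g: "g \<in> G" "lift_path x g p" and h: "h \<in> G" "lift_path x h q" using p q by (simp_all add: calibrated_def)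
  have "g ** h \<in> G" using subgroup.m_closed[OF G g(1) h(1)] by (simp add: general_linear_def)
  moreover have "wn ((*v) (g ** h) ` H) (p +++ ((*v) g \<circ> q)) = logarithm H - logarithm ((*v) (g ** h) ` H)"
    if H: "H \<in> \<A>" for H
  proof -
    let ?K = "(*v) h ` H"
    have K: "?K \<in> \<A>" by (rule image_mem[OF h(1) H])
    have e: "(*v) (g ** h) ` H = (*v) g ` ?K" by (simp add: image_image matrix_vector_mul_assoc)
    have "wn ((*v) g ` ?K) (p +++ ((*v) g \<circ> q)) = wn ((*v) g ` ?K) p + wn ((*v) g ` ?K) ((*v) g \<circ> q)"
      using lift_path_compl[OF g(2)] lift_path_compl[OF h(2)] translate_path[OF in_W[OF g(1)], of q] compl_eq
      by (intro wn_join[OF image_mem[OF g(1) K]]) (simp_all add: pathstart_compose)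
    also have "\<dots> = (logarithm ?K - logarithm ((*v) g ` ?K)) + (logarithm H - logarithm ?K)"
      unfolding wn_translate[OF g(1) K] using p q K H by (simp add: calibrated_def)
    finally show ?thesis by (simp add: e)
  qed
  ultimately show ?thesis using braid_mult(1)[OF g(2) h(2)] by (simp add: calibrated_def)
qed

lemma calibrated_inv:
  assumes p: "calibrated g p"
  shows "calibrated (matrix_inv g) ((*v) (matrix_inv g) \<circ> reversepath p)"
proof -
  interpret G: finite_matrix_group G by (rule finite_matrix_group_subgroup[OF G])
  have g: "g \<in> G" "lift_path x g p" using p by (simp_all add: calibrated_def)
  note ig = G.inv_mem[OF g(1)]
  have "wn ((*v) (matrix_inv g) ` H) ((*v) (matrix_inv g) \<circ> reversepath p) =
      logarithm H - logarithm ((*v) (matrix_inv g) ` H)" if H: "H \<in> \<A>" for H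
  proof -
    let ?K = "(*v) (matrix_inv g) ` H"
    have K: "?K \<in> \<A>" by (rule image_mem[OF ig H])
    have e: "(*v) g ` ?K = H" by (simp add: image_image G.inv_vec[OF g(1)])
    have "wn ?K ((*v) (matrix_inv g) \<circ> reversepath p) = - wn H p"
      unfolding wn_translate[OF ig H] using lift_path_compl[OF g(2)] by (intro wn_reversepath[OF H])
    also have "wn H p = logarithm ?K - logarithm H" using p K e by (force simp: calibrated_def)
    finally show ?thesis by (simp only: minus_diff_eq)
  qed
  then show ?thesis using ig braid_inv(1)[OF base g(2)] unfolding calibrated_def by blast
qed

lemma subgroup_calibrated_braids: "subgroup calibrated_braids \<B>"
proof -
  interpret B: group \<B> by (rule group_braid_group[OF base])
  interpret G: finite_matrix_group G by (rule finite_matrix_group_subgroup[OF G])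
  show ?thesis
  proof (rule B.subgroupI)
    show "calibrated_braids \<subseteq> carrier \<B>"
      unfolding calibrated_braids_def calibrated_def using braid_carrier_iff[OF base] by blast
    show "calibrated_braids \<noteq> {}"
      unfolding calibrated_braids_def using calibrated_path_exists[OF G.one_mem] by blast
  next
    fix b assume "b \<in> calibrated_braids"
    then obtain g p where p: "calibrated g p" "b = braid x p" by (auto simp: calibrated_braids_def)
    then have "lift_path x g p" by (simp add: calibrated_def)
    then show "inv\<^bsub>\<B>\<^esub> b \<in> calibrated_braids"
      unfolding p(2) using braid_inv(2)[OF base] calibrated_inv[OF p(1)] by (auto simp: calibrated_braids_def)
  next
    fix b c assume "b \<in> calibrated_braids" "c \<in> calibrated_braids"
    then obtain g p h q where p: "calibrated g p" "b = braid x p" and q: "calibrated h q" "c = braid x q"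
      by (auto simp: calibrated_braids_def)
    then have "lift_path x g p" "lift_path x h q" by (simp_all add: calibrated_def)
    then show "b \<otimes>\<^bsub>\<B>\<^esub> c \<in> calibrated_braids"
      unfolding p(2) q(2) using braid_mult(2) calibrated_mult[OF p(1) q(1)] by (auto simp: calibrated_braids_def)
  qed
qed

lemma projection_calibrated_braids: "braid_projection W x ` calibrated_braids = G"
proof -
  have pr: "braid_projection W x (braid x p) = g" if "calibrated g p" for g p
    using braid_projection_braid[OF base] that by (simp add: calibrated_def)
  show ?thesis
  proof (intro equalityI subsetI)
    fix g assume "g \<in> braid_projection W x ` calibrated_braids"
    then show "g \<in> G" using pr by (auto simp: calibrated_braids_def calibrated_def)
  next
    fix g assume "g \<in> G"
    then obtain p where "calibrated g p" using calibrated_path_exists by blast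
    then show "g \<in> braid_projection W x ` calibrated_braids"
      using pr by (auto simp: calibrated_braids_def image_iff intro!: exI[of _ "braid x p"])
  qed
qed

text \<open>For \<open>g = 1\<close> the two logarithms in the condition coincide.\<close>

lemma pure_calibrated_braids:
  "calibrated_braids \<inter> kernel \<B> (matrix_group W) (braid_projection W x) \<subseteq> \<K>"
proof
  fix b assume "b \<in> calibrated_braids \<inter> kernel \<B> (matrix_group W) (braid_projection W x)"
  then obtain g p where p: "calibrated g p" "b = braid x p" and "braid_projection W x b = mat 1"
    by (auto simp: calibrated_braids_def kernel_def general_linear_def)
  moreover have "lift_path x g p" using p(1) by (simp add: calibrated_def)
  ultimately have "g = mat 1" using braid_projection_braid[OF base] by simp
  then have "lift_path x (mat 1) p" "\<forall>H\<in>\<A>. wn H p = 0" using p(1) by (simp_all add: calibrated_def)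
  then show "b \<in> \<K>" using p(2) braid_in_commutators_iff by simp
qed

lemma commutators_subset_kernel: "\<K> \<subseteq> kernel \<B> (matrix_group W) (braid_projection W x)"
proof -
  interpret i: group_hom \<P> \<B> "pure_braid_inclusion W x" by (rule pure_braid_inclusion_hom[OF base])
  show ?thesis
    unfolding pure_braid_commutators_def pure_braids_eq_kernel[OF base, symmetric]
    by (rule image_mono) (rule i.G.derived_in_carrier, simp)
qed

theorem finite_lift:
  "\<exists>H. subgroup H (relative_abelianization W x) \<and> finite H \<and>
     relative_abelianization_projection W x \<in> iso ((relative_abelianization W x)\<lparr>carrier := H\<rparr>) (matrix_group G)"
proof -
  let ?H = "(#>\<^bsub>\<B>\<^esub>) \<K> ` calibrated_braids"
  interpret q: group_hom \<B> "matrix_group W" "braid_projection W x" by (rule braid_projection_hom[OF base])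
  note lift = q.iso_onto_image_mod_normal[OF pure_braid_commutators_normal[OF base] commutators_subset_kernel
      subgroup_calibrated_braids pure_calibrated_braids]
  have sub: "subgroup ?H (relative_abelianization W x)"
    using lift(1) by (simp add: relative_abelianization_def)
  have iso: "relative_abelianization_projection W x \<in> iso ((relative_abelianization W x)\<lparr>carrier := ?H\<rparr>) (matrix_group G)"
    using lift(2) unfolding projection_calibrated_braids
    by (simp add: relative_abelianization_def relative_abelianization_projection_def[abs_def])
  have "bij_betw (relative_abelianization_projection W x) ?H G" using iso by (simp add: iso_def)
  moreover have "finite G" using finite_matrix_group_subgroup[OF G] by (simp add: finite_matrix_group_def)
  ultimately have "finite ?H" using bij_betw_finite by blast
  then show ?thesis using sub iso by blast
qed

end

theorem proposition3p9:
  fixes W G :: "(complex^'n^'n) set" and x :: "complex^'n"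
  assumes "complex_reflection_group W"
    and "x \<in> hyperplane_complement W"
    and "group_center (matrix_group W) = {mat 1}"
    and "subgroup G (matrix_group W)" and "finite G"
    and "acts_freely_by_conjugation G (distinguished_reflections W)"
  shows "\<exists>H. subgroup H (relative_abelianization W x) \<and> finite H \<and>
           relative_abelianization_projection W x
             \<in> iso ((relative_abelianization W x)\<lparr>carrier := H\<rparr>) (matrix_group G)"
proof -
  interpret reflection_group W by (rule reflection_group.intro) fact
  obtain a where a: "\<forall>H\<in>\<A>. linear_form (a H) \<and> H = {v. a H v = 0} \<and> (\<exists>v. a H v \<noteq> 0)"
    and inv: "\<forall>g\<in>G. \<forall>H\<in>\<A>. \<forall>v. a ((*v) g ` H) (g *v v) = a H v"
    using equivariant_forms[OF assms(4,6)] by blast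
  interpret equivariant_arrangement W a G x
    by (intro equivariant_arrangement.intro equivariant_arrangement_axioms.intro arrangement_of_forms[OF a]
        reflection_group_axioms assms(2,4)) (use inv in blast)
  show ?thesis by (rule finite_lift)
qed

end
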